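(* Let $A$ be a $2\times 2$ integer matrix with eigenvalues $\lambda_1,\lambda_2$ satisfying $|\lambda_2|>1>|\lambda_1|>0$. Let $T\colon\mathbb{T}^2\to\mathbb{T}^2$, $T(x)=Ax \pmod 1$, let $\tau>0$, and let $$R_\tau=\{\,x\in\mathbb{T}^2 : T^n(x)\in B(x,e^{-n\tau})\ \text{for infinitely many } n\in\mathbb{N}\,\}.$$ Then $$\dim_{\mathrm H} R_\tau = s_0,\qquad\text{where}\qquad s_0=\min\Bigl\{\frac{2\log|\lambda_2|}{\tau+\log|\lambda_2|},\ \frac{\log|\lambda_2|}{\tau}\Bigr\}.$$ Moreover, $R_\tau\in\mathscr{G}^{s_0}(\mathbb{T}^2)$.
   Context: $\mathbb{T}^2=\mathbb{R}^2/\mathbb{Z}^2$ is equipped with the metric induced by the Euclidean metric on $\mathbb{R}^2$; $B(x,r)$ is the open ball with center $x$ and radius $r$; $\dim_{\mathrm H}$ denotes Hausdorff dimension. Large intersection classes (Falconer): for $s>0$, $\mathscr{G}^s(\mathbb{R}^d)$ is the class of $G_\delta$-subsets $F$ of $\mathbb{R}^d$ such that $\dim_{\mathrm H}\bigl(\bigcap_{i=1}^\infty f_i(F)\bigr)\ge s$ for every countable sequence $(f_i)_{i=1}^\infty$ of similarities of $\mathbb{R}^d$. (This class is closed under countable intersections.) The class $\mathscr{G}^s(\mathbb{T}^d)$ is obtained by restricting sets in $\mathscr{G}^s(\mathbb{R}^d)$ to $\mathbb{T}^d$: a subset of $\mathbb{T}^d$, with $\mathbb{T}^d$ identified with $[0,1)^d$,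 belongs to $\mathscr{G}^s(\mathbb{T}^d)$ if it is the restriction to $[0,1)^d$ of a set in $\mathscr{G}^s(\mathbb{R}^d)$. *)

theory Defs
  imports "HOL-Analysis.Analysis"
begin

section \<open>Hausdorff dimension\<close>

text \<open>
  The contribution \<open>(diam U)\<^sup>s\<close> of a covering set, with \<open>0\<^sup>0 = 1\<close> for nonempty \<open>U\<close> (whereas
  \<open>0 powr 0 = 0\<close>), so that the 0-dimensional measure is counting measure.
\<close>

definition hausdorff_gauge :: "real \<Rightarrow> 'a::metric_space set \<Rightarrow> real" where
  "hausdorff_gauge s U =
     (if U = {} then 0 else if s = 0 then 1 else diameter U powr s)"

text \<open>Boundedness is required because \<^const>\<open>diameter\<close> is unspecified on unbounded sets.\<close>

definition hausdorff_premeasure :: "real \<Rightarrow> real \<Rightarrow> 'a::metric_space set \<Rightarrow> ennreal" where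
  "hausdorff_premeasure s \<delta> F =
     Inf {(\<Sum>i. ennreal (hausdorff_gauge s (U i))) | U :: nat \<Rightarrow> 'a set.
            F \<subseteq> (\<Union>i. U i) \<and> (\<forall>i. bounded (U i) \<and> diameter (U i) \<le> \<delta>)}"

definition hausdorff_measure :: "real \<Rightarrow> 'a::metric_space set \<Rightarrow> ennreal" where
  "hausdorff_measure s F = (SUP \<delta>\<in>{0<..}. hausdorff_premeasure s \<delta> F)"

definition hausdorff_dim :: "'a::metric_space set \<Rightarrow> ereal" where
  "hausdorff_dim F = (INF s\<in>{s. 0 \<le> s \<and> hausdorff_measure s F = 0}. ereal s)"


section \<open>The torus as a metric space\<close>

definition torus_rel :: "real ^ 'd::finite \<Rightarrow> real ^ 'd \<Rightarrow> bool" where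
  "torus_rel x y \<longleftrightarrow> (\<forall>i. x $ i - y $ i \<in> \<int>)"

lemma equivp_torus_rel: "equivp torus_rel"
proof (rule equivpI)
  show "reflp torus_rel"
    by (simp add: reflp_def torus_rel_def)
  show "symp torus_rel"
    unfolding symp_def torus_rel_def by (metis Ints_minus minus_diff_eq)
  show "transp torus_rel"
    unfolding transp_def torus_rel_def by (metis Ints_add diff_add_cancel add_diff_eq)
qed

quotient_type (overloaded) 'd torus = "real ^ 'd::finite" / torus_rel
  morphisms rep_torus to_torus
  by (rule equivp_torus_rel)

lemma to_torus_eq_iff: "to_torus x = to_torus y \<longleftrightarrow> (\<forall>i. x $ i - y $ i \<in> \<int>)"
  by (simp add: torus.abs_eq_iff torus_rel_def)

lemma to_torus_surj: "\<exists>x. X = to_torus x"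
  by (metis Quotient_torus Quotient_abs_rep)

definition torus_dist :: "'d::finite torus \<Rightarrow> 'd torus \<Rightarrow> real" where
  "torus_dist X Y = Inf {dist x y | x y. to_torus x = X \<and> to_torus y = Y}"

lemma torus_dist_le: "torus_dist (to_torus x) (to_torus y) \<le> dist x y"
  unfolding torus_dist_def by (rule cInf_lower) (auto intro!: bdd_belowI[of _ 0])

lemma torus_dist_nonneg: "0 \<le> torus_dist X Y"
  unfolding torus_dist_def using to_torus_surj[of X] to_torus_surj[of Y]
  by (intro cInf_greatest) auto

lemma torus_dist_approx:
  assumes "0 < e"
  shows "\<exists>y. to_torus y = Y \<and> dist x y < torus_dist (to_torus x) Y + e"
proof -
  let ?S = "{dist x' y | x' y. to_torus x' = to_torus x \<and> to_torus y = Y}"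
  have "?S \<noteq> {}"
    using to_torus_surj[of Y] by auto
  moreover have "Inf ?S < torus_dist (to_torus x) Y + e"
    using assms by (simp add: torus_dist_def)
  ultimately obtain x' y where *: "to_torus x' = to_torus x" "to_torus y = Y"
      "dist x' y < torus_dist (to_torus x) Y + e"
    using cInf_lessD[of ?S] by blast
  have "to_torus (y + (x - x')) = to_torus y"
    using *(1) unfolding to_torus_eq_iff by (auto, metis Ints_minus minus_diff_eq)
  moreover have "dist x (y + (x - x')) = dist x' y"
    by (simp add: dist_norm)
  ultimately show ?thesis
    using * by metis
qed

lemma torus_dist_eq_0: "torus_dist X Y = 0 \<longleftrightarrow> X = Y"
proof
  assume "X = Y"
  obtain x where "X = to_torus x"
    using to_torus_surj by blast
  then show "torus_dist X Y = 0"
    using torus_dist_le[of x x] torus_dist_nonneg[of X Y] \<open>X = Y\<close> by simp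
next
  assume 0: "torus_dist X Y = 0"
  obtain x y where xy: "X = to_torus x" "Y = to_torus y"
    using to_torus_surj by metis
  have "x $ i - y $ i \<in> \<int>" for i
  proof -
    have "\<exists>m\<in>\<int>. dist m (x $ i - y $ i) < e" if e: "0 < e" for e :: real
    proof -
      obtain z where z: "to_torus z = Y" "dist x z < e"
        using torus_dist_approx[OF e, of Y x] 0 xy by auto
      have "z $ i - y $ i \<in> \<int>"
        using z xy by (simp add: to_torus_eq_iff)
      moreover have "dist (z $ i - y $ i) (x $ i - y $ i) \<le> dist x z"
        using dist_vec_nth_le[of x i z] by (simp add: dist_real_def abs_minus_commute)
      ultimately show ?thesis
        using z(2) by (intro bexI[of _ "z $ i - y $ i"]) auto
    qed
    then have "x $ i - y $ i \<in> closure \<int>"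
      unfolding closure_approachable by blast
    moreover have "closure \<int> = (\<int> :: real set)"
      by (rule closure_closed[OF closed_Ints])
    ultimately show ?thesis
      by simp
  qed
  then show "X = Y"
    using xy by (simp add: to_torus_eq_iff)
qed

lemma torus_dist_commute: "torus_dist X Y = torus_dist Y X"
proof -
  have "{dist x y | x y. to_torus x = X \<and> to_torus y = Y}
      = {dist y x | y x. to_torus y = Y \<and> to_torus x = X}"
    by (subst dist_commute) blast
  then show ?thesis
    by (simp only: torus_dist_def)
qed

lemma torus_dist_triangle: "torus_dist X Z \<le> torus_dist X Y + torus_dist Y Z"
proof (rule field_le_epsilon)
  fix e :: real assume "0 < e"
  then have e: "0 < e / 2" by simp
  obtain x where x: "X = to_torus x"
    using to_torus_surj by blast
  obtain y where y: "to_torus y = Y" "dist x y < torus_dist X Y + e / 2"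
    using torus_dist_approx[OF e, of Y x] x by auto
  obtain z where z: "to_torus z = Z" "dist y z < torus_dist Y Z + e / 2"
    using torus_dist_approx[OF e, of Z y] y by auto
  have "torus_dist X Z \<le> dist x z"
    using torus_dist_le[of x z] x z by simp
  also have "\<dots> \<le> dist x y + dist y z"
    by (rule dist_triangle)
  finally show "torus_dist X Z \<le> torus_dist X Y + torus_dist Y Z + e"
    using y z by simp
qed

instantiation torus :: (finite) metric_space
begin

definition dist_torus :: "'a torus \<Rightarrow> 'a torus \<Rightarrow> real" where
  "dist_torus = torus_dist"

definition uniformity_torus :: "('a torus \<times> 'a torus) filter" where
  "uniformity_torus = (INF e\<in>{0<..}. principal {(x, y). dist x y < e})"

definition open_torus :: "'a torus set \<Rightarrow> bool" where
  "open_torus U = (\<forall>x\<in>U. eventually (\<lambda>(x', y). x' = x \<longrightarrow> y \<in> U) uniformity)"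

instance
proof
  show "dist x y \<le> dist x z + dist y z" for x y z :: "'a torus"
    unfolding dist_torus_def by (metis torus_dist_commute torus_dist_triangle)
qed (simp_all add: dist_torus_def torus_dist_eq_0 uniformity_torus_def open_torus_def)

end


section \<open>Large intersection classes\<close>

definition similarity :: "('a::metric_space \<Rightarrow> 'a) \<Rightarrow> bool" where
  "similarity f \<longleftrightarrow> (\<exists>c>0. \<forall>x y. dist (f x) (f y) = c * dist x y)"

definition large_intersection :: "real \<Rightarrow> (real ^ 'd::finite) set set" where
  "large_intersection s =
     {F. gdelta F \<and>
         (\<forall>f :: nat \<Rightarrow> real ^ 'd \<Rightarrow> real ^ 'd.
            (\<forall>i. similarity (f i)) \<longrightarrow> ereal s \<le> hausdorff_dim (\<Inter>i. f i ` F))}"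

definition unit_cell :: "(real ^ 'd::finite) set" where
  "unit_cell = {x. \<forall>i. 0 \<le> x $ i \<and> x $ i < 1}"

lemma bij_betw_to_torus: "bij_betw to_torus (unit_cell :: (real ^ 'd::finite) set) UNIV"
proof (rule bij_betw_imageI)
  show "inj_on to_torus (unit_cell :: (real ^ 'd) set)"
  proof (rule inj_onI)
    fix x y :: "real ^ 'd"
    assume xy: "x \<in> unit_cell" "y \<in> unit_cell" "to_torus x = to_torus y"
    have "x $ i = y $ i" for i
    proof -
      have "x $ i - y $ i \<in> \<int>"
        using xy(3) by (simp add: to_torus_eq_iff)
      moreover have "\<bar>x $ i - y $ i\<bar> < 1"
        using xy(1,2)[unfolded unit_cell_def mem_Collect_eq, rule_format, of i] by linarith
      ultimately show ?thesis
        using Ints_nonzero_abs_less1 by fastforce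
    qed
    then show "x = y"
      by (simp add: vec_eq_iff)
  qed
  have "X \<in> to_torus ` unit_cell" for X :: "'d torus"
  proof -
    obtain x where x: "X = to_torus x"
      using to_torus_surj by blast
    let ?y = "(\<chi> i. frac (x $ i)) :: real ^ 'd"
    have "X = to_torus ?y"
      unfolding x to_torus_eq_iff by (simp add: frac_def)
    moreover have "?y \<in> unit_cell"
      by (simp add: unit_cell_def frac_lt_1)
    ultimately show ?thesis
      by blast
  qed
  then show "to_torus ` (unit_cell :: (real ^ 'd) set) = UNIV"
    by blast
qed

definition large_intersection_torus :: "real \<Rightarrow> 'd::finite torus set set" where
  "large_intersection_torus s = {to_torus ` (F \<inter> unit_cell) | F. F \<in> large_intersection s}"


section \<open>Recurrence for integer matrix maps\<close>

lift_definition torus_map :: "int ^ 'd ^ 'd \<Rightarrow> 'd::finite torus \<Rightarrow> 'd torus"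
  is "\<lambda>A x. map_matrix real_of_int A *v x"
proof -
  fix A :: "int ^ 'd ^ 'd" and x y :: "real ^ 'd"
  assume *: "torus_rel x y"
  have "(map_matrix real_of_int A *v x) $ i - (map_matrix real_of_int A *v y) $ i
      = (\<Sum>j\<in>UNIV. real_of_int (A $ i $ j) * (x $ j - y $ j))" for i
    by (simp add: matrix_vector_mult_def sum_subtractf right_diff_distrib)
  then show "torus_rel (map_matrix real_of_int A *v x) (map_matrix real_of_int A *v y)"
    using * unfolding torus_rel_def by (auto intro!: Ints_sum Ints_mult)
qed

definition eigenvalue :: "complex ^ 'n ^ 'n \<Rightarrow> complex \<Rightarrow> bool" where
  "eigenvalue M l \<longleftrightarrow> (\<exists>v. v \<noteq> 0 \<and> M *v v = l *s v)"

definition recurrent_set :: "int ^ 'd ^ 'd \<Rightarrow> real \<Rightarrow> 'd::finite torus set" where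
  "recurrent_set A \<tau> =
     {x. \<exists>\<^sub>\<infinity>n. (torus_map A ^^ n) x \<in> ball x (exp (- real n * \<tau>))}"

end

theory Submission
  imports Defs
begin

text \<open>
  Let \<open>P\<^sub>n\<close> be the set of all \<open>p\<close> in the plane with \<open>A\<^sup>n p - p\<close> integral; these are the points whose
  classes return exactly at time \<open>n\<close>. Since \<open>\<bar>\<lambda>\<^sub>1\<bar> \<noteq> \<bar>\<lambda>\<^sub>2\<bar>\<close>, both eigenvalues are real, and since
  \<open>0 < \<bar>\<lambda>\<^sub>1\<bar> < 1\<close> they are irrational. In the coordinates \<open>u\<close>, \<open>v\<close> given by left eigenvectors, \<open>A\<^sup>n - 1\<close>
  multiplies \<open>u\<close> by \<open>\<lambda>\<^sub>2\<^sup>n - 1\<close> and \<open>v\<close> by \<open>\<lambda>\<^sub>1\<^sup>n - 1\<close>. So the points that return within \<open>e\<^sup>-\<^sup>n\<^sup>\<tau>\<close> at time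
  \<open>n\<close> form, up to constant factors, the boxes of side \<open>e\<^sup>-\<^sup>n\<^sup>\<tau> / \<bar>\<lambda>\<^sub>2\<bar>\<^sup>n\<close> in \<open>u\<close> and \<open>e\<^sup>-\<^sup>n\<^sup>\<tau>\<close> in \<open>v\<close> around the
  points of the lattice \<open>P\<^sub>n\<close>, whose covolume is of order \<open>\<bar>\<lambda>\<^sub>2\<bar>\<^sup>-\<^sup>n\<close>.
  
  The arithmetic input is \<open>uv_lattice_ge_1\<close>: \<open>\<bar>u m\<bar> * \<bar>v m\<bar> \<ge> 1\<close> for every nonzero integer vector \<open>m\<close>, because
  \<open>u m * v m\<close> is the value of an integral binary quadratic form without rational zeros. Hence a
  box of half-sides \<open>U\<close>, \<open>V\<close> contains at most \<open>1 + 4 U V / covolume\<close> points of \<open>P\<^sub>n\<close>, whatever its shape.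
  
  The upper bound covers every box by one set of diameter about \<open>e\<^sup>-\<^sup>n\<^sup>\<tau>\<close>, which gives
  \<open>ln \<bar>\<lambda>\<^sub>2\<bar> / \<tau>\<close>, or by about \<open>\<bar>\<lambda>\<^sub>2\<bar>\<^sup>n\<close> sets of diameter about \<open>e\<^sup>-\<^sup>n\<^sup>\<tau> / \<bar>\<lambda>\<^sub>2\<bar>\<^sup>n\<close>, which gives
  \<open>2 ln \<bar>\<lambda>\<^sub>2\<bar> / (\<tau> + ln \<bar>\<lambda>\<^sub>2\<bar>)\<close>.
  
  The lower bound and the large intersection property have a common source. Call an open set \<open>V\<close>
  ubiquitous with exponent \<open>s\<^sub>0\<close> if Lebesgue measure can be moved into \<open>V\<close> over arbitrarily small
  distances, tile by tile, such that a ball of radius \<open>r\<close> receives at most \<open>C r\<^sup>s\<^sup>0\<close> with \<open>C\<close> independent of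
  the distance. Let \<open>s < s\<^sub>0\<close>, and let \<open>\<mu>\<close> be a measure of bounded density with \<open>\<mu> (ball x r) \<le> r\<^sup>s\<close>. Moving \<open>\<mu>\<close> into \<open>V\<close>
  in this way nearly preserves the inequality: on large balls as the mass moves very little, and on small balls
  as \<open>C r\<^sup>s\<^sup>0\<close> times the density bound is at most \<open>r\<^sup>s\<close> (\<open>frostman_step\<close>). Repeating this with countably many ubiquitous sets
  produces a Cantor set in their intersection on which the mass distribution
  principle yields dimension at least \<open>s\<^sub>0\<close> (\<open>hausdorff_dim_Inter_ubiquitous\<close>).
  
  For every \<open>N\<close> the union over \<open>n \<ge> N\<close> of the return sets is ubiquitous with exponent \<open>s\<^sub>0\<close>
  (\<open>ubiquitous_near_return\<close>): the tiles are the translates of a fundamental domain of \<open>P\<^sub>n\<close>, with one point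
  of \<open>P\<^sub>n\<close> each, built from a basis of the integer vectors that lies close to the line \<open>v = 0\<close>,
  so that they become small in both directions; the mass estimate is the counting bound above.
  Ubiquity is preserved by similarities (\<open>ubiquitous_similarity_image\<close>), and the images under \<open>f i\<close> of
  the lifted recurrence set are countable intersections of such images. The dimension on the torus itself follows
  because the projection is isometric on a small ball.
\<close>

section \<open>Bounding Hausdorff dimension\<close>

lemma hausdorff_gauge_nonneg [simp]: "0 \<le> hausdorff_gauge s U"
  by (simp add: hausdorff_gauge_def)

lemma hausdorff_gauge_mono:
  assumes "0 \<le> s" "V \<noteq> {} \<Longrightarrow> U \<noteq> {}" "bounded V" "diameter V \<le> diameter U"
  shows "hausdorff_gauge s V \<le> hausdorff_gauge s U"
  using assms diameter_ge_0[of V] by (auto simp: hausdorff_gauge_def intro: powr_mono2)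

lemma hausdorff_gauge_antimono_exponent:
  assumes "0 \<le> t" "t \<le> s" "bounded U" "diameter U \<le> 1"
  shows "hausdorff_gauge s U \<le> hausdorff_gauge t U"
proof (cases "diameter U = 0")
  case True then show ?thesis using assms by (auto simp: hausdorff_gauge_def)
next
  case False
  then have "0 < diameter U" using diameter_ge_0[OF assms(3)] by linarith
  then have "diameter U powr s \<le> diameter U powr t"
    using assms by (intro powr_mono') auto
  moreover have "diameter U powr s \<le> 1"
    using assms \<open>0 < diameter U\<close> by (intro powr_le1) auto
  ultimately show ?thesis using assms \<open>0 < diameter U\<close> by (auto simp: hausdorff_gauge_def)
qed

lemma hausdorff_premeasure_le:
  assumes "F \<subseteq> (\<Union>i. U i)" "\<And>i. bounded (U i)" "\<And>i. diameter (U i) \<le> \<delta>"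
  shows "hausdorff_premeasure s \<delta> F \<le> (\<Sum>i. ennreal (hausdorff_gauge s (U i)))"
  unfolding hausdorff_premeasure_def using assms by (intro Inf_lower) auto

lemma
  fixes S :: "'a::metric_space set"
  assumes "\<And>x y. x \<in> S \<Longrightarrow> y \<in> S \<Longrightarrow> dist x y \<le> d" "0 \<le> d"
  shows bounded_of_dist_le: "bounded S" and diameter_le_of_dist_le: "diameter S \<le> d"
proof -
  show "bounded S" using assms(1) unfolding bounded_two_points by blast
  show "diameter S \<le> d"
  proof (cases "S = {}")
    case False
    have "dist x y \<le> d" if "x \<in> S" "y \<in> S" for x y using that by (rule assms(1))
    then have "(SUP (x, y)\<in>S \<times> S. dist x y) \<le> d"
      using False by (intro cSUP_least) (simp_all add: split_def mem_Times_iff)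
    then show ?thesis using False by (simp add: diameter_def)
  qed (use assms(2) in simp)
qed

lemma hausdorff_measure_expanding_image:
  assumes "0 \<le> t" and h: "\<And>x y. x \<in> S \<Longrightarrow> y \<in> S \<Longrightarrow> dist x y \<le> dist (h x) (h y)"
  shows "hausdorff_measure t S \<le> hausdorff_measure t (h ` S)"
proof -
  have "hausdorff_premeasure t \<delta> S \<le> hausdorff_premeasure t \<delta> (h ` S)" if "0 < \<delta>" for \<delta>
    unfolding hausdorff_premeasure_def[of t \<delta> "h ` S"]
  proof (rule Inf_greatest, clarsimp)
    fix U :: "nat \<Rightarrow> _ set"
    assume U: "h ` S \<subseteq> \<Union> (range U)" "\<forall>i. bounded (U i) \<and> diameter (U i) \<le> \<delta>"
    define V where "V i = {x \<in> S. h x \<in> U i}" for i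
    have d: "dist x y \<le> diameter (U i)" if "x \<in> V i" "y \<in> V i" for x y i
      using that h[of x y] diameter_bounded_bound[of "U i" "h x" "h y"] U(2)
      unfolding V_def by fastforce
    have d0: "0 \<le> diameter (U i)" for i using U(2) diameter_ge_0 by auto
    have bV: "bounded (V i)" for i by (rule bounded_of_dist_le[OF d d0])
    have dV: "diameter (V i) \<le> diameter (U i)" for i by (rule diameter_le_of_dist_le[OF d d0])
    have "hausdorff_premeasure t \<delta> S \<le> (\<Sum>i. ennreal (hausdorff_gauge t (V i)))"
    proof (rule hausdorff_premeasure_le)
      show "S \<subseteq> (\<Union>i. V i)" using U(1) by (auto simp: V_def)
      show "diameter (V i) \<le> \<delta>" for i using dV[of i] U(2) by (meson order_trans)
    qed (rule bV)
    also have "\<dots> \<le> (\<Sum>i. ennreal (hausdorff_gauge t (U i)))"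
      using bV dV \<open>0 \<le> t\<close>
      by (intro suminf_le ennreal_leI hausdorff_gauge_mono) (auto simp: V_def)
    finally show "hausdorff_premeasure t \<delta> S \<le> (\<Sum>i. ennreal (hausdorff_gauge t (U i)))" .
  qed
  then show ?thesis unfolding hausdorff_measure_def by (intro SUP_mono) auto
qed

text \<open>
  Pulling a cover of the image back to \<open>S\<close> does not increase diameters.
\<close>

lemma hausdorff_dim_expanding_image:
  assumes "\<And>x y. x \<in> S \<Longrightarrow> y \<in> S \<Longrightarrow> dist x y \<le> dist (h x) (h y)"
  shows "hausdorff_dim S \<le> hausdorff_dim (h ` S)"
  unfolding hausdorff_dim_def
proof (rule INF_superset_mono, clarify)
  fix t :: real assume "0 \<le> t" "hausdorff_measure t (h ` S) = 0"
  then show "hausdorff_measure t S = 0"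
    using hausdorff_measure_expanding_image[of t S h] assms by simp
qed simp

lemma hausdorff_dim_mono:
  assumes "S \<subseteq> T" shows "hausdorff_dim S \<le> hausdorff_dim T"
proof -
  have "hausdorff_premeasure t \<delta> S \<le> hausdorff_premeasure t \<delta> T" for t \<delta>
    unfolding hausdorff_premeasure_def using assms by (intro Inf_superset_mono) blast
  then have "hausdorff_measure t S \<le> hausdorff_measure t T" for t
    unfolding hausdorff_measure_def by (intro SUP_mono) auto
  then show ?thesis
    unfolding hausdorff_dim_def by (intro INF_superset_mono) (auto, metis le_zero_eq)
qed

text \<open>
  The mass distribution principle in the form used here: a lower bound for all covers by bounded sets,
  whatever their diameters. The exponent \<open>s\<close> is put halfway between a putative smaller dimension and \<open>d\<close>,
  which also makes it positive, so that the convention \<open>0\<^sup>0 = 1\<close> of the gauge does not interfere.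
\<close>

lemma hausdorff_dim_geI:
  assumes c: "\<And>s. 0 < s \<Longrightarrow> s < d \<Longrightarrow> \<exists>c>0. \<forall>U. S \<subseteq> (\<Union>i::nat. U i) \<longrightarrow> (\<forall>i. bounded (U i))
                 \<longrightarrow> ennreal c \<le> (\<Sum>i. ennreal (hausdorff_gauge s (U i)))"
  shows "ereal d \<le> hausdorff_dim S"
  unfolding hausdorff_dim_def
proof (rule INF_greatest, clarsimp)
  fix t :: real assume t: "0 \<le> t" "hausdorff_measure t S = 0"
  show "d \<le> t"
  proof (rule ccontr)
    assume "\<not> d \<le> t"
    define s where "s = (t + d) / 2"
    have s: "0 < s" "s < d" "t \<le> s" using \<open>\<not> d \<le> t\<close> t by (auto simp: s_def)
    obtain c where c: "c > 0" "\<And>U. S \<subseteq> (\<Union>i::nat. U i) \<Longrightarrow> (\<forall>i. bounded (U i))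
        \<Longrightarrow> ennreal c \<le> (\<Sum>i. ennreal (hausdorff_gauge s (U i)))"
      using assms[OF s(1,2)] by blast
    have "hausdorff_premeasure t 1 S \<le> hausdorff_measure t S"
      unfolding hausdorff_measure_def by (rule SUP_upper) simp
    then have "hausdorff_premeasure t 1 S < ennreal c" using t(2) c(1) by simp
    then obtain U where U: "S \<subseteq> (\<Union>i::nat. U i)" "\<And>i. bounded (U i) \<and> diameter (U i) \<le> 1"
      "(\<Sum>i. ennreal (hausdorff_gauge t (U i))) < ennreal c"
      unfolding hausdorff_premeasure_def Inf_less_iff by auto
    have "ennreal c \<le> (\<Sum>i. ennreal (hausdorff_gauge s (U i)))" 
      by (rule c(2)[OF U(1)]) (use U(2) in blast)
    also have "\<dots> \<le> (\<Sum>i. ennreal (hausdorff_gauge t (U i)))"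
      using U(2) s(3) t(1) by (intro suminf_le ennreal_leI hausdorff_gauge_antimono_exponent) auto
    finally show False using U(3) by (meson not_le)
  qed
qed

lemma hausdorff_dim_leI:
  assumes "0 \<le> d" "\<And>s. d < s \<Longrightarrow> hausdorff_measure s S = 0"
  shows "hausdorff_dim S \<le> ereal d"
proof (rule ereal_le_epsilon2[rule_format])
  fix e :: real assume "0 < e"
  then have "hausdorff_dim S \<le> ereal (d + e)"
    unfolding hausdorff_dim_def using assms by (intro INF_lower) auto
  then show "hausdorff_dim S \<le> ereal d + ereal e" by simp
qed

text \<open>
  The convergence part of the Borel-Cantelli argument: the tails of the double sequence of covering sets
  cover \<open>S\<close>, with sums of gauges that tend to 0.
\<close>

lemma hausdorff_measure_limsup_eq_0:
  fixes W :: "nat \<Rightarrow> nat \<Rightarrow> 'a::metric_space set" and k :: "nat \<Rightarrow> nat" and d :: "nat \<Rightarrow> real"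
  assumes "0 < s"
    and W: "\<And>n i. bounded (W n i)" "\<And>n i. diameter (W n i) \<le> d n"
    and d: "d \<longlonglongrightarrow> 0"
    and sum: "summable (\<lambda>n. real (k n) * d n powr s)"
    and S: "\<And>x. x \<in> S \<Longrightarrow> \<exists>\<^sub>\<infinity>n. \<exists>i<k n. x \<in> W n i"
  shows "hausdorff_measure s S = 0"
proof -
  have "hausdorff_premeasure s \<delta> S = 0" if "0 < \<delta>" for \<delta>
  proof -
    have "hausdorff_premeasure s \<delta> S \<le> 0 + ennreal e" if e: "0 < e" for e
    proof -
      obtain N1 where N1: "\<And>n. n \<ge> N1 \<Longrightarrow> d n < \<delta>"
        using order_tendstoD(2)[OF d \<open>0 < \<delta>\<close>] unfolding eventually_sequentially by blast
      obtain N2 where N2: "\<And>n. n \<ge> N2 \<Longrightarrow> norm (\<Sum>i. real (k (i+n)) * d (i+n) powr s) < e"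
        using suminf_exist_split[OF e sum] by blast
      define N where "N = max N1 N2"
      define f where "f = (\<lambda>(n, i). if i < k (n+N) then W (n+N) i else {})"
      have "S \<subseteq> (\<Union>m. f (prod_decode m))"
      proof
        fix x assume "x \<in> S"
        then obtain n i where "n \<ge> N" "i < k n" "x \<in> W n i"
          using S unfolding INFM_nat_le by blast
        then have "x \<in> f (prod_decode (prod_encode (n - N, i)))" by (simp add: f_def)
        then show "x \<in> (\<Union>m. f (prod_decode m))" by blast
      qed
      moreover have "bounded (f p)" for p
        by (cases p) (simp add: f_def W(1))
      moreover have "diameter (f p) \<le> \<delta>" for p
      proof -
        obtain n i where p: "p = (n, i)" by (cases p)
        have "n + N \<ge> N1" by (simp add: N_def)
        then have "diameter (W (n + N) i) \<le> \<delta>"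
          using W(2)[where n = "n+N" and i = i] N1[of "n+N"] by linarith
        then show ?thesis using \<open>0 < \<delta>\<close> by (simp add: f_def p)
      qed
      ultimately have "hausdorff_premeasure s \<delta> S
          \<le> (\<Sum>m. ennreal (hausdorff_gauge s (f (prod_decode m))))"
        by (intro hausdorff_premeasure_le)
      also have "\<dots> = (\<Sum>n. \<Sum>i. ennreal (hausdorff_gauge s (f (n, i))))"
        by (rule suminf_ennreal_2dimen[where f = "\<lambda>p. ennreal (hausdorff_gauge s (f p))"]) simp
      also have "\<dots> \<le> (\<Sum>n. ennreal (real (k (n+N)) * d (n+N) powr s))"
      proof (intro suminf_le)
        fix n
        have "(\<Sum>i. ennreal (hausdorff_gauge s (f (n, i))))
            = (\<Sum>i<k (n+N). ennreal (hausdorff_gauge s (f (n, i))))"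
          by (rule suminf_finite) (auto simp: f_def hausdorff_gauge_def)
        also have "\<dots> \<le> (\<Sum>i<k (n+N). ennreal (d (n+N) powr s))"
        proof (intro sum_mono ennreal_leI)
          fix i
          have "diameter (W (n+N) i) powr s \<le> d (n+N) powr s"
            using W \<open>0 < s\<close> by (intro powr_mono2 diameter_ge_0) auto
          then show "hausdorff_gauge s (f (n, i)) \<le> d (n+N) powr s"
            using \<open>0 < s\<close> by (auto simp: f_def hausdorff_gauge_def)
        qed
        also have "\<dots> = ennreal (real (k (n+N)) * d (n+N) powr s)"
          by (simp add: ennreal_mult' flip: ennreal_of_nat_eq_real_of_nat)
        finally show "(\<Sum>i. ennreal (hausdorff_gauge s (f (n, i))))
            \<le> ennreal (real (k (n+N)) * d (n+N) powr s)" .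
      qed (rule summableI)+
      also have "\<dots> = ennreal (\<Sum>n. real (k (n+N)) * d (n+N) powr s)"
        by (rule suminf_ennreal2[OF _ summable_ignore_initial_segment[OF sum, of N]]) simp
      also have "\<dots> \<le> ennreal e" 
      proof (rule ennreal_leI)
        have "N2 \<le> N" by (simp add: N_def)
        from N2[OF this] show "(\<Sum>n. real (k (n+N)) * d (n+N) powr s) \<le> e"
          unfolding real_norm_def by linarith
      qed
      finally show ?thesis by simp
    qed
    then have "hausdorff_premeasure s \<delta> S \<le> 0" by (rule ennreal_le_epsilon)
    then show ?thesis by simp
  qed
  then have "hausdorff_measure s S \<le> 0"
    unfolding hausdorff_measure_def by (intro SUP_least) simp
  then show ?thesis by simp
qed

section \<open>Ubiquitous open sets and their countable intersections\<close>

text \<open>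
  The sets \<open>T p\<close> partition the space, and the uniform measure on \<open>Q p\<close> receives the Lebesgue mass of \<open>T p\<close>.
  The constants \<open>C\<close> and \<open>\<rho>\<close> come before \<open>\<eta>\<close>, the distance over which mass may be moved: this uniformity is
  what survives infinitely many repetitions. Finite subsets \<open>P'\<close> replace an infinite sum of
  nonnegative terms.
\<close>

definition ubiquitous :: "real \<Rightarrow> 'a::euclidean_space set \<Rightarrow> bool" where
  "ubiquitous s V \<longleftrightarrow> (\<exists>C>0. \<exists>\<rho>>0. \<forall>\<eta>>0. \<exists>(P::'a set) T Q.
     countable P \<and> disjoint_family_on T P \<and> (\<Union>p\<in>P. T p) = UNIV \<and>
     (\<forall>p\<in>P. T p \<in> sets borel \<and> open (Q p) \<and> Q p \<noteq> {} \<and> closure (Q p) \<subseteq> V \<and>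
            (\<forall>x\<in>T p. \<forall>y\<in>Q p. dist x y \<le> \<eta>)) \<and>
     (\<forall>z r P'. 0 < r \<longrightarrow> r \<le> \<rho> \<longrightarrow> finite P' \<longrightarrow> P' \<subseteq> P \<longrightarrow>
        (\<Sum>p\<in>P'. measure lborel (T p) *
           (measure lborel (Q p \<inter> ball z r) / measure lborel (Q p))) \<le> C * r powr s))"

text \<open>
  The growth condition has the constant 1 throughout the construction below. The density bound \<open>D\<close> is
  existential, as it gets worse at every step; it serves to compare the mass of tiles with their
  Lebesgue measure, which is what the definition of ubiquity controls.
\<close>

definition frostman :: "real \<Rightarrow> 'a::euclidean_space set \<Rightarrow> 'a measure \<Rightarrow> bool" where
  "frostman s G M \<longleftrightarrow> sets M = sets borel \<and> emeasure M (- G) = 0 \<and>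
     (\<exists>D\<ge>0. \<forall>S\<in>sets borel. emeasure M S \<le> ennreal D * emeasure lborel S) \<and>
     (\<forall>x r. 0 < r \<longrightarrow> emeasure M (ball x r) \<le> ennreal (r powr s))"

lemma measure_lborel_pos:
  fixes U :: "'a::euclidean_space set"
  assumes "open U" "U \<noteq> {}" "bounded U"
  shows "0 < measure lborel U"
proof -
  obtain x e where "e > 0" "ball x e \<subseteq> U"
    using assms unfolding open_contains_ball by blast
  moreover have "measure lborel (ball x e) \<le> measure lborel U"
  proof (rule measure_mono_fmeasurable)
    show "U \<in> fmeasurable lborel"
      using assms(1) emeasure_bounded_finite[OF assms(3)] by (intro fmeasurableI) simp_all
  qed (use \<open>ball x e \<subseteq> U\<close> in simp_all)
  ultimately show ?thesis using content_ball_pos[of e x] by linarith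
qed

lemma emeasure_step_density:
  fixes Q :: "'a \<Rightarrow> 'b::euclidean_space set"
  assumes Q: "\<And>p. p \<in> J \<Longrightarrow> Q p \<in> sets borel" and S: "S \<in> sets borel"
  shows "emeasure (density lborel (\<lambda>x. \<Sum>p\<in>J. ennreal (w p) * indicator (Q p) x)) S
       = (\<Sum>p\<in>J. ennreal (w p) * emeasure lborel (Q p \<inter> S))"
proof -
  have "emeasure (density lborel (\<lambda>x. \<Sum>p\<in>J. ennreal (w p) * indicator (Q p) x)) S
      = (\<integral>\<^sup>+x. (\<Sum>p\<in>J. ennreal (w p) * indicator (Q p) x) * indicator S x \<partial>lborel)"
    using Q S by (intro emeasure_density) auto
  also have "\<dots> = (\<integral>\<^sup>+x. (\<Sum>p\<in>J. ennreal (w p) * indicator (Q p \<inter> S) x) \<partial>lborel)"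
    by (intro nn_integral_cong) (simp add: sum_distrib_right indicator_inter_arith mult.assoc)
  also have "\<dots> = (\<Sum>p\<in>J. ennreal (w p) * emeasure lborel (Q p \<inter> S))"
    using Q S by (subst nn_integral_sum) (auto intro!: sum.cong nn_integral_cmult_indicator)
  finally show ?thesis .
qed

lemma emeasure_uniform_mixture:
  fixes Q :: "'a \<Rightarrow> 'b::euclidean_space set"
  assumes "\<And>p. p \<in> J \<Longrightarrow> open (Q p) \<and> bounded (Q p)"
    and "\<And>p. p \<in> J \<Longrightarrow> 0 \<le> c p" and S: "S \<in> sets borel"
  shows "emeasure (density lborel
            (\<lambda>x. \<Sum>p\<in>J. ennreal (c p / measure lborel (Q p)) * indicator (Q p) x)) S
       = ennreal (\<Sum>p\<in>J. c p * (measure lborel (Q p \<inter> S) / measure lborel (Q p)))"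
proof -
  have "emeasure (density lborel
            (\<lambda>x. \<Sum>p\<in>J. ennreal (c p / measure lborel (Q p)) * indicator (Q p) x)) S
      = (\<Sum>p\<in>J. ennreal (c p / measure lborel (Q p)) * emeasure lborel (Q p \<inter> S))"
    using assms(1) S by (intro emeasure_step_density) auto
  also have "\<dots> = (\<Sum>p\<in>J. ennreal (c p * (measure lborel (Q p \<inter> S) / measure lborel (Q p))))"
  proof (rule sum.cong[OF refl])
    fix p assume p: "p \<in> J"
    have "emeasure lborel (Q p \<inter> S) < \<infinity>"
      by (rule emeasure_bounded_finite, rule bounded_subset[of "Q p"]) (use assms(1)[OF p] in simp_all)
    then have "emeasure lborel (Q p \<inter> S) = ennreal (measure lborel (Q p \<inter> S))"
      by (simp add: emeasure_eq_ennreal_measure)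
    then show "ennreal (c p / measure lborel (Q p)) * emeasure lborel (Q p \<inter> S)
        = ennreal (c p * (measure lborel (Q p \<inter> S) / measure lborel (Q p)))"
      using assms(2)[OF p] by (simp add: ennreal_mult' [symmetric])
  qed
  also have "\<dots> = ennreal (\<Sum>p\<in>J. c p * (measure lborel (Q p \<inter> S) / measure lborel (Q p)))"
    using assms(2) by (intro sum_ennreal) auto
  finally show ?thesis .
qed

lemma frostman_emeasure_less_top:
  assumes "frostman s G M" "bounded G" "open G"
  shows "emeasure M UNIV < \<infinity>" "emeasure M UNIV \<le> emeasure M G"
proof -
  have sets: "sets M = sets borel" using assms by (simp add: frostman_def)
  have "emeasure M (G \<union> - G) \<le> emeasure M G + emeasure M (- G)"
    using assms sets by (intro emeasure_subadditive) auto
  then show le: "emeasure M UNIV \<le> emeasure M G" using assms by (simp add: frostman_def)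
  obtain D where D: "D \<ge> 0" "\<And>S. S \<in> sets borel \<Longrightarrow> emeasure M S \<le> ennreal D * emeasure lborel S"
    using assms by (auto simp: frostman_def)
  have "ennreal D * emeasure lborel G < \<infinity>"
    using emeasure_bounded_finite[OF assms(2)] by (simp add: ennreal_mult_less_top)
  then show "emeasure M UNIV < \<infinity>"
    using le D(2)[of G] assms(3) by (auto intro: le_less_trans)
qed

text \<open>
  The mass of the tile \<open>T p\<close> is spread uniformly over \<open>Q p\<close>, for finitely many tiles that carry almost all mass
  and stay away from the boundary of \<open>G\<close>, and then scaled by a factor \<open>\<theta> < 1\<close>. The factor makes up for
  balls of radius \<open>r > r\<^sub>0\<close>, whose new mass may come from the ball of radius \<open>r + \<eta>\<close>. Balls of radius
  \<open>r \<le> r\<^sub>0\<close> are controlled by ubiquity alone, where \<open>r\<^sub>0\<close> depends on the density bound of \<open>M\<close> but not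
  on \<open>\<eta>\<close>. Stating the lower bound \<open>m\<close> for the total mass as a strict inequality leaves room for both losses,
  so that \<open>m\<close> is the same before and after.
\<close>

lemma frostman_step:
  fixes V :: "'a::euclidean_space set"
  assumes V: "ubiquitous s\<^sub>0 V" and s: "0 < s" "s < s\<^sub>0"
    and G: "open G" "bounded G" and M: "frostman s G M"
    and m: "0 < m" "ennreal m < emeasure M UNIV"
  shows "\<exists>G' M'. open G' \<and> bounded G' \<and> closure G' \<subseteq> G \<inter> V \<and> frostman s G' M' \<and>
           ennreal m < emeasure M' UNIV"
proof -
  have setsM [simp]: "sets M = sets borel" using M by (simp add: frostman_def)
  have spM [simp]: "space M = UNIV" using sets_eq_imp_space_eq[OF setsM] by simp
  interpret finite_measure M
    by standard (use frostman_emeasure_less_top[OF M G(2,1)] in auto)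
  obtain D where D: "D \<ge> 0" "\<And>S. S \<in> sets borel \<Longrightarrow> emeasure M S \<le> ennreal D * emeasure lborel S"
    using M by (auto simp: frostman_def)
  have ballM: "measure M (ball x r) \<le> r powr s" if "0 < r" for x r
    using M that by (auto simp: frostman_def emeasure_eq_measure)
  define t where "t = measure M UNIV"
  have t: "m < t" using m by (simp add: t_def emeasure_eq_measure ennreal_less_iff)
  have tG: "measure M G = t"
    using frostman_emeasure_less_top(2)[OF M G(2,1)] finite_measure_mono[of G UNIV]
    by (simp add: emeasure_eq_measure t_def)
  \<comment> \<open>the scaling factor; any number strictly between \<open>m / t\<close> and 1 would do\<close>
  define \<theta> where "\<theta> = (1 + m / t) / 2"
  have "m / t < 1" using t m by simp
  then have \<theta>: "0 < \<theta>" "\<theta> < 1" using m t by (auto simp: \<theta>_def field_simps)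
  have "\<theta> * t = (t + m) / 2" using m t by (simp add: \<theta>_def field_simps)
  then have \<theta>t: "m / \<theta> < t" using \<theta> t by (simp add: field_simps)
  \<comment> \<open>keep away from the boundary of G\<close>
  have neG: "- G \<noteq> {}" using G(2) not_bounded_UNIV by (metis Compl_UNIV_eq boolean_algebra_class.boolean_algebra.double_compl)
  define H where "H k = {x. 1 / real (Suc k) < infdist x (- G)}" for k
  have openH: "open (H k)" for k
    unfolding H_def by (intro open_Collect_less continuous_intros)
  have incH: "incseq H"
    unfolding incseq_def H_def by (auto intro: le_less_trans[rotated] simp: frac_le)
  have UH: "(\<Union>k. H k) = G"
  proof (intro equalityI subsetI)
    fix x assume "x \<in> (\<Union>k. H k)"
    then obtain k where "1 / real (Suc k) < infdist x (- G)" by (auto simp: H_def)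
    moreover have "0 < 1 / real (Suc k)" by simp
    ultimately have "infdist x (- G) \<noteq> 0" by linarith
    then have "x \<notin> - G" using infdist_zero[of x "- G"] by blast
    then show "x \<in> G" by simp
  next
    fix x assume "x \<in> G"
    then have "infdist x (- G) > 0"
      using G(1) neG in_closed_iff_infdist_zero[of "- G" x] infdist_nonneg[of x "-G"]
      by (auto simp: less_le)
    then obtain k where "1 / real (Suc k) < infdist x (- G)"
      using nat_approx_posE by blast
    then show "x \<in> (\<Union>k. H k)" by (auto simp: H_def)
  qed
  have "(\<lambda>k. measure M (H k)) \<longlonglongrightarrow> measure M (\<Union>k. H k)"
    using openH incH by (intro finite_Lim_measure_incseq) auto
  then have limH: "(\<lambda>k. measure M (H k)) \<longlonglongrightarrow> t" using UH tG by simp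
  obtain k where k: "m / \<theta> < measure M (H k)"
    using order_tendstoD(1)[OF limH \<theta>t] unfolding eventually_sequentially by blast
  define \<delta> where "\<delta> = 1 / real (Suc k)"
  have \<delta>: "0 < \<delta>" by (simp add: \<delta>_def)
  obtain C \<rho> where C: "C > 0" and \<rho>: "\<rho> > 0"
    and ub: "\<And>\<eta>. \<eta> > 0 \<Longrightarrow> \<exists>(P::'a set) T Q.
     countable P \<and> disjoint_family_on T P \<and> (\<Union>p\<in>P. T p) = UNIV \<and>
     (\<forall>p\<in>P. T p \<in> sets borel \<and> open (Q p) \<and> Q p \<noteq> {} \<and> closure (Q p) \<subseteq> V \<and>
            (\<forall>x\<in>T p. \<forall>y\<in>Q p. dist x y \<le> \<eta>)) \<and>
     (\<forall>z r P'. 0 < r \<longrightarrow> r \<le> \<rho> \<longrightarrow> finite P' \<longrightarrow> P' \<subseteq> P \<longrightarrow>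
        (\<Sum>p\<in>P'. measure lborel (T p) *
           (measure lborel (Q p \<inter> ball z r) / measure lborel (Q p))) \<le> C * r powr s\<^sub>0)"
    using V unfolding ubiquitous_def by blast
  define q where "q = D * C + 1"
  have q: "q \<ge> 1" using D C by (simp add: q_def)
  \<comment> \<open>below this radius, \<open>r powr (s\<^sub>0 - s)\<close> absorbs the density bound and the constant of ubiquity\<close>
  define r\<^sub>0 where "r\<^sub>0 = min \<rho> ((1 / q) powr (1 / (s\<^sub>0 - s)))"
  have r0: "0 < r\<^sub>0" "r\<^sub>0 \<le> \<rho>" using \<rho> q by (auto simp: r\<^sub>0_def)
  have small: "D * (C * r powr s\<^sub>0) \<le> r powr s" if r: "0 < r" "r \<le> r\<^sub>0" for r
  proof -
    have "r powr (s\<^sub>0 - s) \<le> ((1 / q) powr (1 / (s\<^sub>0 - s))) powr (s\<^sub>0 - s)"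
      using r s by (intro powr_mono2) (auto simp: r\<^sub>0_def)
    also have "\<dots> = 1 / q" using s q by (simp add: powr_powr)
    finally have *: "q * r powr (s\<^sub>0 - s) \<le> 1" using q by (simp add: field_simps)
    have "D * (C * r powr s\<^sub>0) = (D * C) * (r powr (s\<^sub>0 - s) * r powr s)"
      using r by (simp add: powr_add[symmetric])
    also have "\<dots> \<le> q * (r powr (s\<^sub>0 - s) * r powr s)"
      by (intro mult_right_mono) (auto simp: q_def)
    also have "\<dots> = (q * r powr (s\<^sub>0 - s)) * r powr s" by simp
    also have "\<dots> \<le> 1 * r powr s" using * by (intro mult_right_mono) auto
    finally show ?thesis by simp
  qed
  \<comment> \<open>chosen so that enlarging a radius by the factor \<open>w\<close> costs exactly the factor \<open>1 / \<theta>\<close>\<close>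
  define w where "w = (1 / \<theta>) powr (1 / s)"
  have w: "1 < w" using \<theta> s by (auto simp: w_def intro!: gr_one_powr)
  have ws: "w powr s = 1 / \<theta>" using \<theta> s by (simp add: w_def powr_powr)
  define \<eta> where "\<eta> = min (\<delta> / 2) (r\<^sub>0 * (w - 1))"
  have \<eta>: "0 < \<eta>" "\<eta> < \<delta>" "\<eta> \<le> r\<^sub>0 * (w - 1)" using \<delta> r0 w by (auto simp: \<eta>_def min_def)
  have large: "\<theta> * (r + \<eta>) powr s \<le> r powr s" if r: "r\<^sub>0 < r" for r
  proof -
    have "\<eta> \<le> r * (w - 1)" using \<eta>(3) r w by (meson less_imp_le mult_right_mono diff_ge_0_iff_ge order_trans)
    then have "r + \<eta> \<le> r * w" by (simp add: algebra_simps)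
    then have "(r + \<eta>) powr s \<le> (r * w) powr s" using s r r0 \<eta> by (intro powr_mono2) auto
    also have "\<dots> = r powr s / \<theta>" using r r0 w ws by (simp add: powr_mult)
    finally show ?thesis using \<theta> by (simp add: field_simps)
  qed
  obtain P T Q where P: "countable (P::'a set)" and disj: "disjoint_family_on T P"
    and cov: "(\<Union>p\<in>P. T p) = UNIV"
    and TQ: "\<And>p. p \<in> P \<Longrightarrow> T p \<in> sets borel" "\<And>p. p \<in> P \<Longrightarrow> open (Q p)"
        "\<And>p. p \<in> P \<Longrightarrow> Q p \<noteq> {}" "\<And>p. p \<in> P \<Longrightarrow> closure (Q p) \<subseteq> V"
        "\<And>p x y. p \<in> P \<Longrightarrow> x \<in> T p \<Longrightarrow> y \<in> Q p \<Longrightarrow> dist x y \<le> \<eta>"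
    and sum: "\<And>z r P'. 0 < r \<Longrightarrow> r \<le> \<rho> \<Longrightarrow> finite P' \<Longrightarrow> P' \<subseteq> P \<Longrightarrow>
        (\<Sum>p\<in>P'. measure lborel (T p) *
           (measure lborel (Q p \<inter> ball z r) / measure lborel (Q p))) \<le> C * r powr s\<^sub>0"
    using ub[OF \<eta>(1)] by blast
  define J where "J = {p \<in> P. T p \<inter> H k \<noteq> {}}"
  have "countable J" using P by (simp add: J_def)
  have HJ: "H k \<subseteq> (\<Union>p\<in>J. T p)" using cov unfolding J_def by blast
  have "0 < m / \<theta>" using m \<theta> by simp
  then have "H k \<noteq> {}" using k by auto
  then have "J \<noteq> {}" using HJ by auto
  obtain n where n: "m / \<theta> < measure M (\<Union>i<n. T (from_nat_into J i))"
  proof -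
    define A where "A n = (\<Union>i<n. T (from_nat_into J i))" for n
    have TJ: "T (from_nat_into J i) \<in> sets borel" for i
      using from_nat_into[OF \<open>J \<noteq> {}\<close>, of i] TQ(1) by (auto simp: J_def)
    have sA: "A n \<in> sets borel" for n unfolding A_def using TJ by auto
    have iA: "incseq A" unfolding A_def incseq_def by (force intro: less_le_trans)
    have "H k \<subseteq> (\<Union>n. A n)"
    proof
      fix x assume "x \<in> H k"
      then obtain p where p: "p \<in> J" "x \<in> T p" using HJ by auto
      then obtain i where "p = from_nat_into J i"
        using from_nat_into_surj[OF \<open>countable J\<close>] by metis
      then have "x \<in> A (Suc i)" using p by (auto simp: A_def)
      then show "x \<in> (\<Union>n. A n)" by blast
    qed
    then have "m / \<theta> < measure M (\<Union>n. A n)"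
      using k finite_measure_mono[of "H k" "\<Union>n. A n"] sA by force
    moreover have "(\<lambda>n. measure M (A n)) \<longlonglongrightarrow> measure M (\<Union>n. A n)"
      using sA iA by (intro finite_Lim_measure_incseq) auto
    ultimately obtain n where "m / \<theta> < measure M (A n)"
      using order_tendstoD(1)[of "\<lambda>n. measure M (A n)" _ sequentially "m / \<theta>"]
      unfolding eventually_sequentially by blast
    then show thesis using that unfolding A_def by blast
  qed
  define J0 where "J0 = from_nat_into J ` {..<n}"
  have fJ0: "finite J0" by (simp add: J0_def)
  have J0J: "J0 \<subseteq> J" using from_nat_into[OF \<open>J \<noteq> {}\<close>] by (auto simp: J0_def)
  have J0P: "J0 \<subseteq> P" using J0J by (auto simp: J_def)
  have mJ0: "m < (\<Sum>p\<in>J0. \<theta> * measure M (T p))"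
  proof -
    have "m / \<theta> < measure M (\<Union>p\<in>J0. T p)" using n by (simp add: J0_def)
    also have "\<dots> \<le> (\<Sum>p\<in>J0. measure M (T p))"
      using J0P TQ(1) fJ0 by (intro finite_measure_subadditive_finite) auto
    finally show ?thesis using \<theta> by (simp add: sum_distrib_left[symmetric] field_simps)
  qed
  have nearT: "dist x y \<le> \<eta>" if "p \<in> P" "x \<in> T p" "y \<in> closure (Q p)" for p x y
  proof -
    have "closure (Q p) \<subseteq> cball x \<eta>"
      using TQ(5)[OF that(1,2)] by (intro closure_minimal) auto
    then show ?thesis using that by auto
  qed
  have QG: "closure (Q p) \<subseteq> G" if p: "p \<in> J0" for p
  proof
    fix y assume y: "y \<in> closure (Q p)"
    obtain x where x: "x \<in> T p" "x \<in> H k" using p J0J by (auto simp: J_def)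
    show "y \<in> G"
    proof (rule ccontr)
      assume "y \<notin> G"
      then have "infdist x (- G) \<le> dist x y" by (intro infdist_le) auto
      also have "\<dots> \<le> \<eta>" using nearT p J0P x y by blast
      finally show False using x(2) \<eta>(2) by (simp add: H_def \<delta>_def)
    qed
  qed
  have bQ: "bounded (Q p)" if "p \<in> J0" for p
    by (rule bounded_subset[OF G(2)]) (rule order_trans[OF closure_subset QG[OF that]])
  have posQ: "0 < measure lborel (Q p)" if "p \<in> J0" for p
    using that J0P by (intro measure_lborel_pos TQ(2,3) bQ) auto
  define G' where "G' = (\<Union>p\<in>J0. Q p)"
  define c where "c p = \<theta> * measure M (T p)" for p
  have c0: "0 \<le> c p" for p using \<theta> by (simp add: c_def)
  define M' where "M' = density lborel
            (\<lambda>x. \<Sum>p\<in>J0. ennreal (c p / measure lborel (Q p)) * indicator (Q p) x)"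
  have M': "emeasure M' S
       = ennreal (\<Sum>p\<in>J0. c p * (measure lborel (Q p \<inter> S) / measure lborel (Q p)))"
    if "S \<in> sets borel" for S
    unfolding M'_def using J0P TQ(2) bQ c0 that by (intro emeasure_uniform_mixture) auto
  have "open G'" unfolding G'_def using J0P TQ(2) by auto
  moreover have "bounded G'" unfolding G'_def using fJ0 bQ by auto
  moreover have "closure G' \<subseteq> G \<inter> V"
  proof -
    have "closure G' \<subseteq> (\<Union>p\<in>J0. closure (Q p))"
      unfolding G'_def using fJ0 closure_subset by (intro closure_minimal closed_UN) blast+
    then show ?thesis using QG TQ(4) J0P by blast
  qed
  moreover have "ennreal m < emeasure M' UNIV"
  proof -
    have "(\<Sum>p\<in>J0. c p * (measure lborel (Q p \<inter> UNIV) / measure lborel (Q p))) = (\<Sum>p\<in>J0. c p)"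
      by (intro sum.cong) (auto dest!: posQ)
    then show ?thesis using mJ0 m by (subst M') (auto simp: c_def ennreal_less_iff)
  qed
  moreover have "frostman s G' M'"
    unfolding frostman_def
  proof (intro conjI allI impI)
    show "sets M' = sets borel" by (simp add: M'_def)
    have "(\<Sum>p\<in>J0. c p * (measure lborel (Q p \<inter> - G') / measure lborel (Q p))) = 0"
    proof (rule sum.neutral, rule ballI)
      fix p assume "p \<in> J0"
      then have "Q p \<inter> - G' = {}" by (auto simp: G'_def)
      then show "c p * (measure lborel (Q p \<inter> - G') / measure lborel (Q p)) = 0" by simp
    qed
    then show "emeasure M' (- G') = 0" using \<open>open G'\<close> by (subst M') auto
    show "\<exists>D\<ge>0. \<forall>S\<in>sets borel. emeasure M' S \<le> ennreal D * emeasure lborel S"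
    proof (intro exI[of _ "\<Sum>p\<in>J0. c p / measure lborel (Q p)"] conjI ballI)
      show "0 \<le> (\<Sum>p\<in>J0. c p / measure lborel (Q p))" by (intro sum_nonneg) (simp add: c0)
      fix S :: "'a set" assume S: "S \<in> sets borel"
      have "emeasure M' S = (\<Sum>p\<in>J0. ennreal (c p / measure lborel (Q p)) * emeasure lborel (Q p \<inter> S))"
        unfolding M'_def using J0P TQ(2) S by (intro emeasure_step_density) auto
      also have "\<dots> \<le> (\<Sum>p\<in>J0. ennreal (c p / measure lborel (Q p)) * emeasure lborel S)"
        using S by (intro sum_mono mult_left_mono emeasure_mono) auto
      also have "\<dots> = ennreal (\<Sum>p\<in>J0. c p / measure lborel (Q p)) * emeasure lborel S"
        using c0 by (simp add: sum_distrib_right[symmetric] sum_ennreal)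
      finally show "emeasure M' S \<le> ennreal (\<Sum>p\<in>J0. c p / measure lborel (Q p)) * emeasure lborel S" .
    qed
    fix z :: 'a and r :: real assume r: "0 < r"
    have "(\<Sum>p\<in>J0. c p * (measure lborel (Q p \<inter> ball z r) / measure lborel (Q p))) \<le> r powr s"
    proof (cases "r \<le> r\<^sub>0")
      case True
      have "(\<Sum>p\<in>J0. c p * (measure lborel (Q p \<inter> ball z r) / measure lborel (Q p)))
          \<le> (\<Sum>p\<in>J0. D * (measure lborel (T p) * (measure lborel (Q p \<inter> ball z r) / measure lborel (Q p))))"
      proof (intro sum_mono)
        fix p assume p: "p \<in> J0"
        obtain y where "y \<in> Q p" using p J0P TQ(3) by blast
        then have "T p \<subseteq> cball y \<eta>" using TQ(5) p J0P by (auto simp: dist_commute)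
        then have "emeasure lborel (T p) < \<infinity>"
          by (intro emeasure_bounded_finite bounded_subset[OF bounded_cball])
        then have "emeasure lborel (T p) = ennreal (measure lborel (T p))"
          by (simp add: emeasure_eq_ennreal_measure)
        then have "measure M (T p) \<le> D * measure lborel (T p)"
          using D(2)[of "T p"] D(1) TQ(1) p J0P
          by (simp add: emeasure_eq_measure ennreal_mult'[symmetric] subset_iff)
        then have "c p \<le> D * measure lborel (T p)"
          using \<theta> unfolding c_def
          by (meson less_imp_le measure_nonneg mult_left_le_one_le order_trans)
        then have "c p * (measure lborel (Q p \<inter> ball z r) / measure lborel (Q p))
          \<le> D * measure lborel (T p) * (measure lborel (Q p \<inter> ball z r) / measure lborel (Q p))"
          by (rule mult_right_mono) simp
        then show "c p * (measure lborel (Q p \<inter> ball z r) / measure lborel (Q p))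
          \<le> D * (measure lborel (T p) * (measure lborel (Q p \<inter> ball z r) / measure lborel (Q p)))"
          by (simp add: mult.assoc)
      qed
      also have "\<dots> \<le> D * (C * r powr s\<^sub>0)"
        unfolding sum_distrib_left[symmetric]
        using sum[OF r _ fJ0 J0P] True r0 D by (intro mult_left_mono) auto
      also have "\<dots> \<le> r powr s" by (rule small[OF r True])
      finally show ?thesis .
    next
      case False
      define J1 where "J1 = {p \<in> J0. Q p \<inter> ball z r \<noteq> {}}"
      have J1: "finite J1" "J1 \<subseteq> J0" using fJ0 by (auto simp: J1_def)
      have "(\<Sum>p\<in>J0. c p * (measure lborel (Q p \<inter> ball z r) / measure lborel (Q p)))
          = (\<Sum>p\<in>J1. c p * (measure lborel (Q p \<inter> ball z r) / measure lborel (Q p)))"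
        using fJ0 by (intro sum.mono_neutral_right) (auto simp: J1_def)
      also have "\<dots> \<le> (\<Sum>p\<in>J1. c p)"
      proof (intro sum_mono)
        fix p assume "p \<in> J1"
        then have p: "p \<in> J0" using J1 by auto
        have oQ: "open (Q p)" using TQ(2) p J0P by blast
        have "measure lborel (Q p \<inter> ball z r) \<le> measure lborel (Q p)"
          using emeasure_bounded_finite[OF bQ[OF p]] oQ
          by (intro measure_mono_fmeasurable fmeasurableI) simp_all
        then show "c p * (measure lborel (Q p \<inter> ball z r) / measure lborel (Q p)) \<le> c p"
          using posQ[OF p] c0 by (intro mult_right_le_one_le) auto
      qed
      also have "\<dots> = \<theta> * measure M (\<Union>p\<in>J1. T p)"
        unfolding c_def sum_distrib_left[symmetric]
        using J1 J0P TQ(1) disj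
        by (subst finite_measure_finite_Union) (auto intro: disjoint_family_on_mono)
      also have "\<dots> \<le> \<theta> * measure M (ball z (r + \<eta>))"
      proof (intro mult_left_mono finite_measure_mono)
        show "(\<Union>p\<in>J1. T p) \<subseteq> ball z (r + \<eta>)"
        proof
          fix x assume "x \<in> (\<Union>p\<in>J1. T p)"
          then obtain p where p: "p \<in> J0" "x \<in> T p" "Q p \<inter> ball z r \<noteq> {}"
            unfolding J1_def by blast
          then obtain y where "y \<in> Q p" "dist z y < r" by (meson disjoint_iff mem_ball)
          then have "dist z x < r + \<eta>"
            using TQ(5)[of p x y] dist_triangle[of z x y] p J0P by (force simp: dist_commute)
          then show "x \<in> ball z (r + \<eta>)" by simp
        qed
      qed (use \<theta> in auto)
      also have "\<dots> \<le> \<theta> * (r + \<eta>) powr s" using ballM r \<eta> \<theta> by (intro mult_left_mono) auto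
      also have "\<dots> \<le> r powr s" using large False by simp
      finally show ?thesis .
    qed
    then show "emeasure M' (ball z r) \<le> ennreal (r powr s)"
      by (subst M') (auto intro: ennreal_leI)
  qed
  ultimately show ?thesis by blast
qed

text \<open>
  The density is the reciprocal of the volume of the unit ball, so a ball of radius \<open>t\<close>
  has mass at most \<open>t ^ DIM('a)\<close>, which is at most \<open>t powr s\<close> for \<open>t \<le> 1\<close>.
\<close>

lemma frostman_uniform_ball:
  fixes z :: "'a::euclidean_space"
  assumes s: "0 < s" "s \<le> real DIM('a)" and \<rho>: "0 < \<rho>" "\<rho> \<le> 1"
  obtains M where "frostman s (ball z \<rho>) M" "0 < emeasure M UNIV"
proof
  define \<omega> where "\<omega> = unit_ball_vol (real DIM('a))"
  have \<omega>: "0 < \<omega>" by (simp add: \<omega>_def)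
  define M where "M = density lborel (\<lambda>x. \<Sum>p\<in>{z}. ennreal (1 / \<omega>) * indicator (ball z \<rho>) x)"
  have M: "emeasure M S = ennreal (1 / \<omega>) * emeasure lborel (ball z \<rho> \<inter> S)"
    if "S \<in> sets borel" for S
    unfolding M_def by (subst emeasure_step_density) (use that in auto)
  have ball: "ennreal (1 / \<omega>) * emeasure lborel (ball y t) = ennreal (t ^ DIM('a))"
    if "0 < t" for y :: 'a and t
    using that \<omega> by (simp add: emeasure_ball \<omega>_def[symmetric] ennreal_mult'[symmetric])
  show "0 < emeasure M UNIV" using \<rho> by (simp add: M ball)
  show "frostman s (ball z \<rho>) M"
    unfolding frostman_def
  proof (intro conjI allI impI exI[of _ "1 / \<omega>"] ballI)
    show "sets M = sets borel" by (simp add: M_def)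
    show "emeasure M (- ball z \<rho>) = 0" by (subst M) auto
    show "0 \<le> 1 / \<omega>" using \<omega> by simp
    show "emeasure M S \<le> ennreal (1 / \<omega>) * emeasure lborel S" if "S \<in> sets borel" for S
      using that by (subst M) (auto intro!: mult_left_mono emeasure_mono)
    fix x :: 'a and r :: real assume r: "0 < r"
    define t where "t = min \<rho> r"
    have t: "0 < t" "t \<le> 1" "t \<le> r" using r \<rho> by (auto simp: t_def)
    have "emeasure M (ball x r) \<le> ennreal (t ^ DIM('a))"
    proof (cases "\<rho> \<le> r")
      case True
      then have "emeasure M (ball x r) \<le> ennreal (1 / \<omega>) * emeasure lborel (ball z t)"
        by (subst M) (auto intro!: mult_left_mono emeasure_mono simp: t_def)
      then show ?thesis using ball t by simp
    next
      case False
      then have "emeasure M (ball x r) \<le> ennreal (1 / \<omega>) * emeasure lborel (ball x t)"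
        by (subst M) (auto intro!: mult_left_mono emeasure_mono simp: t_def)
      then show ?thesis using ball t by simp
    qed
    also have "t ^ DIM('a) = t powr real DIM('a)" using t by (simp add: powr_realpow)
    also have "t powr real DIM('a) \<le> t powr s" using t s by (intro powr_mono') auto
    also have "t powr s \<le> r powr s" using t s by (intro powr_mono2) auto
    finally show "emeasure M (ball x r) \<le> ennreal (r powr s)" by (simp add: ennreal_leI)
  qed
qed

text \<open>
  Dependent choice over \<open>frostman_step\<close> gives all levels of the Cantor construction, with one \<open>m\<close> for all.
\<close>

lemma frostman_chain:
  fixes V :: "nat \<Rightarrow> 'a::euclidean_space set"
  assumes V: "\<And>k. ubiquitous s\<^sub>0 (V k)" and s: "0 < s" "s < s\<^sub>0" "s\<^sub>0 \<le> real DIM('a)"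
    and G: "open G" "G \<noteq> {}"
  obtains m Gs Ms where "0 < m" "\<And>k. open (Gs k)" "\<And>k. bounded (Gs k)" "\<And>k. frostman s (Gs k) (Ms k)"
    "\<And>k. ennreal m < emeasure (Ms k) UNIV" "\<And>k. closure (Gs (Suc k)) \<subseteq> Gs k \<inter> V k" "Gs 0 \<subseteq> G"
proof -
  obtain z e where e: "0 < e" "ball z e \<subseteq> G" using G unfolding open_contains_ball by blast
  define \<rho> where "\<rho> = min e 1"
  have \<rho>: "0 < \<rho>" "\<rho> \<le> 1" "ball z \<rho> \<subseteq> G" using e by (auto simp: \<rho>_def)
  obtain M\<^sub>0 where M0: "frostman s (ball z \<rho>) M\<^sub>0" "0 < emeasure M\<^sub>0 UNIV"
    using frostman_uniform_ball[of s \<rho> z] s \<rho> by (metis less_imp_le less_le_trans)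
  have "emeasure M\<^sub>0 UNIV < \<infinity>"
    using frostman_emeasure_less_top(1)[OF M0(1)] by simp
  then obtain t where t: "emeasure M\<^sub>0 UNIV = ennreal t" "0 < t"
    using M0(2) by (cases "emeasure M\<^sub>0 UNIV") auto
  define m where "m = t / 2"
  have m: "0 < m" "ennreal m < emeasure M\<^sub>0 UNIV"
    using t by (auto simp: m_def ennreal_less_iff)
  define Pr where "Pr = (\<lambda>(k::nat) (Y :: 'a set \<times> 'a measure).
     open (fst Y) \<and> bounded (fst Y) \<and> frostman s (fst Y) (snd Y) \<and> ennreal m < emeasure (snd Y) UNIV \<and>
     (k = 0 \<longrightarrow> fst Y \<subseteq> G))"
  define Re where "Re = (\<lambda>k (Y :: 'a set \<times> 'a measure) (Z :: 'a set \<times> 'a measure).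
     closure (fst Z) \<subseteq> fst Y \<inter> V k)"
  have start: "\<exists>Y. Pr 0 Y"
    by (rule exI[of _ "(ball z \<rho>, M\<^sub>0)"]) (use M0 m \<rho> in \<open>simp add: Pr_def\<close>)
  have step: "\<exists>Z. Pr (Suc k) Z \<and> Re k Y Z" if Y: "Pr k Y" for k Y
  proof -
    obtain G' M' where "open G'" "bounded G'" "closure G' \<subseteq> fst Y \<inter> V k" "frostman s G' M'"
           "ennreal m < emeasure M' UNIV"
      using frostman_step[OF V s(1,2), of "fst Y" "snd Y" m k] Y m(1) unfolding Pr_def by blast
    then show ?thesis by (intro exI[of _ "(G', M')"]) (simp add: Pr_def Re_def)
  qed
  obtain f where f: "\<And>k. Pr k (f k)" "\<And>k. Re k (f k) (f (Suc k))"
    using dependent_nat_choice[of Pr Re, OF start step] by blast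
  show thesis
    by (rule that[of m "\<lambda>k. fst (f k)" "\<lambda>k. snd (f k)"])
      (use m(1) f(1) f(1)[of 0] f(2) in \<open>auto simp: Pr_def Re_def\<close>)
qed

text \<open>
  A set of diameter 0 has gauge 0 but needs a ball of positive radius; the summand \<open>e\<close> pays for it.
\<close>

lemma small_enclosing_ball:
  fixes U :: "'a::metric_space set"
  assumes "bounded U" "0 < s" "0 < e"
  shows "\<exists>x r. 0 < r \<and> U \<subseteq> ball x r \<and> r powr s \<le> 2 powr s * hausdorff_gauge s U + e"
proof (cases "diameter U > 0")
  case True
  then obtain x where x: "x \<in> U" by fastforce
  have "U \<subseteq> ball x (2 * diameter U)"
    using diameter_bounded_bound[OF assms(1) x] True by fastforce
  moreover have "(2 * diameter U) powr s \<le> 2 powr s * hausdorff_gauge s U + e"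
    using True assms x by (auto simp: hausdorff_gauge_def powr_mult)
  ultimately show ?thesis using True by (intro exI[of _ x] exI[of _ "2 * diameter U"]) simp
next
  case False
  then have d0: "diameter U = 0" using diameter_ge_0[OF assms(1)] by simp
  define r where "r = e powr (1 / s)"
  have r: "0 < r" "r powr s = e" using assms by (auto simp: r_def powr_powr)
  obtain x where "U \<subseteq> ball x r"
  proof (cases "U = {}")
    case True then show thesis using that by simp
  next
    case False
    then obtain x where x: "x \<in> U" by auto
    have "dist x y = 0" if "y \<in> U" for y
      using diameter_bounded_bound[OF assms(1) x that] d0 zero_le_dist[of x y] by linarith
    then have "U \<subseteq> ball x r" using r by auto
    then show thesis by (rule that)
  qed
  then show ?thesis using r assms(2) by (intro exI[of _ x] exI[of _ r]) simp
qed

text \<open>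
  The Cantor set \<open>\<Inter>k. closure (Gs (Suc k))\<close> lies in the intersection. Given a cover, its sets are enlarged to
  open balls; finitely many of them cover some level of the construction, whose
  measure has mass at least \<open>m\<close> and satisfies the growth condition on each ball.
\<close>

theorem hausdorff_dim_Inter_ubiquitous:
  fixes V :: "nat \<Rightarrow> 'a::euclidean_space set"
  assumes V: "\<And>k. ubiquitous s\<^sub>0 (V k)" and "s\<^sub>0 \<le> real DIM('a)"
    and G: "open G" "G \<noteq> {}"
  shows "ereal s\<^sub>0 \<le> hausdorff_dim (G \<inter> (\<Inter>k. V k))"
proof (rule hausdorff_dim_geI)
  fix s assume s: "0 < s" "s < s\<^sub>0"
  obtain m Gs Ms where m: "0 < m" and Gs: "\<And>k. open (Gs k)" "\<And>k. bounded (Gs k)"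
    and Ms: "\<And>k. frostman s (Gs k) (Ms k)" "\<And>k. ennreal m < emeasure (Ms k) UNIV"
    and cl: "\<And>k. closure (Gs (Suc k)) \<subseteq> Gs k \<inter> V k" "Gs 0 \<subseteq> G"
    by (rule frostman_chain[OF V s assms(2) G]) (rule that)
  define c where "c = m / 2 / 2 powr s"
  have "ennreal c \<le> (\<Sum>i. ennreal (hausdorff_gauge s (U i)))"
    if U: "G \<inter> (\<Inter>k. V k) \<subseteq> (\<Union>i. U i)" "\<forall>i. bounded (U i)" for U :: "nat \<Rightarrow> 'a set"
  proof -
    define e where "e i = m / 2 * (1 / 2) ^ Suc i" for i
    have e: "0 < e i" for i using m by (simp add: e_def)
    have "\<forall>i. \<exists>x r. 0 < r \<and> U i \<subseteq> ball x r \<and> r powr s \<le> 2 powr s * hausdorff_gauge s (U i) + e i"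
      using small_enclosing_ball[OF _ s(1) e] U(2) by blast
    then obtain x r where xr: "\<And>i. 0 < r i" "\<And>i. U i \<subseteq> ball (x i) (r i)"
       "\<And>i. r i powr s \<le> 2 powr s * hausdorff_gauge s (U i) + e i" by metis
    define B where "B n = (\<Union>i<n. ball (x i) (r i))" for n
    have openB: "open (B n)" for n by (auto simp: B_def)
    \<comment> \<open>by compactness some level of the construction is covered by finitely many balls\<close>
    have "\<exists>k. closure (Gs (Suc k)) \<subseteq> B k"
    proof (rule ccontr)
      assume "\<nexists>k. closure (Gs (Suc k)) \<subseteq> B k"
      then have ne: "closure (Gs (Suc k)) - B k \<noteq> {}" for k by blast
      have "closure (Gs (Suc (Suc k))) \<subseteq> closure (Gs (Suc k))" for k
        using cl(1)[of "Suc k"] closure_subset[of "Gs (Suc k)"] by blast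
      then have dec: "decseq (\<lambda>k. closure (Gs (Suc k)))" by (intro decseq_SucI)
      have "(\<Inter>k. closure (Gs (Suc k)) - B k) \<noteq> {}"
      proof (rule compact_nest)
        show "compact (closure (Gs (Suc k)) - B k)" for k
          using Gs openB by (intro compact_diff) (auto simp: compact_closure)
        show "closure (Gs (Suc k)) - B k \<subseteq> closure (Gs (Suc l)) - B l" if "l \<le> k" for k l
        proof -
          have "B l \<subseteq> B k" using that by (auto simp: B_def intro: less_le_trans)
          then show ?thesis using decseqD[OF dec that] by blast
        qed
      qed (rule ne)
      then obtain y where y: "\<And>k. y \<in> closure (Gs (Suc k))" "\<And>k. y \<notin> B k" by blast
      have "y \<in> V k" for k using y(1)[of k] cl(1)[of k] by blast
      moreover have "y \<in> G" using y(1)[of 0] cl(1)[of 0] cl(2) by blast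
      ultimately obtain i where "y \<in> U i" using U(1) by blast
      then have "y \<in> B (Suc i)" using xr(2)[of i] unfolding B_def by blast
      then show False using y(2) by blast
    qed
    then obtain k where k: "closure (Gs (Suc k)) \<subseteq> B k" by blast
    let ?M = "Ms (Suc k)"
    have sM: "sets ?M = sets borel" using Ms(1)[of "Suc k"] by (simp add: frostman_def)
    have "ennreal m < emeasure ?M UNIV" by (rule Ms)
    also have "\<dots> \<le> emeasure ?M (Gs (Suc k))"
      by (rule frostman_emeasure_less_top(2)[OF Ms(1) Gs(2) Gs(1)])
    also have "\<dots> \<le> emeasure ?M (B k)"
      using k closure_subset[of "Gs (Suc k)"] openB sM by (intro emeasure_mono) auto
    also have "\<dots> \<le> (\<Sum>i<k. emeasure ?M (ball (x i) (r i)))"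
      unfolding B_def by (rule emeasure_subadditive_finite) (simp_all add: sM image_subset_iff)
    also have "\<dots> \<le> (\<Sum>i<k. ennreal (2 powr s * hausdorff_gauge s (U i) + e i))"
    proof (intro sum_mono)
      fix i
      have "emeasure ?M (ball (x i) (r i)) \<le> ennreal (r i powr s)"
        using Ms(1)[of "Suc k"] xr(1) by (simp add: frostman_def)
      also have "\<dots> \<le> ennreal (2 powr s * hausdorff_gauge s (U i) + e i)"
        by (intro ennreal_leI xr)
      finally show "emeasure ?M (ball (x i) (r i)) \<le> ennreal (2 powr s * hausdorff_gauge s (U i) + e i)" .
    qed
    also have "\<dots> = ennreal (\<Sum>i<k. 2 powr s * hausdorff_gauge s (U i) + e i)"
      using e by (intro sum_ennreal) (simp add: less_imp_le)
    finally have "m < (\<Sum>i<k. 2 powr s * hausdorff_gauge s (U i) + e i)"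
      using m by (simp add: ennreal_less_iff)
    also have "\<dots> = 2 powr s * (\<Sum>i<k. hausdorff_gauge s (U i)) + (\<Sum>i<k. e i)"
      by (simp add: sum.distrib sum_distrib_left)
    also have "(\<Sum>i<k. e i) \<le> m / 2"
    proof -
      have "(\<Sum>i<k. e i) = m / 2 * (1 - (1 / 2) ^ k)"
        by (induction k) (simp_all add: e_def algebra_simps)
      also have "\<dots> \<le> m / 2" using m by (intro mult_left_le) auto
      finally show ?thesis .
    qed
    finally have "c \<le> (\<Sum>i<k. hausdorff_gauge s (U i))" by (simp add: c_def field_simps)
    then have "ennreal c \<le> ennreal (\<Sum>i<k. hausdorff_gauge s (U i))" by (rule ennreal_leI)
    also have "\<dots> = (\<Sum>i<k. ennreal (hausdorff_gauge s (U i)))" by (simp add: sum_ennreal)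
    also have "\<dots> \<le> (\<Sum>i. ennreal (hausdorff_gauge s (U i)))"
      by (intro sum_le_suminf summableI) auto
    finally show ?thesis .
  qed
  moreover have "0 < c" using m by (simp add: c_def)
  ultimately show "\<exists>c>0. \<forall>U. G \<inter> (\<Inter>k. V k) \<subseteq> (\<Union>i::nat. U i) \<longrightarrow> (\<forall>i. bounded (U i))
                 \<longrightarrow> ennreal c \<le> (\<Sum>i. ennreal (hausdorff_gauge s (U i)))" by blast
qed

section \<open>Similarities preserve ubiquity\<close>

lemma similarity_imp_affine:
  fixes f :: "'a::euclidean_space \<Rightarrow> 'a"
  assumes "similarity f"
  obtains c h where "0 < c" "linear h" "\<And>x. f x = f 0 + h x" "\<And>x y. dist (f x) (f y) = c * dist x y" "bij f"
proof -
  obtain c where c: "0 < c" "\<And>x y. dist (f x) (f y) = c * dist x y"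
    using assms unfolding similarity_def by blast
  define k where "k x = (f x - f 0) /\<^sub>R c" for x
  have "orthogonal_transformation k"
    unfolding orthogonal_transformation_isometry
  proof (intro conjI allI)
    show "k 0 = 0" by (simp add: k_def)
    fix x y
    have "k x - k y = (f x - f y) /\<^sub>R c" by (simp add: k_def scaleR_diff_right)
    then show "dist (k x) (k y) = dist x y"
      using c(1) c(2)[of x y] by (simp add: dist_norm)
  qed
  then have k: "linear k" by (rule orthogonal_transformation_linear)
  define h where "h x = c *\<^sub>R k x" for x
  have h: "linear h" unfolding h_def using k by (intro linear_compose_scale_right)
  have fh: "f x = f 0 + h x" for x using c(1) by (simp add: h_def k_def)
  have "inj f"
    using c by (intro injI) (metis dist_self dist_eq_0_iff less_irrefl mult_eq_0_iff)
  then have "inj h" by (metis (no_types) fh injI inj_def)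
  then have "surj h" using h by (simp add: linear_injective_imp_surjective)
  have "surj f"
    unfolding surj_def
  proof
    fix y
    obtain x where "y - f 0 = h x" using \<open>surj h\<close> unfolding surj_def by blast
    then have "y = f x" using fh[of x] by (simp add: algebra_simps)
    then show "\<exists>x. y = f x" by blast
  qed
  then show thesis using that[OF c(1) h fh c(2)] \<open>inj f\<close> by (simp add: bij_def)
qed

text \<open>
  A similarity is affine, so it scales Lebesgue measure by a constant; tiles, target sets and balls
  are all transported, and only the constants \<open>C\<close> and \<open>\<rho>\<close> change.
\<close>

lemma ubiquitous_similarity_image:
  fixes f :: "real ^ 'n::{finite,wellorder} \<Rightarrow> real ^ 'n::_"
  assumes f: "similarity f" and V: "ubiquitous s V"
  shows "ubiquitous s (f ` V)"
proof -
  obtain c h where c: "0 < c" and h: "linear h" and fh: "\<And>x. f x = f 0 + h x"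
    and fd: "\<And>x y. dist (f x) (f y) = c * dist x y" and bij: "bij f"
    using similarity_imp_affine[OF f] by blast
  define g where "g = inv f"
  have fg [simp]: "f (g x) = x" "g (f x) = x" for x
    using bij by (auto simp: g_def bij_def surj_f_inv_f)
  have gd: "dist (g x) (g y) = dist x y / c" for x y
    using fd[of "g x" "g y"] c by simp
  have img: "f ` S = g -` S" for S by (force simp: image_iff intro: fg(1)[symmetric])
  have "continuous_on UNIV g"
    unfolding continuous_on_iff
  proof (intro ballI allI impI)
    fix x and e :: real assume "0 < e"
    then show "\<exists>d>0. \<forall>x'\<in>UNIV. dist x' x < d \<longrightarrow> dist (g x') (g x) < e"
      using c by (intro exI[of _ "c * e"]) (auto simp: gd field_simps)
  qed
  then have cg: "isCont g x" for x by (simp add: continuous_on_eq_continuous_at)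
  have open_img: "open (f ` S)" if "open S" for S
    unfolding img using that cg by (intro continuous_open_vimage) auto
  have closed_img: "closed (f ` S)" if "closed S" for S
    unfolding img using that cg by (intro continuous_closed_vimage) auto
  have borel_img: "f ` S \<in> sets borel" if "S \<in> sets borel" for S
    unfolding img using that \<open>continuous_on UNIV g\<close>
    by (metis borel_measurable_continuous_onI measurable_sets_borel)
  define K where "K = \<bar>det (matrix h)\<bar>"
  have meas: "measure lborel (f ` S) = K * measure lborel S" if S: "S \<in> sets borel" "bounded S" for S
  proof -
    have fm: "S \<in> lmeasurable"
      using S by (simp add: bounded_set_imp_lmeasurable)
    have im: "f ` S = (\<lambda>x. f 0 + x) ` (h ` S)" 
      unfolding image_image by (rule image_cong[OF refl fh])
    have "measure lebesgue (f ` S) = measure lebesgue (h ` S)"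
      unfolding im by (rule measure_translation)
    also have "\<dots> = K * measure lebesgue S"
      unfolding K_def by (rule measure_linear_image[OF h fm])
    finally show ?thesis using S borel_img[OF S(1)] by simp
  qed
  have K: "0 \<le> K" by (simp add: K_def)
  obtain C \<rho> where C: "C > 0" and \<rho>: "\<rho> > 0"
    and ub: "\<And>\<eta>. \<eta> > 0 \<Longrightarrow> \<exists>(P::(real^'n::{finite,wellorder}) set) T Q.
     countable P \<and> disjoint_family_on T P \<and> (\<Union>p\<in>P. T p) = UNIV \<and>
     (\<forall>p\<in>P. T p \<in> sets borel \<and> open (Q p) \<and> Q p \<noteq> {} \<and> closure (Q p) \<subseteq> V \<and>
            (\<forall>x\<in>T p. \<forall>y\<in>Q p. dist x y \<le> \<eta>)) \<and>
     (\<forall>z r P'. 0 < r \<longrightarrow> r \<le> \<rho> \<longrightarrow> finite P' \<longrightarrow> P' \<subseteq> P \<longrightarrow>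
        (\<Sum>p\<in>P'. measure lborel (T p) *
           (measure lborel (Q p \<inter> ball z r) / measure lborel (Q p))) \<le> C * r powr s)"
    using V unfolding ubiquitous_def by blast
  show ?thesis
    unfolding ubiquitous_def
  proof (rule exI[of _ "(K + 1) * C / c powr s"], rule conjI, use K C c in simp,
      rule exI[of _ "c * \<rho>"], rule conjI, use c \<rho> in simp, intro allI impI)
    fix \<eta> :: real assume "0 < \<eta>"
    then have "0 < \<eta> / c" using c by simp
    obtain P T Q where P: "countable (P::(real^'n::{finite,wellorder}) set)" and disj: "disjoint_family_on T P"
      and cov: "(\<Union>p\<in>P. T p) = UNIV"
      and TQ: "\<And>p. p \<in> P \<Longrightarrow> T p \<in> sets borel" "\<And>p. p \<in> P \<Longrightarrow> open (Q p)"
          "\<And>p. p \<in> P \<Longrightarrow> Q p \<noteq> {}" "\<And>p. p \<in> P \<Longrightarrow> closure (Q p) \<subseteq> V"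
          "\<And>p x y. p \<in> P \<Longrightarrow> x \<in> T p \<Longrightarrow> y \<in> Q p \<Longrightarrow> dist x y \<le> \<eta> / c"
      and sum: "\<And>z r P'. 0 < r \<Longrightarrow> r \<le> \<rho> \<Longrightarrow> finite P' \<Longrightarrow> P' \<subseteq> P \<Longrightarrow>
          (\<Sum>p\<in>P'. measure lborel (T p) *
             (measure lborel (Q p \<inter> ball z r) / measure lborel (Q p))) \<le> C * r powr s"
      using ub[OF \<open>0 < \<eta> / c\<close>] by blast
    define T' where "T' q = f ` T (g q)" for q
    define Q' where "Q' q = f ` Q (g q)" for q
    have bT: "bounded (T p)" if p: "p \<in> P" for p
    proof -
      obtain y where "y \<in> Q p" using TQ(3)[OF p] by blast
      then have "T p \<subseteq> cball y (\<eta> / c)" using TQ(5)[OF p] by (auto simp: dist_commute)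
      then show ?thesis by (rule bounded_subset[OF bounded_cball])
    qed
    have main: "(\<Sum>p\<in>P'. measure lborel (T' p) *
           (measure lborel (Q' p \<inter> ball z r) / measure lborel (Q' p)))
         \<le> (K + 1) * C / c powr s * r powr s"
      if r: "0 < r" "r \<le> c * \<rho>" and P': "finite P'" "P' \<subseteq> f ` P" for z r P'
    proof -
      have rc: "0 < r / c" "r / c \<le> \<rho>" using r c by (auto simp: field_simps)
      define P0 where "P0 = g ` P'"
      have P0: "finite P0" "P0 \<subseteq> P" using P' by (auto simp: P0_def)
      have P'eq: "P' = f ` P0" by (force simp: P0_def image_image)
      have summand: "measure lborel (T' (f p)) * (measure lborel (Q' (f p) \<inter> ball z r) / measure lborel (Q' (f p)))
          \<le> K * (measure lborel (T p) * (measure lborel (Q p \<inter> ball (g z) (r / c)) / measure lborel (Q p)))"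
        if p: "p \<in> P0" for p
      proof (cases "T p = {}")
        case True then show ?thesis by (simp add: T'_def)
      next
        case False
        have pP: "p \<in> P" using p P0 by blast
        obtain x where "x \<in> T p" using False by blast
        then have "Q p \<subseteq> cball x (\<eta> / c)" using TQ(5)[OF pP] by auto
        then have bQ: "bounded (Q p)" by (rule bounded_subset[OF bounded_cball])
        have oQ: "open (Q p)" by (rule TQ(2)[OF pP])
        have "Q' (f p) \<inter> ball z r = f ` (Q p \<inter> ball (g z) (r / c))"
          using c unfolding Q'_def img by (auto simp: gd field_simps)
        then have "measure lborel (Q' (f p) \<inter> ball z r) = K * measure lborel (Q p \<inter> ball (g z) (r / c))"
          using meas[of "Q p \<inter> ball (g z) (r / c)"] oQ bQ by (simp add: bounded_Int)
        moreover have "measure lborel (Q' (f p)) = K * measure lborel (Q p)"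
          using meas[of "Q p"] oQ bQ by (simp add: Q'_def)
        moreover have "measure lborel (T' (f p)) = K * measure lborel (T p)"
          using meas[OF TQ(1)[OF pP] bT[OF pP]] by (simp add: T'_def)
        ultimately show ?thesis by (cases "K = 0") simp_all
      qed
      have "(\<Sum>p\<in>P'. measure lborel (T' p) * (measure lborel (Q' p \<inter> ball z r) / measure lborel (Q' p)))
         = (\<Sum>p\<in>P0. measure lborel (T' (f p)) * (measure lborel (Q' (f p) \<inter> ball z r) / measure lborel (Q' (f p))))"
        unfolding P'eq using bij by (subst sum.reindex) (auto simp: bij_def intro: inj_on_subset)
      also have "\<dots> \<le> (\<Sum>p\<in>P0. K * (measure lborel (T p) * (measure lborel (Q p \<inter> ball (g z) (r / c)) / measure lborel (Q p))))"
        by (rule sum_mono) (rule summand)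
      also have "\<dots> \<le> K * (C * (r / c) powr s)"
        unfolding sum_distrib_left[symmetric] using K by (intro mult_left_mono sum rc P0) auto
      also have "\<dots> \<le> (K + 1) * (C * (r / c) powr s)"
        using C by (intro mult_right_mono) auto
      also have "\<dots> = (K + 1) * C / c powr s * r powr s"
        using r c by (simp add: powr_divide)
      finally show ?thesis .
    qed
    show "\<exists>(P::(real^'n::{finite,wellorder}) set) T Q. countable P \<and> disjoint_family_on T P \<and> (\<Union>p\<in>P. T p) = UNIV \<and>
     (\<forall>p\<in>P. T p \<in> sets borel \<and> open (Q p) \<and> Q p \<noteq> {} \<and> closure (Q p) \<subseteq> f ` V \<and>
            (\<forall>x\<in>T p. \<forall>y\<in>Q p. dist x y \<le> \<eta>)) \<and>
     (\<forall>z r P'. 0 < r \<longrightarrow> r \<le> c * \<rho> \<longrightarrow> finite P' \<longrightarrow> P' \<subseteq> P \<longrightarrow>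
        (\<Sum>p\<in>P'. measure lborel (T p) *
           (measure lborel (Q p \<inter> ball z r) / measure lborel (Q p))) \<le> (K + 1) * C / c powr s * r powr s)"
    proof (rule exI[of _ "f ` P"], rule exI[of _ T'], rule exI[of _ Q'], intro conjI ballI allI impI)
      show "countable (f ` P)" using P by simp
      show "disjoint_family_on T' (f ` P)"
        unfolding disjoint_family_on_def
      proof (intro ballI impI)
        fix a b assume "a \<in> f ` P" "b \<in> f ` P" "a \<noteq> b"
        then have "g a \<in> P" "g b \<in> P" "g a \<noteq> g b" using fg by fastforce+
        then have "T (g a) \<inter> T (g b) = {}" using disj by (auto simp: disjoint_family_on_def)
        then show "T' a \<inter> T' b = {}" unfolding T'_def img by blast
      qed
      show "(\<Union>p\<in>f ` P. T' p) = UNIV"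
      proof (intro equalityI subsetI UNIV_I)
        fix y
        obtain p where "p \<in> P" "g y \<in> T p" using cov by blast
        then have "y \<in> T' (f p)" unfolding T'_def img by simp
        then show "y \<in> (\<Union>p\<in>f ` P. T' p)" using \<open>p \<in> P\<close> by blast
      qed
      fix q assume "q \<in> f ` P"
      then have gq: "g q \<in> P" by auto
      show "T' q \<in> sets borel" unfolding T'_def by (rule borel_img[OF TQ(1)[OF gq]])
      show "open (Q' q)" unfolding Q'_def by (rule open_img[OF TQ(2)[OF gq]])
      show "Q' q \<noteq> {}" unfolding Q'_def using TQ(3)[OF gq] by simp
      have "closure (Q' q) \<subseteq> f ` closure (Q (g q))"
        unfolding Q'_def using closure_subset by (intro closure_minimal closed_img) blast+
      then show "closure (Q' q) \<subseteq> f ` V" using TQ(4)[OF gq] by blast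
      fix x y assume "x \<in> T' q" "y \<in> Q' q"
      then obtain x' y' where "x' \<in> T (g q)" "y' \<in> Q (g q)" "x = f x'" "y = f y'"
        unfolding T'_def Q'_def by blast
      then show "dist x y \<le> \<eta>" using TQ(5)[OF gq, of x' y'] c by (simp add: fd field_simps)
    qed (use main in blast)
  qed
qed

section \<open>Areas and counting in the plane\<close>

lemma measure_linear_vimage:
  fixes h :: "real ^ 'n::{finite,wellorder} \<Rightarrow> real ^ 'n::_"
  assumes h: "linear h" and det: "det (matrix h) \<noteq> 0"
    and S: "S \<in> sets borel" "bounded S"
  shows "measure lborel (h -` S) = measure lborel S / \<bar>det (matrix h)\<bar>"
proof -
  have inj: "inj h" using det_nz_iff_inj[OF h] det by blast
  have surj: "surj h" by (rule linear_injective_imp_surjective[OF h inj]) simp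
  have "h -` S = inv h ` S"
    using inj surj by (simp add: bij_vimage_eq_inv_image bij_def)
  then have "bounded (h -` S)"
    using S(2) inj_linear_imp_inv_linear[OF h inj]
    by (simp add: bounded_linear_image linear_conv_bounded_linear)
  moreover have borel: "h -` S \<in> sets borel"
    using S(1) linear_continuous_on[OF h[unfolded linear_conv_bounded_linear]]
    by (metis borel_measurable_continuous_onI measurable_sets_borel)
  ultimately have "h -` S \<in> lmeasurable" by (simp add: bounded_set_imp_lmeasurable)
  then have "measure lebesgue (h ` (h -` S)) = \<bar>det (matrix h)\<bar> * measure lebesgue (h -` S)"
    by (rule measure_linear_image[OF h])
  then show ?thesis
    using det S(1) borel by (simp add: surj field_simps)
qed

lemma measure_cbox_2:
  fixes a b :: "real ^ 2"
  assumes "a $ 1 \<le> b $ 1" "a $ 2 \<le> b $ 2"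
  shows "measure lborel (cbox a b) = (b $ 1 - a $ 1) * (b $ 2 - a $ 2)"
proof -
  have "a \<in> cbox a b" using assms by (simp add: mem_box_cart forall_2)
  then have "cbox a b \<noteq> {}" by blast
  then show ?thesis by (simp add: content_cbox_cart UNIV_2)
qed

lemma card_separated_reals:
  fixes S :: "real set"
  assumes S: "finite S" "\<And>x. x \<in> S \<Longrightarrow> a \<le> x \<and> x \<le> a + l" and "0 < d" "0 \<le> l"
    and sep: "\<And>x y. x \<in> S \<Longrightarrow> y \<in> S \<Longrightarrow> x \<noteq> y \<Longrightarrow> d \<le> \<bar>x - y\<bar>"
  shows "real (card S) \<le> 1 + l / d"
proof -
  define f where "f x = \<lfloor>(x - a) / d\<rfloor>" for x
  have "inj_on f S"
  proof (rule inj_onI, rule ccontr)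
    fix x y assume xy: "x \<in> S" "y \<in> S" "f x = f y" "x \<noteq> y"
    have "\<bar>(x - a) / d - (y - a) / d\<bar> < 1"
      using xy(3) floor_correct[of "(x - a) / d"] floor_correct[of "(y - a) / d"]
      unfolding f_def by linarith
    moreover have "(x - a) / d - (y - a) / d = (x - y) / d" by (simp add: diff_divide_distrib)
    ultimately have "\<bar>x - y\<bar> < d" using \<open>0 < d\<close> by (simp add: abs_divide)
    then show False using sep xy by fastforce
  qed
  moreover have "f ` S \<subseteq> {0..\<lfloor>l / d\<rfloor>}"
    using S(2) \<open>0 < d\<close>
    by (auto simp: f_def intro!: floor_mono divide_right_mono) (simp add: S(2) diff_le_eq add.commute)
  ultimately have "card S \<le> card {0..\<lfloor>l / d\<rfloor>}"
    by (metis card_image card_mono finite_atLeastAtMost_int)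
  also have "\<dots> = nat (\<lfloor>l / d\<rfloor> + 1)" by simp
  finally have "real (card S) \<le> real (nat (\<lfloor>l / d\<rfloor> + 1))" by linarith
  also have "\<dots> = of_int \<lfloor>l / d\<rfloor> + 1" using \<open>0 < d\<close> \<open>0 \<le> l\<close> by simp
  also have "\<dots> \<le> 1 + l / d" by linarith
  finally show ?thesis .
qed

text \<open>
  Two points of the box differ by at most \<open>2 * U\<close> in \<open>u\<close>, hence by at least \<open>\<kappa> / (2 * U)\<close> in \<open>v\<close>. The bound
  has the right order for boxes of any eccentricity, which no separation in the Euclidean metric would give.
\<close>

lemma card_hyperbolically_separated:
  fixes u v :: "'a \<Rightarrow> real"
  assumes S: "finite S" and "0 < \<kappa>" "0 < U" "0 \<le> V"
    and box: "\<And>p. p \<in> S \<Longrightarrow> \<bar>u p - u\<^sub>0\<bar> \<le> U \<and> \<bar>v p - v\<^sub>0\<bar> \<le> V"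
    and sep: "\<And>p q. p \<in> S \<Longrightarrow> q \<in> S \<Longrightarrow> p \<noteq> q \<Longrightarrow> \<kappa> \<le> \<bar>u p - u q\<bar> * \<bar>v p - v q\<bar>"
  shows "real (card S) \<le> 1 + 4 * U * V / \<kappa>"
proof -
  define d where "d = \<kappa> / (2 * U)"
  have d: "0 < d" using assms by (simp add: d_def)
  have vsep: "d \<le> \<bar>v p - v q\<bar>" if "p \<in> S" "q \<in> S" "p \<noteq> q" for p q
  proof -
    have "\<bar>u p - u q\<bar> \<le> 2 * U" using box[OF that(1)] box[OF that(2)] by linarith
    then have "\<bar>u p - u q\<bar> * \<bar>v p - v q\<bar> \<le> 2 * U * \<bar>v p - v q\<bar>" by (intro mult_right_mono) auto
    then have "\<kappa> \<le> 2 * U * \<bar>v p - v q\<bar>" using sep[OF that] by linarith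
    then show ?thesis using \<open>0 < U\<close> by (simp add: d_def field_simps)
  qed
  then have "inj_on v S" using d by (intro inj_onI) (fastforce)
  then have "real (card S) = real (card (v ` S))" by (simp add: card_image)
  also have "\<dots> \<le> 1 + (2 * V) / d"
  proof (rule card_separated_reals)
    show "v\<^sub>0 - V \<le> x \<and> x \<le> v\<^sub>0 - V + 2 * V" if "x \<in> v ` S" for x
      using that box by (force simp: abs_le_iff)
    show "d \<le> \<bar>x - y\<bar>" if "x \<in> v ` S" "y \<in> v ` S" "x \<noteq> y" for x y
      using that vsep by auto
  qed (use S d \<open>0 \<le> V\<close> in auto)
  also have "\<dots> = 1 + 4 * U * V / \<kappa>" by (simp add: d_def)
  finally show ?thesis .
qed

section \<open>Integer matrices with a hyperbolic eigenbasis\<close>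

definition lattice :: "(real ^ 2) set" where
  "lattice = {m. \<forall>i. m $ i \<in> \<int>}"

lemma lattice_iff: "m \<in> lattice \<longleftrightarrow> m $ 1 \<in> \<int> \<and> m $ 2 \<in> \<int>"
  by (simp add: lattice_def forall_2)

lemma lattice_diff: "m \<in> lattice \<Longrightarrow> m' \<in> lattice \<Longrightarrow> m - m' \<in> lattice"
  by (simp add: lattice_def)

lemma countable_lattice: "countable lattice"
proof -
  have "lattice \<subseteq> (\<lambda>(i, j). vector [of_int i, of_int j]) ` (UNIV :: (int \<times> int) set)"
  proof
    fix m assume "m \<in> lattice"
    then obtain i j where "m $ 1 = of_int i" "m $ 2 = of_int j"
      unfolding lattice_iff by (auto elim!: Ints_cases)
    then have "m = vector [of_int i, of_int j]" by (simp add: vec_eq_iff forall_2)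
    then show "m \<in> (\<lambda>(i, j). vector [of_int i, of_int j]) ` (UNIV :: (int \<times> int) set)" by auto
  qed
  then show ?thesis by (rule countable_subset) simp
qed

lemma rational_root_integral:
  fixes l :: real
  assumes "l\<^sup>2 - of_int t * l + of_int d = 0" "l \<in> \<rat>"
  shows "l \<in> \<int>"
proof -
  obtain p q :: int where q: "q > 0" "coprime p q" "l = of_int p / of_int q"
    using Rats_cases'[OF assms(2)] by metis
  have "of_int p ^ 2 = (of_int q * (of_int t * of_int p - of_int d * of_int q) :: real)"
    using assms(1) q by (simp add: field_simps power2_eq_square)
  then have "p ^ 2 = q * (t * p - d * q)"
    by (metis (mono_tags, opaque_lifting) of_int_diff of_int_eq_iff of_int_mult of_int_power)
  then have "q dvd p ^ 2" by simp
  moreover have "coprime (p ^ 2) q" using q(2) by simp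
  ultimately have "q dvd 1" by (metis coprime_absorb_right is_unit_gcd_iff coprime_commute coprime_dvd_mult_left_iff dvd_refl mult.right_neutral)
  then have "q = 1" using q(1) by simp
  then show ?thesis using q(3) by simp
qed

text \<open>
  The eigenvalues are given by trace and determinant: this is the form in which they enter the
  norm form of \<open>uv_lattice_ge_1\<close>.
\<close>

locale hyperbolic_matrix =
  fixes A :: "int ^ 2 ^ 2" and l1 l2 :: real
  assumes trace_eq: "l1 + l2 = of_int (A $ 1 $ 1 + A $ 2 $ 2)"
    and det_eq: "l1 * l2 = of_int (A $ 1 $ 1 * A $ 2 $ 2 - A $ 1 $ 2 * A $ 2 $ 1)"
    and l1: "0 < \<bar>l1\<bar>" "\<bar>l1\<bar> < 1" and l2: "1 < \<bar>l2\<bar>"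
begin

text \<open>
  The functionals \<open>u\<close> and \<open>v\<close> are left eigenvectors of \<open>A\<close> for \<open>l2\<close> and \<open>l1\<close>: \<open>u\<close> is the expanding and
  \<open>v\<close> the contracting coordinate.
\<close>

definition u :: "real ^ 2 \<Rightarrow> real" where
  "u x = of_int (A $ 2 $ 1) * x $ 1 + (l2 - of_int (A $ 1 $ 1)) * x $ 2"

definition v :: "real ^ 2 \<Rightarrow> real" where
  "v x = of_int (A $ 2 $ 1) * x $ 1 + (l1 - of_int (A $ 1 $ 1)) * x $ 2"

definition iterate :: "nat \<Rightarrow> real ^ 2 \<Rightarrow> real ^ 2" where
  "iterate n = ((*v) (map_matrix real_of_int A)) ^^ n"

definition displacement :: "nat \<Rightarrow> real ^ 2 \<Rightarrow> real ^ 2" where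
  "displacement n x = iterate n x - x"

lemma u_diff: "u (x - y) = u x - u y" and u_add: "u (x + y) = u x + u y"
  and u_scale: "u (k *\<^sub>R x) = k * u x"
  and v_diff: "v (x - y) = v x - v y" and v_add: "v (x + y) = v x + v y"
  and v_scale: "v (k *\<^sub>R x) = k * v x"
  by (simp_all add: u_def v_def algebra_simps)

lemma root_l1: "l1\<^sup>2 - of_int (A $ 1 $ 1 + A $ 2 $ 2) * l1
    + of_int (A $ 1 $ 1 * A $ 2 $ 2 - A $ 1 $ 2 * A $ 2 $ 1) = 0"
  and root_l2: "l2\<^sup>2 - of_int (A $ 1 $ 1 + A $ 2 $ 2) * l2
    + of_int (A $ 1 $ 1 * A $ 2 $ 2 - A $ 1 $ 2 * A $ 2 $ 1) = 0"
  unfolding trace_eq[symmetric] det_eq[symmetric] by (simp_all add: algebra_simps power2_eq_square)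

lemma l1_irrational: "l1 \<notin> \<rat>"
proof
  assume "l1 \<in> \<rat>"
  then have "l1 \<in> \<int>" using rational_root_integral[OF root_l1] by simp
  then show False using l1 Ints_nonzero_abs_less1 by fastforce
qed

lemma l2_irrational: "l2 \<notin> \<rat>"
proof
  assume "l2 \<in> \<rat>"
  then have "of_int (A $ 1 $ 1 + A $ 2 $ 2) - l2 \<in> \<rat>" by (intro Rats_diff) auto
  moreover have "of_int (A $ 1 $ 1 + A $ 2 $ 2) - l2 = l1" using trace_eq by linarith
  ultimately show False using l1_irrational by simp
qed

lemma A21_nonzero: "A $ 2 $ 1 \<noteq> 0"
proof
  assume "A $ 2 $ 1 = 0"
  then have "(l1 - of_int (A $ 1 $ 1)) * (l1 - of_int (A $ 2 $ 2)) = 0"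
    using root_l1 by (simp add: algebra_simps power2_eq_square)
  then have "l1 \<in> \<rat>" by auto
  then show False using l1_irrational by simp
qed

lemma u_map: "u (map_matrix real_of_int A *v x) = l2 * u x"
proof -
  have "l2 * (l2 - of_int (A $ 1 $ 1)) = of_int (A $ 2 $ 1) * of_int (A $ 1 $ 2)
      + (l2 - of_int (A $ 1 $ 1)) * of_int (A $ 2 $ 2)"
    using root_l2 by (simp add: algebra_simps power2_eq_square)
  then have "l2 * (l2 - of_int (A $ 1 $ 1)) * x $ 2 = (of_int (A $ 2 $ 1) * of_int (A $ 1 $ 2)
      + (l2 - of_int (A $ 1 $ 1)) * of_int (A $ 2 $ 2)) * x $ 2" by simp
  then show ?thesis
    by (simp add: u_def matrix_vector_mult_def sum_2 algebra_simps)
qed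

lemma v_map: "v (map_matrix real_of_int A *v x) = l1 * v x"
proof -
  have "l1 * (l1 - of_int (A $ 1 $ 1)) = of_int (A $ 2 $ 1) * of_int (A $ 1 $ 2)
      + (l1 - of_int (A $ 1 $ 1)) * of_int (A $ 2 $ 2)"
    using root_l1 by (simp add: algebra_simps power2_eq_square)
  then have "l1 * (l1 - of_int (A $ 1 $ 1)) * x $ 2 = (of_int (A $ 2 $ 1) * of_int (A $ 1 $ 2)
      + (l1 - of_int (A $ 1 $ 1)) * of_int (A $ 2 $ 2)) * x $ 2" by simp
  then show ?thesis
    by (simp add: v_def matrix_vector_mult_def sum_2 algebra_simps)
qed

lemma u_iterate: "u (iterate n x) = l2 ^ n * u x" and v_iterate: "v (iterate n x) = l1 ^ n * v x"
  by (induction n) (simp_all add: iterate_def u_map v_map)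

lemma u_displacement: "u (displacement n x) = (l2 ^ n - 1) * u x" and v_displacement: "v (displacement n x) = (l1 ^ n - 1) * v x"
  by (simp_all add: displacement_def u_diff v_diff u_iterate v_iterate algebra_simps)

lemma linear_iterate: "linear (iterate n)"
proof (induction n)
  case 0 then show ?case by (simp add: iterate_def linear_id[unfolded id_def])
next
  case (Suc n)
  have "iterate (Suc n) = (*v) (map_matrix real_of_int A) \<circ> iterate n" by (simp add: iterate_def)
  then show ?case
    using linear_compose[OF Suc matrix_vector_mul_linear[of "map_matrix real_of_int A"]] by (simp only:)
qed

lemma linear_displacement: "linear (displacement n)"
  unfolding displacement_def[abs_def] using linear_compose_sub[OF linear_iterate linear_ident] .

lemma iterate_lattice: "m \<in> lattice \<Longrightarrow> iterate n m \<in> lattice"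
proof (induction n)
  case (Suc n)
  have "map_matrix real_of_int A *v m' \<in> lattice" if "m' \<in> lattice" for m'
    using that by (auto simp: lattice_def matrix_vector_mult_def intro!: Ints_sum Ints_mult)
  then show ?case using Suc by (simp add: iterate_def)
qed (simp add: iterate_def)

lemma l1_ne_l2: "l1 \<noteq> l2" using l1 l2 by auto

lemma uv_eq_0: "u x = 0 \<Longrightarrow> v x = 0 \<Longrightarrow> x = 0"
proof -
  assume 0: "u x = 0" "v x = 0"
  have "u x - v x = (l2 - l1) * x $ 2" by (simp add: u_def v_def algebra_simps)
  then have "x $ 2 = 0" using 0 l1_ne_l2 by simp
  moreover have "x $ 1 = 0" using 0 \<open>x $ 2 = 0\<close> A21_nonzero by (simp add: u_def)
  ultimately show "x = 0" by (simp add: vec_eq_iff forall_2)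
qed

text \<open>
  The product \<open>u m * v m\<close> is the value at \<open>m\<close> of a quadratic form with integer coefficients, and it does not
  vanish because \<open>l1\<close> and \<open>l2\<close> are irrational.
\<close>

lemma uv_lattice_ge_1:
  assumes "m \<in> lattice" "m \<noteq> 0"
  shows "1 \<le> \<bar>u m\<bar> * \<bar>v m\<bar>"
proof -
  obtain i j where ij: "m $ 1 = of_int i" "m $ 2 = of_int j"
    using assms(1) unfolding lattice_iff by (auto elim!: Ints_cases)
  \<comment> \<open>the norm form, which is integral although \<open>u m\<close> and \<open>v m\<close> are not\<close>
  let ?N = "A $ 2 $ 1 * (A $ 2 $ 1 * i\<^sup>2 + (A $ 2 $ 2 - A $ 1 $ 1) * i * j - A $ 1 $ 2 * j\<^sup>2)"
  have "u m * v m = (of_int (A $ 2 $ 1))\<^sup>2 * (of_int i)\<^sup>2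
      + of_int (A $ 2 $ 1) * of_int i * of_int j * ((l1 + l2) - 2 * of_int (A $ 1 $ 1))
      + (of_int j)\<^sup>2 * (l1 * l2 - of_int (A $ 1 $ 1) * (l1 + l2) + (of_int (A $ 1 $ 1))\<^sup>2)"
    by (simp add: u_def v_def ij algebra_simps power2_eq_square)
  also have "\<dots> = of_int ?N"
    unfolding trace_eq det_eq by (simp add: algebra_simps power2_eq_square)
  finally have N: "u m * v m = of_int ?N" .
  have ne: "of_int (A $ 2 $ 1) * of_int i + (l - of_int (A $ 1 $ 1)) * of_int j \<noteq> 0"
    if l: "l \<notin> \<rat>" for l :: real
  proof
    assume 0: "of_int (A $ 2 $ 1) * of_int i + (l - of_int (A $ 1 $ 1)) * of_int j = 0"
    show False
    proof (cases "j = 0")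
      case True
      then have "i = 0" using 0 A21_nonzero by simp
      then have "m = 0" using True ij by (simp add: vec_eq_iff forall_2)
      then show False using assms(2) by simp
    next
      case False
      then have "l = of_int (A $ 1 $ 1) - of_int (A $ 2 $ 1) * of_int i / of_int j"
        using 0 by (simp add: field_simps)
      also have "\<dots> \<in> \<rat>" by (intro Rats_diff Rats_divide Rats_mult) auto
      finally show False using l by simp
    qed
  qed
  have "u m \<noteq> 0" "v m \<noteq> 0"
    using ne[OF l2_irrational] ne[OF l1_irrational] by (auto simp: u_def v_def ij)
  then have "?N \<noteq> 0" using N by (metis mult_eq_0_iff of_int_0)
  then have "1 \<le> \<bar>?N\<bar>" by linarith
  then have "1 \<le> \<bar>of_int ?N :: real\<bar>" by linarith
  then show ?thesis by (simp only: N[symmetric] abs_mult)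
qed

lemma uv_le_norm: "\<exists>C>0. \<forall>x. \<bar>u x\<bar> \<le> C * norm x \<and> \<bar>v x\<bar> \<le> C * norm x"
proof (intro exI conjI allI)
  let ?C = "\<bar>of_int (A $ 2 $ 1)\<bar> + \<bar>l1 - of_int (A $ 1 $ 1)\<bar> + \<bar>l2 - of_int (A $ 1 $ 1)\<bar> :: real"
  show "0 < ?C" using A21_nonzero by linarith
  fix x :: "real ^ 2"
  have "\<bar>a * x $ 1 + b * x $ 2\<bar> \<le> (\<bar>a\<bar> + \<bar>b\<bar>) * norm x" for a b :: real
  proof -
    have "\<bar>a * x $ 1 + b * x $ 2\<bar> \<le> \<bar>a\<bar> * \<bar>x $ 1\<bar> + \<bar>b\<bar> * \<bar>x $ 2\<bar>"
      by (metis abs_mult abs_triangle_ineq)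
    also have "\<dots> \<le> \<bar>a\<bar> * norm x + \<bar>b\<bar> * norm x"
      by (intro add_mono mult_left_mono component_le_norm_cart) auto
    finally show ?thesis by (simp add: algebra_simps)
  qed
  note b = this
  have m: "(\<bar>a\<bar> + \<bar>b\<bar>) * norm x \<le> ?C * norm x" if "\<bar>a\<bar> + \<bar>b\<bar> \<le> ?C" for a b :: real
    using that by (intro mult_right_mono) auto
  show "\<bar>u x\<bar> \<le> ?C * norm x" unfolding u_def by (rule order_trans[OF b m]) auto
  show "\<bar>v x\<bar> \<le> ?C * norm x" unfolding v_def by (rule order_trans[OF b m]) auto
qed

lemma norm_le_uv: "\<exists>C>0. \<forall>x. norm x \<le> C * (\<bar>u x\<bar> + \<bar>v x\<bar>)"
proof -
  define c where "c = \<bar>of_int (A $ 2 $ 1) :: real\<bar>"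
  define e where "e = \<bar>l2 - of_int (A $ 1 $ 1)\<bar>"
  define d where "d = \<bar>l2 - l1\<bar>"
  have cd: "c > 0" "d > 0" "e \<ge> 0" using A21_nonzero l1_ne_l2 by (auto simp: c_def d_def e_def)
  have "norm x \<le> (1 / c + e / c / d + 1 / d) * (\<bar>u x\<bar> + \<bar>v x\<bar>)" for x
  proof -
    have "u x - v x = (l2 - l1) * x $ 2" by (simp add: u_def v_def algebra_simps)
    then have "d * \<bar>x $ 2\<bar> = \<bar>u x - v x\<bar>" by (simp add: d_def abs_mult)
    also have "\<dots> \<le> \<bar>u x\<bar> + \<bar>v x\<bar>" by linarith
    finally have 2: "\<bar>x $ 2\<bar> \<le> (\<bar>u x\<bar> + \<bar>v x\<bar>) / d" using cd by (simp add: field_simps)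
    have "of_int (A $ 2 $ 1) * x $ 1 = u x - (l2 - of_int (A $ 1 $ 1)) * x $ 2" by (simp add: u_def)
    then have "c * \<bar>x $ 1\<bar> = \<bar>u x - (l2 - of_int (A $ 1 $ 1)) * x $ 2\<bar>"
      by (simp add: c_def abs_mult[symmetric])
    also have "\<dots> \<le> \<bar>u x\<bar> + e * \<bar>x $ 2\<bar>"
      unfolding e_def abs_mult[symmetric] by linarith
    also have "\<dots> \<le> (\<bar>u x\<bar> + \<bar>v x\<bar>) + e * ((\<bar>u x\<bar> + \<bar>v x\<bar>) / d)"
      using 2 cd by (intro add_mono mult_left_mono) auto
    finally have "\<bar>x $ 1\<bar> \<le> ((\<bar>u x\<bar> + \<bar>v x\<bar>) + e * ((\<bar>u x\<bar> + \<bar>v x\<bar>) / d)) / c"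
      using cd by (simp only: pos_le_divide_eq mult.commute)
    then have 1: "\<bar>x $ 1\<bar> \<le> (\<bar>u x\<bar> + \<bar>v x\<bar>) / c + e * ((\<bar>u x\<bar> + \<bar>v x\<bar>) / d) / c"
      by (simp only: add_divide_distrib)
    have "norm x \<le> \<bar>x $ 1\<bar> + \<bar>x $ 2\<bar>" using norm_le_l1_cart[of x] by (simp add: sum_2)
    also have "\<dots> \<le> (\<bar>u x\<bar> + \<bar>v x\<bar>) / c + e * ((\<bar>u x\<bar> + \<bar>v x\<bar>) / d) / c + (\<bar>u x\<bar> + \<bar>v x\<bar>) / d"
      using 1 2 by linarith
    also have "\<dots> = (1 / c + e / c / d + 1 / d) * (\<bar>u x\<bar> + \<bar>v x\<bar>)"
      using cd by (simp add: field_simps)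
    finally show ?thesis .
  qed
  moreover have "0 < 1 / c + e / c / d + 1 / d" using cd by (simp add: add_pos_nonneg add_nonneg_pos)
  ultimately show ?thesis by blast
qed

text \<open>
  The vector \<open>A\<^sup>k e\<^sub>1\<close> has a small \<open>v\<close>-coordinate, and dividing it by the gcd of its entries makes
  it primitive without increasing the \<open>v\<close>-coordinate. Bezout's identity completes it to a basis, and a multiple
  of the first vector is added to the second to reduce the second \<open>v\<close>-coordinate modulo the first.
\<close>

lemma contracted_lattice_basis:
  assumes "0 < \<epsilon>"
  obtains p q r t :: int where "p * t - q * r = 1"
    "\<bar>v (vector [of_int p, of_int q])\<bar> < \<epsilon>" "\<bar>v (vector [of_int r, of_int t])\<bar> < \<epsilon>"
proof -
  define e1 :: "real ^ 2" where "e1 = vector [1, 0]"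
  have e1: "e1 \<in> lattice" "e1 \<noteq> 0" by (auto simp: e1_def lattice_iff vec_eq_iff forall_2)
  have "(\<lambda>n. \<bar>l1\<bar> ^ n * \<bar>v e1\<bar>) \<longlonglongrightarrow> 0 * \<bar>v e1\<bar>"
    using l1 by (intro tendsto_mult LIMSEQ_power_zero tendsto_const) auto
  then obtain k where k: "\<bar>l1\<bar> ^ k * \<bar>v e1\<bar> < \<epsilon>"
    using order_tendstoD(2)[of _ "0 * \<bar>v e1\<bar>" sequentially \<epsilon>] assms unfolding eventually_sequentially by auto
  define m where "m = iterate k e1"
  have "v e1 \<noteq> 0" using uv_lattice_ge_1[OF e1] by auto
  then have vm: "v m \<noteq> 0" "\<bar>v m\<bar> < \<epsilon>" using k l1 by (auto simp: m_def v_iterate abs_mult power_abs)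
  have "m \<in> lattice" unfolding m_def by (rule iterate_lattice[OF e1(1)])
  then obtain i j where ij: "m $ 1 = of_int i" "m $ 2 = of_int j"
    unfolding lattice_iff by (auto elim!: Ints_cases)
  define g where "g = gcd i j"
  have "i \<noteq> 0 \<or> j \<noteq> 0" using vm(1) ij by (auto simp: v_def)
  then have g: "g > 0" by (auto simp: g_def)
  obtain p q where pq: "i = g * p" "j = g * q" "coprime p q"
    using gcd_coprime_exists[of i j] g unfolding g_def by (metis less_irrefl mult.commute)
  have vm': "v m = of_int g * v (vector [of_int p, of_int q])"
    by (simp add: v_def ij pq algebra_simps)
  define w where "w = v (vector [of_int p, of_int q])"
  have w: "w \<noteq> 0" using vm vm' w_def by auto
  have "\<bar>w\<bar> \<le> of_int g * \<bar>w\<bar>" using g mult_right_mono[of 1 "of_int g" "\<bar>w\<bar>"] by simp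
  then have we: "\<bar>w\<bar> < \<epsilon>" using vm' vm(2) g by (simp add: w_def abs_mult)
  obtain x y where xy: "x * p + y * q = 1" using pq(3) bezout_int[of p q] by auto
  define z where "z = v (vector [of_int (- y), of_int x])"
  \<comment> \<open>reduce \<open>z\<close> modulo \<open>w\<close>\<close>
  define s where "s = - round (z / w)"
  have "\<bar>z / w + of_int s\<bar> \<le> 1 / 2"
    using of_int_round_abs_le[of "z / w"] by (simp add: s_def abs_minus_commute)
  then have "\<bar>z / w + of_int s\<bar> * \<bar>w\<bar> \<le> 1 / 2 * \<bar>w\<bar>" by (rule mult_right_mono) simp
  moreover have "(z / w + of_int s) * w = z + of_int s * w" using w by (simp add: field_simps)
  ultimately have "\<bar>z + of_int s * w\<bar> \<le> 1 / 2 * \<bar>w\<bar>" by (metis abs_mult)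
  then have "\<bar>z + of_int s * w\<bar> < \<epsilon>" using we by linarith
  moreover have "v (vector [of_int (- y + s * p), of_int (x + s * q)]) = z + of_int s * w"
    by (simp add: z_def w_def v_def algebra_simps)
  moreover have "p * (x + s * q) - q * (- y + s * p) = 1"
    using xy by (simp add: algebra_simps)
  ultimately show thesis using that[of p "x + s * q" q "- y + s * p"] we w_def by simp
qed

end

section \<open>Ubiquity of the recurrence sets\<close>

text \<open>
  A ball of radius \<open>R\<close> takes, up to a constant, at most the fraction \<open>(R / a) powr \<alpha> * (R / b) powr (s - \<alpha>)\<close>
  of a box with short side \<open>a\<close> and long side \<open>b\<close>. So \<open>\<alpha>\<close> is the part of the exponent \<open>s\<close> that is spent on the
  short side, and the equation makes the powers of \<open>exp n\<close> cancel in \<open>box_density_le\<close>. It is 0 for \<open>L \<le> \<tau>\<close>;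
  for \<open>\<tau> < L\<close> it is \<open>s - 1\<close>, and the long side has the exponent 1.
\<close>

lemma interpolation_exponent:
  fixes L \<tau> :: real
  assumes "0 < L" "0 < \<tau>" and s: "s = min (2 * L / (\<tau> + L)) (L / \<tau>)"
  obtains \<alpha> where "0 \<le> \<alpha>" "\<alpha> \<le> 1" "\<alpha> \<le> s" "s \<le> 1 + \<alpha>" "\<tau> * s + L * \<alpha> = L" "0 < s" "s \<le> 2"
proof (cases "L \<le> \<tau>")
  case True
  then have "L / \<tau> \<le> 2 * L / (\<tau> + L)" using assms by (simp add: field_simps)
  then have "s = L / \<tau>" using s by simp
  moreover have "L / \<tau> \<le> 1" using True assms(1,2) by simp
  then have "L / \<tau> \<le> 2" by linarith
  ultimately show thesis using that[of 0] True assms(1,2) by simp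
next
  case False
  then have "2 * L / (\<tau> + L) \<le> L / \<tau>" using assms by (simp add: field_simps)
  then have s: "s = 2 * L / (\<tau> + L)" using s by simp
  have "1 \<le> s" "s \<le> 2" using False assms(1,2) unfolding s by (simp_all add: field_simps)
  moreover have "s * (\<tau> + L) = 2 * L" using assms(1,2) by (simp add: s)
  then have "\<tau> * s + L * (s - 1) = L" by (simp add: algebra_simps)
  ultimately show thesis using that[of "s - 1"] by simp
qed

lemma min_div_le_powr:
  fixes a R \<alpha> :: real
  assumes "0 < a" "0 < R" "0 \<le> \<alpha>" "\<alpha> \<le> 1"
  shows "min a R / a \<le> (R / a) powr \<alpha>"
proof (cases "a \<le> R")
  case True
  then show ?thesis using assms ge_one_powr_ge_zero[of "R / a" \<alpha>] by simp
next
  case False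
  then have "(R / a) powr 1 \<le> (R / a) powr \<alpha>" using assms by (intro powr_mono') auto
  then show ?thesis using False assms by simp
qed

lemma mult_min_le:
  fixes a R :: real
  assumes "0 < a" "0 < R"
  shows "(a + R) * (min a R / a) \<le> 2 * R"
proof (cases "a \<le> R")
  case True
  then show ?thesis using assms by simp
next
  case False
  then have "R * R \<le> a * R" using assms by (intro mult_right_mono) auto
  then show ?thesis using False assms by (simp add: field_simps)
qed

context hyperbolic_matrix
begin

definition near_return :: "real \<Rightarrow> nat \<Rightarrow> (real ^ 2) set" where
  "near_return \<tau> n = {x. \<exists>m\<in>lattice. norm (displacement n x - m) < exp (- real n * \<tau>)}"

definition periodic_lattice :: "nat \<Rightarrow> (real ^ 2) set" where
  "periodic_lattice n = {p. displacement n p \<in> lattice}"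

definition eigenbox :: "real \<Rightarrow> real \<Rightarrow> real ^ 2 \<Rightarrow> (real ^ 2) set" where
  "eigenbox a b p = {x. \<bar>u x - u p\<bar> < a \<and> \<bar>v x - v p\<bar> < b}"

definition \<Phi> :: "real ^ 2 \<Rightarrow> real ^ 2" where
  "\<Phi> x = vector [u x, v x]"

lemma linear_\<Phi>: "linear \<Phi>"
  by (rule linearI) (simp_all add: \<Phi>_def vec_eq_iff forall_2 u_add v_add u_scale v_scale)

lemma det_\<Phi>: "det (matrix \<Phi>) \<noteq> 0"
proof -
  have "inj \<Phi>"
    using uv_eq_0 unfolding linear_injective_0[OF linear_\<Phi>]
    by (auto simp: \<Phi>_def vec_eq_iff forall_2)
  then show ?thesis using det_nz_iff_inj[OF linear_\<Phi>] by blast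
qed

lemma abs_l2_power: "\<bar>l2\<bar> ^ n = exp (real n * ln \<bar>l2\<bar>)"
  using l2 by (simp add: exp_of_nat_mult)

lemma factor_bounds:
  assumes "1 \<le> n"
  shows "(1 - 1 / \<bar>l2\<bar>) * \<bar>l2\<bar> ^ n \<le> \<bar>l2 ^ n - 1\<bar>" "\<bar>l2 ^ n - 1\<bar> \<le> 2 * \<bar>l2\<bar> ^ n"
    "1 - \<bar>l1\<bar> \<le> \<bar>l1 ^ n - 1\<bar>" "\<bar>l1 ^ n - 1\<bar> \<le> 2"
proof -
  have "\<bar>l2\<bar> ^ 1 \<le> \<bar>l2\<bar> ^ n" using l2 assms by (intro power_increasing) auto
  then have l2n: "\<bar>l2\<bar> \<le> \<bar>l2\<bar> ^ n" by simp
  then have "1 \<le> 1 / \<bar>l2\<bar> * \<bar>l2\<bar> ^ n" using l2 by (simp add: field_simps)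
  then have "(1 - 1 / \<bar>l2\<bar>) * \<bar>l2\<bar> ^ n \<le> \<bar>l2\<bar> ^ n - 1" by (simp add: algebra_simps)
  also have "\<dots> \<le> \<bar>l2 ^ n - 1\<bar>" by (simp add: power_abs[symmetric])
  finally show "(1 - 1 / \<bar>l2\<bar>) * \<bar>l2\<bar> ^ n \<le> \<bar>l2 ^ n - 1\<bar>" .
  have "\<bar>l2 ^ n - 1\<bar> \<le> \<bar>l2\<bar> ^ n + 1" by (simp add: power_abs[symmetric])
  then show "\<bar>l2 ^ n - 1\<bar> \<le> 2 * \<bar>l2\<bar> ^ n" using l2n l2 by linarith
  have "\<bar>l1\<bar> ^ n \<le> \<bar>l1\<bar> ^ 1" using l1 assms by (intro power_decreasing) auto
  then have l1n: "\<bar>l1 ^ n\<bar> \<le> \<bar>l1\<bar>" by (simp add: power_abs)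
  then show "1 - \<bar>l1\<bar> \<le> \<bar>l1 ^ n - 1\<bar>" "\<bar>l1 ^ n - 1\<bar> \<le> 2" using l1 by linarith+
qed

lemma factors_pos:
  assumes "1 \<le> n" shows "0 < \<bar>l2 ^ n - 1\<bar>" "0 < \<bar>l1 ^ n - 1\<bar>"
proof -
  have "0 < (1 - 1 / \<bar>l2\<bar>) * \<bar>l2\<bar> ^ n" using l2 by (intro mult_pos_pos) auto
  then show "0 < \<bar>l2 ^ n - 1\<bar>" using factor_bounds(1)[OF assms] by linarith
  show "0 < \<bar>l1 ^ n - 1\<bar>" using factor_bounds(3)[OF assms] l1 by linarith
qed

lemma det_displacement: "\<bar>det (matrix (displacement n))\<bar> = \<bar>l2 ^ n - 1\<bar> * \<bar>l1 ^ n - 1\<bar>"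
proof -
  define G :: "real ^ 2 \<Rightarrow> real ^ 2" where "G y = vector [(l2 ^ n - 1) * y $ 1, (l1 ^ n - 1) * y $ 2]" for y
  have G: "linear G"
    by (rule linearI) (simp_all add: G_def vec_eq_iff forall_2 algebra_simps)
  have "\<Phi> \<circ> displacement n = G \<circ> \<Phi>"
    by (rule ext) (simp add: \<Phi>_def G_def u_displacement v_displacement vec_eq_iff forall_2)
  then have "matrix \<Phi> ** matrix (displacement n) = matrix G ** matrix \<Phi>"
    by (metis matrix_compose G linear_displacement linear_\<Phi>)
  then have "det (matrix \<Phi>) * det (matrix (displacement n)) = det (matrix G) * det (matrix \<Phi>)"
    by (metis det_mul)
  then have "det (matrix (displacement n)) = det (matrix G)" using det_\<Phi> by simp
  also have "\<dots> = (l2 ^ n - 1) * (l1 ^ n - 1)"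
    by (simp add: det_2 matrix_def G_def axis_def)
  finally show ?thesis by (simp add: abs_mult)
qed

lemma inj_displacement: "1 \<le> n \<Longrightarrow> inj (displacement n)" and surj_displacement: "1 \<le> n \<Longrightarrow> surj (displacement n)"
proof -
  assume n: "1 \<le> n"
  have "det (matrix (displacement n)) \<noteq> 0" using det_displacement[of n] factors_pos[OF n] by auto
  then show "inj (displacement n)" using det_nz_iff_inj[OF linear_displacement] by blast
  then show "surj (displacement n)" by (rule linear_injective_imp_surjective[OF linear_displacement]) simp
qed

lemma periodic_lattice_separated:
  assumes "1 \<le> n" "p \<in> periodic_lattice n" "q \<in> periodic_lattice n" "p \<noteq> q"
  shows "1 / (\<bar>l2 ^ n - 1\<bar> * \<bar>l1 ^ n - 1\<bar>) \<le> \<bar>u p - u q\<bar> * \<bar>v p - v q\<bar>"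
proof -
  have Dd: "displacement n (p - q) = displacement n p - displacement n q" by (rule linear_diff[OF linear_displacement])
  have "displacement n (p - q) \<in> lattice" unfolding Dd using assms by (intro lattice_diff) (auto simp: periodic_lattice_def)
  moreover have "displacement n (p - q) \<noteq> 0" unfolding Dd using inj_displacement[OF assms(1)] assms(4) by (auto dest: injD)
  ultimately have "1 \<le> \<bar>u (displacement n (p - q))\<bar> * \<bar>v (displacement n (p - q))\<bar>" by (rule uv_lattice_ge_1)
  also have "\<dots> = (\<bar>l2 ^ n - 1\<bar> * \<bar>l1 ^ n - 1\<bar>) * (\<bar>u p - u q\<bar> * \<bar>v p - v q\<bar>)"
    by (simp add: u_displacement v_displacement u_diff v_diff abs_mult)
  finally show ?thesis using factors_pos[OF assms(1)]
    by (subst pos_divide_le_eq) (auto simp: mult.commute)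
qed

lemma countable_periodic_lattice:
  assumes "1 \<le> n" shows "countable (periodic_lattice n)"
proof -
  have "countable (displacement n ` periodic_lattice n)"
    by (rule countable_subset[OF _ countable_lattice]) (auto simp: periodic_lattice_def)
  then show ?thesis
    by (rule countable_image_inj_on) (rule inj_on_subset[OF inj_displacement[OF assms] subset_UNIV])
qed

lemma card_periodic_lattice_box:
  assumes "1 \<le> n" "finite S" "S \<subseteq> periodic_lattice n" "0 < U" "0 \<le> V"
    and "\<And>p. p \<in> S \<Longrightarrow> \<bar>u p - u\<^sub>0\<bar> \<le> U \<and> \<bar>v p - v\<^sub>0\<bar> \<le> V"
  shows "real (card S) \<le> 1 + 4 * U * V * (\<bar>l2 ^ n - 1\<bar> * \<bar>l1 ^ n - 1\<bar>)"
proof -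
  let ?N = "\<bar>l2 ^ n - 1\<bar> * \<bar>l1 ^ n - 1\<bar>"
  have "0 < ?N" using factors_pos[OF assms(1)] by (rule mult_pos_pos)
  have "real (card S) \<le> 1 + 4 * U * V / (1 / ?N)"
  proof (rule card_hyperbolically_separated[of S _ _ _ u u\<^sub>0 v v\<^sub>0])
    show "0 < 1 / ?N" using \<open>0 < ?N\<close> by simp
    show "1 / ?N \<le> \<bar>u p - u q\<bar> * \<bar>v p - v q\<bar>" if "p \<in> S" "q \<in> S" "p \<noteq> q" for p q
      by (rule periodic_lattice_separated[OF assms(1)]) (use that assms(3) in blast)+
  qed (use assms in blast)+
  then show ?thesis by simp
qed

text \<open>
  The tiles are the preimages under \<open>A\<^sup>n - 1\<close> of the fundamental parallelograms spanned by \<open>w1\<close>, \<open>w2\<close>. Dividing by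
  \<open>l1 ^ n - 1\<close>, which is bounded away from 0, does not shrink the \<open>v\<close>-width, so the width must
  already be small in the basis; the \<open>u\<close>-width is made small by \<open>n\<close>.
\<close>

lemma periodic_tiling:
  assumes n: "1 \<le> n" and det: "p * t - q * r = (1::int)"
  defines "w1 \<equiv> vector [of_int p, of_int q] :: real ^ 2"
    and "w2 \<equiv> vector [of_int r, of_int t] :: real ^ 2"
  obtains T where "disjoint_family_on T (periodic_lattice n)"
    "(\<Union>x\<in>periodic_lattice n. T x) = UNIV"
    "\<And>x. T x \<in> sets borel"
    "\<And>x. measure lborel (T x) \<le> 1 / (\<bar>l2 ^ n - 1\<bar> * \<bar>l1 ^ n - 1\<bar>)"
    "\<And>x y. y \<in> T x \<Longrightarrow> \<bar>u y - u x\<bar> \<le> (\<bar>u w1\<bar> + \<bar>u w2\<bar>) / \<bar>l2 ^ n - 1\<bar>"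
    "\<And>x y. y \<in> T x \<Longrightarrow> \<bar>v y - v x\<bar> \<le> (\<bar>v w1\<bar> + \<bar>v w2\<bar>) / \<bar>l1 ^ n - 1\<bar>"
proof -
  define B :: "real ^ 2 \<Rightarrow> real ^ 2" where
    "B y = vector [of_int t * y $ 1 - of_int r * y $ 2, of_int p * y $ 2 - of_int q * y $ 1]" for y
  have linB: "linear B"
    by (rule linearI) (simp_all add: B_def vec_eq_iff forall_2 algebra_simps)
  have rdet: "real_of_int p * of_int t - of_int q * of_int r = 1"
    using det by (metis of_int_1 of_int_diff of_int_mult)
  have expand: "y = (B y $ 1) *\<^sub>R w1 + (B y $ 2) *\<^sub>R w2" for y
  proof -
    have "B y $ 1 * of_int p + B y $ 2 * of_int r = (real_of_int p * of_int t - of_int q * of_int r) * y $ 1"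
      "B y $ 1 * of_int q + B y $ 2 * of_int t = (real_of_int p * of_int t - of_int q * of_int r) * y $ 2"
      by (simp_all add: B_def algebra_simps)
    then show ?thesis unfolding rdet by (simp add: vec_eq_iff forall_2 w1_def w2_def)
  qed
  have Blat: "B y \<in> lattice \<longleftrightarrow> y \<in> lattice" for y
  proof
    assume "B y \<in> lattice"
    then have "(B y $ 1) *\<^sub>R w1 + (B y $ 2) *\<^sub>R w2 \<in> lattice"
      by (auto simp: lattice_iff w1_def w2_def intro!: Ints_add Ints_mult)
    then show "y \<in> lattice" using expand[of y] by simp
  qed (auto simp: lattice_iff B_def intro!: Ints_diff Ints_mult)
  have detB: "det (matrix B) = 1"
    using rdet by (simp add: det_2 matrix_def B_def axis_def algebra_simps)
  define h where "h = B \<circ> displacement n"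
  have linh: "linear h" unfolding h_def by (rule linear_compose[OF linear_displacement linB])
  have deth: "\<bar>det (matrix h)\<bar> = \<bar>l2 ^ n - 1\<bar> * \<bar>l1 ^ n - 1\<bar>"
    unfolding h_def matrix_compose[OF linear_displacement linB] by (simp add: det_mul detB det_displacement)
  have deth0: "det (matrix h) \<noteq> 0"
    using deth mult_pos_pos[OF factors_pos[OF n]] by auto
  have hlat: "h x \<in> lattice \<longleftrightarrow> x \<in> periodic_lattice n" for x
    by (simp add: h_def Blat periodic_lattice_def)
  have injh: "inj h" using det_nz_iff_inj[OF linh] deth0 by blast
  then have surjh: "surj h" by (rule linear_injective_imp_surjective[OF linh]) simp
  have hD: "displacement n (y - x) = (h y $ 1 - h x $ 1) *\<^sub>R w1 + (h y $ 2 - h x $ 2) *\<^sub>R w2" for x y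
  proof -
    have "displacement n (y - x) = (B (displacement n (y - x)) $ 1) *\<^sub>R w1 + (B (displacement n (y - x)) $ 2) *\<^sub>R w2"
      by (rule expand)
    moreover have "B (displacement n (y - x)) = h y - h x"
      using linear_diff[OF linh] by (simp add: h_def)
    ultimately show ?thesis by simp
  qed
  \<comment> \<open>half-open unit squares in the lattice coordinates\<close>
  define T where "T x = {y. \<forall>i. h x $ i \<le> h y $ i \<and> h y $ i < h x $ i + 1}" for x
  have disj: "disjoint_family_on T (periodic_lattice n)"
    unfolding disjoint_family_on_def
  proof (intro ballI impI, rule ccontr)
    fix x y assume xy: "x \<in> periodic_lattice n" "y \<in> periodic_lattice n" "x \<noteq> y" "T x \<inter> T y \<noteq> {}"
    then obtain z where z: "z \<in> T x" "z \<in> T y" by blast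
    have "h x $ i = h y $ i" for i
    proof -
      have "h x \<in> lattice" "h y \<in> lattice" using xy(1,2) hlat by blast+
      then have "h x $ i - h y $ i \<in> \<int>" by (simp add: lattice_def)
      moreover have "\<bar>h x $ i - h y $ i\<bar> < 1"
        using z unfolding T_def mem_Collect_eq by (smt (verit))
      ultimately show ?thesis using Ints_nonzero_abs_less1 by fastforce
    qed
    then have "h x = h y" by (simp add: vec_eq_iff)
    then show False using injh xy(3) by (auto dest: injD)
  qed
  have cov: "(\<Union>x\<in>periodic_lattice n. T x) = UNIV"
  proof (intro equalityI subsetI UNIV_I)
    fix y
    obtain x where x: "(\<chi> i. of_int \<lfloor>h y $ i\<rfloor>) = h x" using surjh unfolding surj_def by blast
    then have hx: "h x $ i = of_int \<lfloor>h y $ i\<rfloor>" for i by (simp add: vec_eq_iff)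
    have "h x \<in> lattice" by (simp add: lattice_def hx)
    moreover have "y \<in> T x" by (simp add: T_def hx)
    ultimately show "y \<in> (\<Union>x\<in>periodic_lattice n. T x)" using hlat by blast
  qed
  have conth: "continuous_on UNIV (\<lambda>y. h y $ i)" for i
    using linear_continuous_on[OF linh[unfolded linear_conv_bounded_linear]]
    by (intro continuous_on_component)
  have borelT: "T x \<in> sets borel" for x
  proof -
    have mh: "(\<lambda>y. h y $ i) \<in> borel_measurable borel" for i
      using conth by (intro borel_measurable_continuous_onI)
    have "T x = {y \<in> space borel. \<forall>i. h x $ i \<le> h y $ i \<and> h y $ i < h x $ i + 1}"
      by (simp add: T_def)
    also have "\<dots> \<in> sets borel" using mh by measurable
    finally show ?thesis .
  qed
  have meas: "measure lborel (T x) \<le> 1 / (\<bar>l2 ^ n - 1\<bar> * \<bar>l1 ^ n - 1\<bar>)" for x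
  proof -
    let ?S = "cbox (h x) (h x + vector [1, 1])"
    have S: "?S \<in> sets borel" "bounded ?S" by simp_all
    have "measure lborel (h -` ?S) = measure lborel ?S / \<bar>det (matrix h)\<bar>"
      by (rule measure_linear_vimage[OF linh deth0 S])
    also have "measure lborel ?S = 1" by (subst measure_cbox_2) simp_all
    finally have m: "measure lborel (h -` ?S) = 1 / (\<bar>l2 ^ n - 1\<bar> * \<bar>l1 ^ n - 1\<bar>)" by (simp add: deth)
    have "T x \<subseteq> h -` ?S" by (auto simp: T_def mem_box_cart forall_2 less_imp_le)
    moreover have "h -` ?S \<in> fmeasurable lborel"
    proof (rule fmeasurableI)
      have "0 < measure lborel (h -` ?S)" using m mult_pos_pos[OF factors_pos[OF n]] by simp
      then show "emeasure lborel (h -` ?S) < \<infinity>"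
        by (metis enn2real_top infinity_ennreal_def less_irrefl measure_def top.not_eq_extremum)
      show "h -` ?S \<in> sets lborel"
        using linear_continuous_on[OF linh[unfolded linear_conv_bounded_linear]] S(1)
        by (simp, metis borel_measurable_continuous_onI measurable_sets_borel)
    qed
    ultimately have "measure lborel (T x) \<le> measure lborel (h -` ?S)"
      using borelT by (intro measure_mono_fmeasurable) auto
    then show ?thesis by (simp only: m)
  qed
  have bnd: "\<bar>k\<bar> * \<bar>g y - g x\<bar> \<le> \<bar>g w1\<bar> + \<bar>g w2\<bar>"
    if y: "y \<in> T x" and g: "\<And>y z. g (y + z) = g y + g z" "\<And>c y. g (c *\<^sub>R y) = c * g y"
      "\<And>y. g (displacement n y) = k * g y" for g :: "real ^ 2 \<Rightarrow> real" and k x y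
  proof -
    have "g y = g x + g (y - x)" using g(1)[of x "y - x"] by simp
    then have "k * (g y - g x) = g (displacement n (y - x))" using g(3)[of "y - x"] by simp
    also have "\<dots> = (h y $ 1 - h x $ 1) * g w1 + (h y $ 2 - h x $ 2) * g w2"
      unfolding hD by (simp only: g)
    finally have "\<bar>k\<bar> * \<bar>g y - g x\<bar> \<le> \<bar>(h y $ 1 - h x $ 1) * g w1\<bar> + \<bar>(h y $ 2 - h x $ 2) * g w2\<bar>"
      by (metis abs_mult abs_triangle_ineq)
    also have "\<dots> \<le> 1 * \<bar>g w1\<bar> + 1 * \<bar>g w2\<bar>"
      unfolding abs_mult using y by (intro add_mono mult_right_mono) (auto simp: T_def forall_2)
    finally show ?thesis by simp
  qed
  have ubound: "\<bar>u y - u x\<bar> \<le> (\<bar>u w1\<bar> + \<bar>u w2\<bar>) / \<bar>l2 ^ n - 1\<bar>" if "y \<in> T x" for x y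
    using bnd[OF that u_add u_scale u_displacement] factors_pos(1)[OF n]
    by (subst pos_le_divide_eq) (simp_all add: mult.commute)
  have vbound: "\<bar>v y - v x\<bar> \<le> (\<bar>v w1\<bar> + \<bar>v w2\<bar>) / \<bar>l1 ^ n - 1\<bar>" if "y \<in> T x" for x y
    using bnd[OF that v_add v_scale v_displacement] factors_pos(2)[OF n]
    by (subst pos_le_divide_eq) (simp_all add: mult.commute)
  show thesis by (rule that[OF disj cov borelT meas ubound vbound])
qed

lemma eigenbox_eq_vimage:
  "eigenbox a b p = \<Phi> -` box (vector [u p - a, v p - b]) (vector [u p + a, v p + b])"
  by (auto simp: eigenbox_def \<Phi>_def mem_box_cart forall_2 abs_less_iff)

lemma continuous_uv: "continuous_on UNIV u" "continuous_on UNIV v"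
  unfolding u_def[abs_def] v_def[abs_def] by (intro continuous_intros)+

lemma open_eigenbox: "open (eigenbox a b p)"
  unfolding eigenbox_def
  by (intro open_Collect_conj open_Collect_less continuous_intros continuous_uv)

lemma closure_eigenbox: "closure (eigenbox a b p) \<subseteq> {x. \<bar>u x - u p\<bar> \<le> a \<and> \<bar>v x - v p\<bar> \<le> b}"
proof (rule closure_minimal)
  show "closed {x. \<bar>u x - u p\<bar> \<le> a \<and> \<bar>v x - v p\<bar> \<le> b}"
    by (intro closed_Collect_conj closed_Collect_le continuous_intros continuous_uv)
qed (auto simp: eigenbox_def)

lemma measure_eigenbox:
  assumes "0 < a" "0 < b"
  shows "measure lborel (eigenbox a b p) = 4 * a * b / \<bar>det (matrix \<Phi>)\<bar>"
proof -
  let ?l = "vector [u p - a, v p - b] :: real ^ 2" and ?h = "vector [u p + a, v p + b] :: real ^ 2"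
  have "measure lborel (eigenbox a b p) = measure lborel (box ?l ?h) / \<bar>det (matrix \<Phi>)\<bar>"
    unfolding eigenbox_eq_vimage by (rule measure_linear_vimage[OF linear_\<Phi> det_\<Phi>]) simp_all
  also have "measure lborel (box ?l ?h) = measure lborel (cbox ?l ?h)"
    by (simp only: measure_lborel_box_eq measure_lborel_cbox_eq)
  also have "\<dots> = 4 * a * b" using assms by (subst measure_cbox_2) (simp_all add: algebra_simps)
  finally show ?thesis .
qed

lemma measure_eigenbox_Int_le:
  assumes "0 < a" "0 < b" "0 < R"
    and B: "\<And>x. x \<in> B \<Longrightarrow> \<bar>u x - u z\<bar> < R \<and> \<bar>v x - v z\<bar> < R" and "B \<in> sets borel"
  shows "measure lborel (eigenbox a b p \<inter> B) \<le> 4 * min a R * min b R / \<bar>det (matrix \<Phi>)\<bar>"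
proof -
  \<comment> \<open>in each coordinate, keep the centre of the shorter of the two intervals\<close>
  define cu where "cu = (if a \<le> R then u p else u z)"
  define cv where "cv = (if b \<le> R then v p else v z)"
  obtain y where y: "\<Phi> y = vector [cu, cv]"
  proof -
    have "inj \<Phi>" using det_nz_iff_inj[OF linear_\<Phi>] det_\<Phi> by blast
    then have "surj \<Phi>" by (rule linear_injective_imp_surjective[OF linear_\<Phi>]) simp
    then show thesis using that unfolding surj_def by metis
  qed
  then have uvy: "u y = cu" "v y = cv" by (auto simp: \<Phi>_def vec_eq_iff forall_2)
  have sub: "eigenbox a b p \<inter> B \<subseteq> eigenbox (min a R) (min b R) y"
    using B by (auto simp: eigenbox_def uvy cu_def cv_def min_def)
  have pos: "0 < min a R" "0 < min b R" using assms by auto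
  have "0 < measure lborel (eigenbox (min a R) (min b R) y)"
    unfolding measure_eigenbox[OF pos] using pos det_\<Phi> by simp
  then have "emeasure lborel (eigenbox (min a R) (min b R) y) < \<infinity>"
    by (metis enn2real_top infinity_ennreal_def less_irrefl measure_def top.not_eq_extremum)
  then have "eigenbox (min a R) (min b R) y \<in> fmeasurable lborel"
    using open_eigenbox by (intro fmeasurableI) auto
  then have "measure lborel (eigenbox a b p \<inter> B) \<le> measure lborel (eigenbox (min a R) (min b R) y)"
    using sub open_eigenbox \<open>B \<in> sets borel\<close> by (intro measure_mono_fmeasurable) auto
  then show ?thesis by (simp only: measure_eigenbox[OF pos])
qed

text \<open>
  The set \<open>B\<close> meets at most \<open>1 + 4 * (a + R) * (b + R) * N\<close> of the boxes, where \<open>1 / N\<close> is the covolume, and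
  takes from each at most the fraction \<open>min a R * min b R / (a * b)\<close>. The summand 1 gives the first term of the
  bound; in the other one \<open>N\<close> cancels against the mass \<open>1 / N\<close> of a tile.
\<close>

lemma eigenbox_sum_le:
  assumes n: "1 \<le> n" and ab: "0 < a" "0 < b" and P': "finite P'" "P' \<subseteq> periodic_lattice n"
    and m: "\<And>p. 0 \<le> m p" "\<And>p. m p \<le> 1 / (\<bar>l2 ^ n - 1\<bar> * \<bar>l1 ^ n - 1\<bar>)"
    and R: "0 < R" and B: "\<And>x. x \<in> B \<Longrightarrow> \<bar>u x - u z\<bar> < R \<and> \<bar>v x - v z\<bar> < R" "B \<in> sets borel"
  shows "(\<Sum>p\<in>P'. m p * (measure lborel (eigenbox a b p \<inter> B) / measure lborel (eigenbox a b p)))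
     \<le> 1 / (\<bar>l2 ^ n - 1\<bar> * \<bar>l1 ^ n - 1\<bar>) * (min a R / a * (min b R / b)) + 16 * R\<^sup>2"
proof -
  define N where "N = \<bar>l2 ^ n - 1\<bar> * \<bar>l1 ^ n - 1\<bar>"
  have N: "0 < N" unfolding N_def using factors_pos[OF n] by (rule mult_pos_pos)
  define \<mu> where "\<mu> = min a R / a * (min b R / b)"
  have \<mu>: "0 \<le> \<mu>" using ab R by (simp add: \<mu>_def)
  define P1 where "P1 = {p \<in> P'. eigenbox a b p \<inter> B \<noteq> {}}"
  have P1: "finite P1" "P1 \<subseteq> periodic_lattice n" using P' by (auto simp: P1_def)
  have \<Delta>: "0 < \<bar>det (matrix \<Phi>)\<bar>" using det_\<Phi> by simp
  have "(\<Sum>p\<in>P'. m p * (measure lborel (eigenbox a b p \<inter> B) / measure lborel (eigenbox a b p)))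
      = (\<Sum>p\<in>P1. m p * (measure lborel (eigenbox a b p \<inter> B) / measure lborel (eigenbox a b p)))"
    using P'(1) by (intro sum.mono_neutral_right) (auto simp: P1_def)
  also have "\<dots> \<le> (\<Sum>p\<in>P1. 1 / N * \<mu>)"
  proof (intro sum_mono mult_mono)
    fix p
    have "measure lborel (eigenbox a b p \<inter> B) / measure lborel (eigenbox a b p)
       \<le> (4 * min a R * min b R / \<bar>det (matrix \<Phi>)\<bar>) / measure lborel (eigenbox a b p)"
      by (intro divide_right_mono measure_eigenbox_Int_le[where z = z] ab R B) simp_all
    also have "\<dots> = \<mu>" unfolding measure_eigenbox[OF ab] \<mu>_def using \<Delta> ab by (simp add: field_simps)
    finally show "measure lborel (eigenbox a b p \<inter> B) / measure lborel (eigenbox a b p) \<le> \<mu>" .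
  qed (use m N in \<open>auto simp: N_def\<close>)
  also have "\<dots> = real (card P1) * (1 / N * \<mu>)" by simp
  also have "\<dots> \<le> (1 + 4 * (a + R) * (b + R) * N) * (1 / N * \<mu>)"
  proof (rule mult_right_mono)
    show "real (card P1) \<le> 1 + 4 * (a + R) * (b + R) * N"
      unfolding N_def
    proof (rule card_periodic_lattice_box[OF n P1])
      fix p assume "p \<in> P1"
      then obtain x where "x \<in> eigenbox a b p" "x \<in> B" by (auto simp: P1_def)
      then show "\<bar>u p - u z\<bar> \<le> a + R \<and> \<bar>v p - v z\<bar> \<le> b + R"
        using B(1)[of x] by (auto simp: eigenbox_def)
    qed (use ab R in auto)
  qed (use N \<mu> in simp)
  also have "\<dots> = 1 / N * \<mu> + 4 * ((a + R) * (min a R / a)) * ((b + R) * (min b R / b))"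
  proof -
    have "(1 + 4 * X * Y * N) * (1 / N * (x * y)) = 1 / N * (x * y) + 4 * (X * x) * (Y * y)"
      for X Y x y :: real using N by (simp add: field_simps)
    then show ?thesis unfolding \<mu>_def .
  qed
  also have "\<dots> \<le> 1 / N * \<mu> + 4 * (2 * R) * (2 * R)"
  proof -
    have "((a + R) * (min a R / a)) * ((b + R) * (min b R / b)) \<le> (2 * R) * (2 * R)"
      using ab R by (intro mult_mono[OF mult_min_le[OF ab(1) R] mult_min_le[OF ab(2) R]]) auto
    then show ?thesis by linarith
  qed
  finally show ?thesis by (simp add: N_def \<mu>_def power2_eq_square)
qed

lemma eigenbox_subset_near_return:
  assumes C: "0 < C" "\<And>x. norm x \<le> C * (\<bar>u x\<bar> + \<bar>v x\<bar>)" and n: "1 \<le> n"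
    and p: "p \<in> periodic_lattice n"
    and ab: "0 < a" "0 < b" "\<bar>l2\<bar> ^ n * a \<le> exp (- real n * \<tau>) / (8 * C)" "b \<le> exp (- real n * \<tau>) / (8 * C)"
  shows "closure (eigenbox a b p) \<subseteq> near_return \<tau> n"
proof
  fix x assume "x \<in> closure (eigenbox a b p)"
  then have x: "\<bar>u x - u p\<bar> \<le> a" "\<bar>v x - v p\<bar> \<le> b" using closure_eigenbox by blast+
  have "norm (displacement n x - displacement n p) = norm (displacement n (x - p))" by (simp add: linear_diff[OF linear_displacement])
  also have "\<dots> \<le> C * (\<bar>u (displacement n (x - p))\<bar> + \<bar>v (displacement n (x - p))\<bar>)" by (rule C)
  also have "\<dots> = C * (\<bar>l2 ^ n - 1\<bar> * \<bar>u x - u p\<bar> + \<bar>l1 ^ n - 1\<bar> * \<bar>v x - v p\<bar>)"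
    by (simp add: u_displacement v_displacement u_diff v_diff abs_mult)
  also have "\<dots> \<le> C * (2 * \<bar>l2\<bar> ^ n * a + 2 * b)"
    using C(1) x by (intro mult_left_mono add_mono mult_mono factor_bounds n) auto
  also have "\<dots> \<le> C * (2 * (exp (- real n * \<tau>) / (8 * C)) + 2 * (exp (- real n * \<tau>) / (8 * C)))"
    using ab C(1) by (intro mult_left_mono add_mono) auto
  also have "\<dots> = exp (- real n * \<tau>) / 2" using C(1) by simp
  also have "\<dots> < exp (- real n * \<tau>)" by simp
  finally show "x \<in> near_return \<tau> n" using p by (auto simp: near_return_def periodic_lattice_def)
qed

lemma exp_neg_tendsto_0: "0 < c \<Longrightarrow> (\<lambda>n. exp (- real n * c)) \<longlonglongrightarrow> 0"
proof -
  assume "0 < c"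
  then have "(\<lambda>n. exp (- c) ^ n) \<longlonglongrightarrow> 0" by (intro LIMSEQ_power_zero) simp
  then show ?thesis by (simp add: exp_of_nat_mult[symmetric])
qed

text \<open>
  The left-hand side is the covolume of \<open>periodic_lattice n\<close>.
\<close>

lemma inverse_index_le:
  assumes "1 \<le> n"
  shows "1 / (\<bar>l2 ^ n - 1\<bar> * \<bar>l1 ^ n - 1\<bar>)
    \<le> exp (- real n * ln \<bar>l2\<bar>) / ((1 - 1 / \<bar>l2\<bar>) * (1 - \<bar>l1\<bar>))"
proof -
  have pos: "0 < 1 - 1 / \<bar>l2\<bar>" "0 < 1 - \<bar>l1\<bar>" using l1 l2 by auto
  have "(1 - 1 / \<bar>l2\<bar>) * \<bar>l2\<bar> ^ n * (1 - \<bar>l1\<bar>) \<le> \<bar>l2 ^ n - 1\<bar> * \<bar>l1 ^ n - 1\<bar>"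
    using pos by (intro mult_mono factor_bounds assms) auto
  then have "1 / (\<bar>l2 ^ n - 1\<bar> * \<bar>l1 ^ n - 1\<bar>) \<le> 1 / ((1 - 1 / \<bar>l2\<bar>) * \<bar>l2\<bar> ^ n * (1 - \<bar>l1\<bar>))"
    using pos l2 by (intro divide_left_mono mult_pos_pos factors_pos assms) auto
  also have "\<dots> = exp (- real n * ln \<bar>l2\<bar>) / ((1 - 1 / \<bar>l2\<bar>) * (1 - \<bar>l1\<bar>))"
    unfolding abs_l2_power by (simp add: exp_minus field_simps)
  finally show ?thesis .
qed

text \<open>
  The short side gets the exponent \<open>\<alpha>\<close> and the long side the exponent \<open>s - \<alpha>\<close>, by \<open>min_div_le_powr\<close>.
\<close>

lemma box_density_le:
  fixes L \<tau> s \<alpha> k R :: real and n :: nat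
  assumes k: "0 < k" and R: "0 < R" and \<alpha>: "0 \<le> \<alpha>" "\<alpha> \<le> 1" "\<alpha> \<le> s" "s \<le> 1 + \<alpha>" "\<tau> * s + L * \<alpha> = L"
  defines "a \<equiv> k * exp (- real n * (\<tau> + L))" and "b \<equiv> k * exp (- real n * \<tau>)"
  shows "exp (- real n * L) * (min a R / a * (min b R / b)) \<le> (R / k) powr s"
proof -
  have ab: "0 < a" "0 < b" using k by (auto simp: a_def b_def)
  have e: "exp (- real n * x) = 1 / exp (real n * x)" for x
    by (simp add: exp_minus inverse_eq_divide)
  have Ra: "R / a = R / k * exp (real n * (\<tau> + L))" and Rb: "R / b = R / k * exp (real n * \<tau>)"
    unfolding a_def b_def e by simp_all
  have "min a R / a * (min b R / b) \<le> (R / a) powr \<alpha> * (R / b) powr (s - \<alpha>)"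
    using \<alpha> ab R by (intro mult_mono min_div_le_powr) auto
  also have "\<dots> = ((R / k) powr \<alpha> * (R / k) powr (s - \<alpha>))
      * (exp (real n * (\<tau> + L) * \<alpha>) * exp (real n * \<tau> * (s - \<alpha>)))"
  proof -
    have pm: "(R / k * exp y) powr z = (R / k) powr z * exp (y * z)" for y z
      using R k by (subst powr_mult) (simp_all add: exp_powr_real)
    show ?thesis unfolding Ra Rb pm by (simp only: mult_ac)
  qed
  also have "(R / k) powr \<alpha> * (R / k) powr (s - \<alpha>) = (R / k) powr s"
    by (simp add: powr_add[symmetric])
  also have "exp (real n * (\<tau> + L) * \<alpha>) * exp (real n * \<tau> * (s - \<alpha>)) = exp (real n * (\<tau> * s + L * \<alpha>))"
    by (simp add: exp_add[symmetric] algebra_simps)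
  also have "\<dots> = exp (real n * L)" by (simp only: \<alpha>)
  finally have "exp (- real n * L) * (min a R / a * (min b R / b))
      \<le> exp (- real n * L) * ((R / k) powr s * exp (real n * L))"
    by (intro mult_left_mono) auto
  also have "\<dots> = (R / k) powr s" by (simp add: exp_minus)
  finally show ?thesis .
qed

text \<open>
  Only a single large \<open>n\<close> is used for each \<open>\<eta>\<close>. First the basis is chosen so that the tiles are thin in \<open>v\<close> for
  all \<open>n\<close>, then \<open>n\<close> so that they are thin in \<open>u\<close> and the boxes are small. The mass estimate
  does not depend on the basis.
\<close>

theorem ubiquitous_near_return:
  assumes \<tau>: "0 < \<tau>" and s: "s = min (2 * ln \<bar>l2\<bar> / (\<tau> + ln \<bar>l2\<bar>)) (ln \<bar>l2\<bar> / \<tau>)"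
  shows "ubiquitous s (\<Union>n\<in>{N..}. near_return \<tau> n)"
proof -
  define L where "L = ln \<bar>l2\<bar>"
  have L: "0 < L" using l2 by (simp add: L_def)
  obtain \<alpha> where \<alpha>: "0 \<le> \<alpha>" "\<alpha> \<le> 1" "\<alpha> \<le> s" "s \<le> 1 + \<alpha>" "\<tau> * s + L * \<alpha> = L" and s02: "0 < s" "s \<le> 2"
    using interpolation_exponent[OF L \<tau> s[folded L_def]] by blast
  obtain C0 where C0: "0 < C0" "\<And>x. \<bar>u x\<bar> \<le> C0 * norm x" "\<And>x. \<bar>v x\<bar> \<le> C0 * norm x"
    using uv_le_norm by blast
  obtain C1 where C1: "0 < C1" "\<And>x. norm x \<le> C1 * (\<bar>u x\<bar> + \<bar>v x\<bar>)"
    using norm_le_uv by blast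
  \<comment> \<open>small enough for \<open>eigenbox_subset_near_return\<close>\<close>
  define k where "k = 1 / (8 * C1)"
  have k: "0 < k" using C1 by (simp add: k_def)
  define a where "a n = k * exp (- real n * (\<tau> + L))" for n :: nat
  define b where "b n = k * exp (- real n * \<tau>)" for n :: nat
  have ab: "0 < a n" "0 < b n" for n using k by (auto simp: a_def b_def)
  define cN where "cN = (1 - 1 / \<bar>l2\<bar>) * (1 - \<bar>l1\<bar>)"
  have cN: "0 < cN" using l1 l2 by (simp add: cN_def)
  define C where "C = (C0 / k) powr s / cN + 16 * C0\<^sup>2"
  have C: "0 < C" using C0 k cN by (simp add: C_def add_pos_pos)
  have boxsub: "closure (eigenbox (a n) (b n) p) \<subseteq> near_return \<tau> n"
    if "1 \<le> n" "p \<in> periodic_lattice n" for n p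
  proof (rule eigenbox_subset_near_return[OF C1 that ab])
    show "\<bar>l2\<bar> ^ n * a n \<le> exp (- real n * \<tau>) / (8 * C1)"
      by (simp add: abs_l2_power a_def k_def L_def exp_add[symmetric] algebra_simps)
    show "b n \<le> exp (- real n * \<tau>) / (8 * C1)" by (simp add: b_def k_def)
  qed
  have sum: "(\<Sum>p\<in>P'. measure lborel (T p) *
       (measure lborel (eigenbox (a n) (b n) p \<inter> ball z r) / measure lborel (eigenbox (a n) (b n) p)))
      \<le> C * r powr s"
    if n: "1 \<le> n" and P': "finite P'" "P' \<subseteq> periodic_lattice n" and r: "0 < r" "r \<le> 1"
      and T: "\<And>p. measure lborel (T p) \<le> 1 / (\<bar>l2 ^ n - 1\<bar> * \<bar>l1 ^ n - 1\<bar>)" for n P' T z r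
  proof -
    define R where "R = C0 * r"
    have R: "0 < R" using C0 r by (simp add: R_def)
    have ball: "\<bar>u x - u z\<bar> < R \<and> \<bar>v x - v z\<bar> < R" if "x \<in> ball z r" for x
    proof -
      have "C0 * norm (x - z) < R"
        using that C0(1) by (simp add: R_def dist_norm norm_minus_commute)
      then show ?thesis
        using C0(2)[of "x - z"] C0(3)[of "x - z"] unfolding u_diff v_diff by linarith
    qed
    define \<mu> where "\<mu> = min (a n) R / a n * (min (b n) R / b n)"
    have \<mu>: "0 \<le> \<mu>" unfolding \<mu>_def using ab[of n] R by (intro mult_nonneg_nonneg divide_nonneg_pos) auto
    have "(\<Sum>p\<in>P'. measure lborel (T p) *
       (measure lborel (eigenbox (a n) (b n) p \<inter> ball z r) / measure lborel (eigenbox (a n) (b n) p)))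
      \<le> 1 / (\<bar>l2 ^ n - 1\<bar> * \<bar>l1 ^ n - 1\<bar>) * \<mu> + 16 * R\<^sup>2"
      unfolding \<mu>_def by (rule eigenbox_sum_le[OF n ab P' _ T R ball]) auto
    also have "1 / (\<bar>l2 ^ n - 1\<bar> * \<bar>l1 ^ n - 1\<bar>) * \<mu> \<le> exp (- real n * L) / cN * \<mu>"
      unfolding L_def cN_def by (intro mult_right_mono inverse_index_le n \<mu>)
    also have "\<dots> = (exp (- real n * L) * \<mu>) / cN" by simp
    also have "\<dots> \<le> (R / k) powr s / cN"
      unfolding \<mu>_def a_def b_def using cN by (intro divide_right_mono box_density_le[OF k R \<alpha>]) simp
    also have "(R / k) powr s = (C0 / k) powr s * r powr s"
      using C0 k r by (simp add: R_def powr_mult[symmetric])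
    also have "R\<^sup>2 \<le> C0\<^sup>2 * r powr s"
    proof -
      have "r powr 2 \<le> r powr s" using r s02 by (intro powr_mono') auto
      then have "r\<^sup>2 \<le> r powr s" using r by simp
      then show ?thesis unfolding R_def power_mult_distrib by (intro mult_left_mono) auto
    qed
    finally show ?thesis by (simp add: C_def algebra_simps)
  qed
  show ?thesis
    unfolding ubiquitous_def
  proof (rule exI[of _ C], rule conjI[OF C], rule exI[of _ 1], rule conjI[OF zero_less_one], intro allI impI)
    fix \<eta> :: real assume \<eta>: "0 < \<eta>"
    \<comment> \<open>the tiles contribute \<open>\<eta> / 4\<close> in the direction of \<open>v\<close>; all other contributions are below \<open>\<eta> / 2\<close>\<close>
    define \<epsilon> where "\<epsilon> = \<eta> * (1 - \<bar>l1\<bar>) / (8 * C1)"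
    have \<epsilon>: "0 < \<epsilon>" using \<eta> l1 C1 by (simp add: \<epsilon>_def)
    obtain p q r t :: int where det: "p * t - q * r = 1"
      and vw: "\<bar>v (vector [of_int p, of_int q])\<bar> < \<epsilon>" "\<bar>v (vector [of_int r, of_int t])\<bar> < \<epsilon>"
      using contracted_lattice_basis[OF \<epsilon>] by metis
    define W where "W = \<bar>u (vector [of_int p, of_int q])\<bar> + \<bar>u (vector [of_int r, of_int t])\<bar>"
    define f where "f n = C1 * (W / (1 - 1 / \<bar>l2\<bar>) * exp (- real n * L) + a n + b n)" for n
    have "f \<longlonglongrightarrow> C1 * (W / (1 - 1 / \<bar>l2\<bar>) * 0 + k * 0 + k * 0)"
      unfolding f_def[abs_def] a_def b_def using L \<tau>
      by (intro tendsto_intros exp_neg_tendsto_0) auto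
    then have "f \<longlonglongrightarrow> 0" by simp
    then have "eventually (\<lambda>n. f n < \<eta> / 2) sequentially" using \<eta> by (intro order_tendstoD(2)) auto
    then have "eventually (\<lambda>n. f n < \<eta> / 2 \<and> n \<ge> max 1 N) sequentially"
      by (intro eventually_conj eventually_ge_at_top)
    then obtain n where n: "f n < \<eta> / 2" "1 \<le> n" "N \<le> n"
      unfolding eventually_sequentially by auto
    obtain T where T: "disjoint_family_on T (periodic_lattice n)"
      "(\<Union>x\<in>periodic_lattice n. T x) = UNIV"
      "\<And>x. T x \<in> sets borel"
      "\<And>x. measure lborel (T x) \<le> 1 / (\<bar>l2 ^ n - 1\<bar> * \<bar>l1 ^ n - 1\<bar>)"
      "\<And>x y. y \<in> T x \<Longrightarrow> \<bar>u y - u x\<bar> \<le>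
         (\<bar>u (vector [of_int p, of_int q])\<bar> + \<bar>u (vector [of_int r, of_int t])\<bar>) / \<bar>l2 ^ n - 1\<bar>"
      "\<And>x y. y \<in> T x \<Longrightarrow> \<bar>v y - v x\<bar> \<le>
         (\<bar>v (vector [of_int p, of_int q])\<bar> + \<bar>v (vector [of_int r, of_int t])\<bar>) / \<bar>l1 ^ n - 1\<bar>"
      by (rule periodic_tiling[OF n(2) det]) (rule that)
    have close: "dist x y \<le> \<eta>" if x: "x \<in> T c" and y: "y \<in> eigenbox (a n) (b n) c" for x y c
    proof -
      have "\<bar>u x - u c\<bar> \<le> W / \<bar>l2 ^ n - 1\<bar>" by (rule T(5)[OF x, folded W_def])
      also have "\<dots> \<le> W / ((1 - 1 / \<bar>l2\<bar>) * \<bar>l2\<bar> ^ n)"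
        using l2 factors_pos[OF n(2)] factor_bounds(1)[OF n(2)]
        by (intro divide_left_mono mult_pos_pos) (auto simp: W_def)
      also have "\<dots> = W / (1 - 1 / \<bar>l2\<bar>) * exp (- real n * L)"
        unfolding abs_l2_power L_def by (simp add: exp_minus divide_inverse)
      finally have ux: "\<bar>u x - u c\<bar> \<le> W / (1 - 1 / \<bar>l2\<bar>) * exp (- real n * L)" .
      have "\<bar>v x - v c\<bar> \<le> (\<bar>v (vector [of_int p, of_int q])\<bar> + \<bar>v (vector [of_int r, of_int t])\<bar>) / \<bar>l1 ^ n - 1\<bar>"
        by (rule T(6)[OF x])
      also have "\<dots> \<le> (2 * \<epsilon>) / (1 - \<bar>l1\<bar>)"
        using vw l1 \<epsilon> factor_bounds(3)[OF n(2)] by (intro frac_le) auto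
      also have "\<dots> = \<eta> / 4 / C1"
      proof -
        have "2 * (\<eta> * d / (8 * C1)) / d = \<eta> / 4 / C1" if "d \<noteq> 0" for d :: real
          using that by (simp add: field_simps)
        then show ?thesis unfolding \<epsilon>_def using l1 by simp
      qed
      finally have vx: "\<bar>v x - v c\<bar> \<le> \<eta> / 4 / C1" .
      have uvy: "\<bar>u y - u c\<bar> < a n" "\<bar>v y - v c\<bar> < b n" using y by (auto simp: eigenbox_def)
      have "dist x y \<le> C1 * (\<bar>u x - u y\<bar> + \<bar>v x - v y\<bar>)"
        using C1(2)[of "x - y"] by (simp add: dist_norm u_diff v_diff)
      also have "\<dots> \<le> C1 * ((W / (1 - 1 / \<bar>l2\<bar>) * exp (- real n * L) + a n + b n) + \<eta> / 4 / C1)"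
        using ux vx uvy C1(1) by (intro mult_left_mono) linarith+
      also have "\<dots> = f n + \<eta> / 4" using C1(1) by (simp add: f_def distrib_left)
      also have "\<dots> \<le> \<eta>" using n(1) \<eta> by linarith
      finally show ?thesis .
    qed
    show "\<exists>(P::(real ^ 2) set) T Q. countable P \<and> disjoint_family_on T P \<and> (\<Union>p\<in>P. T p) = UNIV \<and>
     (\<forall>p\<in>P. T p \<in> sets borel \<and> open (Q p) \<and> Q p \<noteq> {} \<and>
            closure (Q p) \<subseteq> (\<Union>n\<in>{N..}. near_return \<tau> n) \<and>
            (\<forall>x\<in>T p. \<forall>y\<in>Q p. dist x y \<le> \<eta>)) \<and>
     (\<forall>z r P'. 0 < r \<longrightarrow> r \<le> 1 \<longrightarrow> finite P' \<longrightarrow> P' \<subseteq> P \<longrightarrow>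
        (\<Sum>p\<in>P'. measure lborel (T p) *
           (measure lborel (Q p \<inter> ball z r) / measure lborel (Q p))) \<le> C * r powr s)"
    proof (rule exI[of _ "periodic_lattice n"], rule exI[of _ T], rule exI[of _ "eigenbox (a n) (b n)"],
        intro conjI ballI allI impI)
      fix c assume c: "c \<in> periodic_lattice n"
      have "c \<in> eigenbox (a n) (b n) c" using ab by (simp add: eigenbox_def)
      then show "eigenbox (a n) (b n) c \<noteq> {}" by blast
      show "closure (eigenbox (a n) (b n) c) \<subseteq> (\<Union>n\<in>{N..}. near_return \<tau> n)"
        using boxsub[OF n(2) c] n(3) by blast
      show "T c \<in> sets borel" by (rule T)
      show "open (eigenbox (a n) (b n) c)" by (rule open_eigenbox)
      show "dist x y \<le> \<eta>" if "x \<in> T c" "y \<in> eigenbox (a n) (b n) c" for x y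
        using that by (rule close)
    next
      show "countable (periodic_lattice n)" by (rule countable_periodic_lattice[OF n(2)])
      show "disjoint_family_on T (periodic_lattice n)" "(\<Union>p\<in>periodic_lattice n. T p) = UNIV" by (rule T)+
      fix z r P' assume "0 < r" "r \<le> (1::real)" "finite P'" "P' \<subseteq> periodic_lattice n"
      then show "(\<Sum>p\<in>P'. measure lborel (T p) *
           (measure lborel (eigenbox (a n) (b n) p \<inter> ball z r) / measure lborel (eigenbox (a n) (b n) p)))
          \<le> C * r powr s"
        by (intro sum n(2) T(4))
    qed
  qed
qed

end

section \<open>Recurrence on the torus\<close>

lemma dist_to_torus_less_iff:
  fixes x y :: "real ^ 2"
  shows "dist (to_torus x) (to_torus y) < r \<longleftrightarrow> (\<exists>m\<in>lattice. norm (x - y - m) < r)"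
proof
  assume "dist (to_torus x) (to_torus y) < r"
  then have "0 < r - torus_dist (to_torus x) (to_torus y)" by (simp add: dist_torus_def)
  from torus_dist_approx[OF this, of "to_torus y" x] obtain y' where y': "to_torus y' = to_torus y" "dist x y' < r"
    by auto
  have "y' - y \<in> lattice" using y'(1) by (simp add: to_torus_eq_iff lattice_def)
  moreover have "norm (x - y - (y' - y)) < r" using y'(2) by (simp add: dist_norm)
  ultimately show "\<exists>m\<in>lattice. norm (x - y - m) < r" by blast
next
  assume "\<exists>m\<in>lattice. norm (x - y - m) < r"
  then obtain m where m: "m \<in> lattice" "norm (x - y - m) < r" by blast
  have "to_torus (y + m) = to_torus y" using m(1) by (simp add: to_torus_eq_iff lattice_def)
  then have "dist (to_torus x) (to_torus y) \<le> dist x (y + m)"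
    unfolding dist_torus_def using torus_dist_le[of x "y + m"] by simp
  also have "\<dots> < r" using m(2) by (simp add: dist_norm algebra_simps)
  finally show "dist (to_torus x) (to_torus y) < r" .
qed

text \<open>
  Two lifts of a point differ by an integer vector, and a nonzero one is too long to shorten the distance.
\<close>

lemma dist_le_dist_to_torus:
  fixes x y :: "real ^ 2"
  assumes "x \<in> ball 0 (1 / 8)" "y \<in> ball 0 (1 / 8)"
  shows "dist x y \<le> dist (to_torus x) (to_torus y)"
proof (rule ccontr)
  assume "\<not> dist x y \<le> dist (to_torus x) (to_torus y)"
  then obtain m where m: "m \<in> lattice" "norm (x - y - m) < dist x y"
    using dist_to_torus_less_iff[of x y "dist x y"] by auto
  have xy: "norm (x - y) < 1 / 4"
    using assms norm_triangle_ineq4[of x y] by simp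
  have "norm m \<le> norm (x - y) + norm (x - y - m)"
    using norm_triangle_ineq4[of "x - y" "x - y - m"] by simp
  then have "norm m < 1" using m(2) xy by (simp add: dist_norm)
  then have "\<bar>m $ i\<bar> < 1" for i using component_le_norm_cart[of m i] by linarith
  then have "m $ i = 0" for i
    using m(1) Ints_nonzero_abs_less1[of "m $ i"] unfolding lattice_def by blast
  then have "m = 0" by (simp add: vec_eq_iff)
  then show False using m(2) by (simp add: dist_norm)
qed

lemma hausdorff_measure_finite_families_eq_0:
  fixes piece :: "nat \<Rightarrow> 'i \<Rightarrow> 'a::metric_space set"
  assumes "0 < s" and I: "\<And>n. finite (I n)"
    and piece: "\<And>n i. bounded (piece n i)" "\<And>n i. diameter (piece n i) \<le> d n"
    and d: "d \<longlonglongrightarrow> 0"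
    and sum: "summable (\<lambda>n. real (card (I n)) * d n powr s)"
    and S: "\<And>x. x \<in> S \<Longrightarrow> \<exists>\<^sub>\<infinity>n. \<exists>i\<in>I n. x \<in> piece n i"
  shows "hausdorff_measure s S = 0"
proof -
  have "\<exists>e. bij_betw e {..<card (I n)} (I n)" for n
    using ex_bij_betw_nat_finite[OF I[of n]] by (simp add: atLeast0LessThan)
  then obtain e where e: "\<And>n. bij_betw (e n) {..<card (I n)} (I n)" by metis
  show ?thesis
  proof (rule hausdorff_measure_limsup_eq_0[OF assms(1) piece d sum])
    fix x assume "x \<in> S"
    from S[OF this] show "\<exists>\<^sub>\<infinity>n. \<exists>i<card (I n). x \<in> piece n (e n i)"
    proof (rule INFM_mono)
      fix n assume "\<exists>i\<in>I n. x \<in> piece n i"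
      then show "\<exists>i<card (I n). x \<in> piece n (e n i)"
        using e[of n] unfolding bij_betw_def by (metis image_iff lessThan_iff)
    qed
  qed
qed

context hyperbolic_matrix
begin

lemma torus_map_iterate: "(torus_map A ^^ n) (to_torus x) = to_torus (iterate n x)"
  by (induction n) (simp_all add: iterate_def torus_map.abs_eq)

lemma recurrent_set_iff:
  "to_torus x \<in> recurrent_set A \<tau> \<longleftrightarrow> (\<exists>\<^sub>\<infinity>n. x \<in> near_return \<tau> n)"
proof -
  have "(torus_map A ^^ n) (to_torus x) \<in> ball (to_torus x) (exp (- real n * \<tau>)) \<longleftrightarrow> x \<in> near_return \<tau> n" for n
    unfolding torus_map_iterate mem_ball dist_commute[of "to_torus x"] dist_to_torus_less_iff
    by (simp add: near_return_def displacement_def)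
  then show ?thesis by (simp add: recurrent_set_def)
qed

lemma recurrent_set_vimage:
  "to_torus -` recurrent_set A \<tau> = (\<Inter>N. \<Union>n\<in>{N..}. near_return \<tau> n)"
  by (auto simp: recurrent_set_iff INFM_nat_le Bex_def)

lemma open_near_return: "open (near_return \<tau> n)"
proof -
  have "continuous_on UNIV (displacement n)"
    using linear_continuous_on[OF linear_displacement[unfolded linear_conv_bounded_linear]] .
  then have "open {x. norm (displacement n x - m) < exp (- real n * \<tau>)}" for m
    by (intro open_Collect_less continuous_intros)
  moreover have "near_return \<tau> n = (\<Union>m\<in>lattice. {x. norm (displacement n x - m) < exp (- real n * \<tau>)})"
    by (auto simp: near_return_def)
  ultimately show ?thesis by auto
qed

lemma summable_exp_powr:
  assumes "0 < \<tau>" "0 \<le> \<theta>" "(L + \<theta>) / (\<tau> + \<theta>) < s" "0 \<le> c1" "0 \<le> c2"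
    and k: "\<And>n. real (k n) \<le> c1 * exp (real n * (L + \<theta>))"
  shows "summable (\<lambda>n. real (k n) * (c2 * exp (- real n * (\<tau> + \<theta>))) powr s)"
proof (rule summable_comparison_test')
  define q where "q = exp (L + \<theta> - (\<tau> + \<theta>) * s)"
  have "L + \<theta> < s * (\<tau> + \<theta>)" using assms by (simp add: pos_divide_less_eq)
  then have "norm q < 1" by (simp add: q_def mult.commute)
  then show "summable (\<lambda>n. c1 * c2 powr s * q ^ n)" by (intro summable_mult summable_geometric)
  fix n
  have "real (k n) * (c2 * exp (- real n * (\<tau> + \<theta>))) powr s
      = real (k n) * (c2 powr s * exp (- real n * (\<tau> + \<theta>) * s))"
    using assms(5) by (subst powr_mult) (simp_all add: exp_powr_real)
  also have "\<dots> \<le> (c1 * exp (real n * (L + \<theta>))) * (c2 powr s * exp (- real n * (\<tau> + \<theta>) * s))"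
    by (intro mult_right_mono k) auto
  also have "\<dots> = c1 * c2 powr s * (exp (real n * (L + \<theta>)) * exp (- real n * (\<tau> + \<theta>) * s))" by simp
  also have "exp (real n * (L + \<theta>)) * exp (- real n * (\<tau> + \<theta>) * s) = q ^ n"
    by (simp add: q_def exp_add[symmetric] exp_of_nat_mult[symmetric] algebra_simps)
  finally show "norm (real (k n) * (c2 * exp (- real n * (\<tau> + \<theta>))) powr s) \<le> c1 * c2 powr s * q ^ n"
    by simp
qed

text \<open>
  The box around \<open>fst i\<close> is cut in the direction of \<open>v\<close> into pieces of width \<open>\<delta>\<close>, numbered by \<open>snd i\<close>.
\<close>

definition slice :: "real \<Rightarrow> real \<Rightarrow> real \<Rightarrow> (real ^ 2) \<times> nat \<Rightarrow> (real ^ 2) set" where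
  "slice a b \<delta> i = {x. \<bar>u x - u (fst i)\<bar> \<le> a \<and>
      v (fst i) - b + real (snd i) * \<delta> \<le> v x \<and> v x \<le> v (fst i) - b + (real (snd i) + 1) * \<delta>}"

lemma slice_dist:
  assumes C: "0 < C" "\<And>x. norm x \<le> C * (\<bar>u x\<bar> + \<bar>v x\<bar>)" and xy: "x \<in> slice a b \<delta> i" "y \<in> slice a b \<delta> i"
  shows "dist x y \<le> C * (2 * a + \<delta>)"
proof -
  have "\<bar>u x - u y\<bar> \<le> 2 * a" "\<bar>v x - v y\<bar> \<le> \<delta>"
    using xy unfolding slice_def mem_Collect_eq distrib_right by linarith+
  then have "C * (\<bar>u x - u y\<bar> + \<bar>v x - v y\<bar>) \<le> C * (2 * a + \<delta>)"
    using C(1) by (intro mult_left_mono add_mono) auto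
  then show ?thesis using C(2)[of "x - y"] by (simp add: dist_norm u_diff v_diff)
qed

lemma slices_cover:
  assumes "\<bar>u x - u p\<bar> \<le> a" "\<bar>v x - v p\<bar> \<le> b" "0 < \<delta>"
  shows "\<exists>j<nat \<lceil>2 * b / \<delta>\<rceil> + 1. x \<in> slice a b \<delta> (p, j)"
proof (intro exI conjI)
  define t where "t = (v x - v p + b) / \<delta>"
  have t: "0 \<le> t" "t \<le> 2 * b / \<delta>"
    using assms unfolding t_def by (auto intro!: divide_right_mono divide_nonneg_pos)
  have vx: "v x = v p - b + t * \<delta>" using assms(3) by (simp add: t_def)
  have j: "real (nat \<lfloor>t\<rfloor>) \<le> t" "t \<le> real (nat \<lfloor>t\<rfloor>) + 1" using t(1) by (auto simp: less_imp_le)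
  show "nat \<lfloor>t\<rfloor> < nat \<lceil>2 * b / \<delta>\<rceil> + 1" using t by linarith
  show "x \<in> slice a b \<delta> (p, nat \<lfloor>t\<rfloor>)"
    using assms(1) mult_right_mono[OF j(1), of \<delta>] mult_right_mono[OF j(2), of \<delta>] assms(3)
    by (simp add: slice_def vx del: of_nat_nat)
qed

lemma near_return_near_periodic:
  assumes C0: "0 < C0" "\<And>x. \<bar>u x\<bar> \<le> C0 * norm x" "\<And>x. \<bar>v x\<bar> \<le> C0 * norm x"
    and n: "1 \<le> n" and x: "x \<in> near_return \<tau> n"
  obtains p where "p \<in> periodic_lattice n"
    "\<bar>u x - u p\<bar> \<le> C0 / (1 - 1 / \<bar>l2\<bar>) * exp (- real n * (\<tau> + ln \<bar>l2\<bar>))"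
    "\<bar>v x - v p\<bar> \<le> C0 / (1 - \<bar>l1\<bar>) * exp (- real n * \<tau>)"
proof -
  obtain m where m: "m \<in> lattice" "norm (displacement n x - m) < exp (- real n * \<tau>)"
    using x by (auto simp: near_return_def)
  obtain p where p: "displacement n p = m" using surj_displacement[OF n] unfolding surj_def by metis
  have w: "displacement n (x - p) = displacement n x - m" using p by (simp add: linear_diff[OF linear_displacement])
  have small: "C0 * norm (displacement n x - m) \<le> C0 * exp (- real n * \<tau>)"
    using m(2) C0(1) by (intro mult_left_mono) auto
  have pos: "0 < 1 - 1 / \<bar>l2\<bar>" "0 < 1 - \<bar>l1\<bar>" using l1 l2 by auto
  have "(1 - 1 / \<bar>l2\<bar>) * \<bar>l2\<bar> ^ n * \<bar>u x - u p\<bar> \<le> \<bar>l2 ^ n - 1\<bar> * \<bar>u x - u p\<bar>"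
    by (intro mult_right_mono factor_bounds n) auto
  also have "\<dots> = \<bar>u (displacement n (x - p))\<bar>" by (simp add: u_displacement u_diff abs_mult)
  also have "\<dots> \<le> C0 * exp (- real n * \<tau>)" unfolding w using C0(2) small by (rule order_trans)
  finally have "\<bar>u x - u p\<bar> \<le> C0 * exp (- real n * \<tau>) / ((1 - 1 / \<bar>l2\<bar>) * \<bar>l2\<bar> ^ n)"
    using pos l2 by (subst pos_le_divide_eq) (auto simp: mult.commute)
  also have "\<dots> = C0 / (1 - 1 / \<bar>l2\<bar>) * exp (- real n * (\<tau> + ln \<bar>l2\<bar>))"
  proof -
    have "exp (- real n * (\<tau> + ln \<bar>l2\<bar>)) = exp (- real n * \<tau>) / exp (real n * ln \<bar>l2\<bar>)"
      by (simp add: exp_diff[symmetric] algebra_simps)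
    then show ?thesis by (simp add: abs_l2_power)
  qed
  finally have u: "\<bar>u x - u p\<bar> \<le> C0 / (1 - 1 / \<bar>l2\<bar>) * exp (- real n * (\<tau> + ln \<bar>l2\<bar>))" .
  have "(1 - \<bar>l1\<bar>) * \<bar>v x - v p\<bar> \<le> \<bar>l1 ^ n - 1\<bar> * \<bar>v x - v p\<bar>"
    by (intro mult_right_mono factor_bounds n) auto
  also have "\<dots> = \<bar>v (displacement n (x - p))\<bar>" by (simp add: v_displacement v_diff abs_mult)
  also have "\<dots> \<le> C0 * exp (- real n * \<tau>)" unfolding w using C0(3) small by (rule order_trans)
  finally have "\<bar>v x - v p\<bar> \<le> C0 * exp (- real n * \<tau>) / (1 - \<bar>l1\<bar>)"
    using pos by (subst pos_le_divide_eq) (auto simp: mult.commute)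
  then have v: "\<bar>v x - v p\<bar> \<le> C0 / (1 - \<bar>l1\<bar>) * exp (- real n * \<tau>)" by simp
  show thesis using that[OF _ u v] p m(1) by (simp add: periodic_lattice_def)
qed

lemma card_periodic_lattice_bounded:
  assumes n: "1 \<le> n" and "0 < U" "0 < V"
  defines "S \<equiv> {p \<in> periodic_lattice n. \<bar>u p\<bar> \<le> U \<and> \<bar>v p\<bar> \<le> V}"
  shows "finite S \<and> real (card S) \<le> (1 + 16 * U * V) * exp (real n * ln \<bar>l2\<bar>)"
proof -
  have one: "1 \<le> exp (real n * ln \<bar>l2\<bar>)" using l2 by simp
  have fin: "real (card G) \<le> (1 + 16 * U * V) * exp (real n * ln \<bar>l2\<bar>)" if G: "G \<subseteq> S" "finite G" for G
  proof -
    have "real (card G) \<le> 1 + 4 * U * V * (\<bar>l2 ^ n - 1\<bar> * \<bar>l1 ^ n - 1\<bar>)"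
      using G assms by (intro card_periodic_lattice_box[OF n, where u\<^sub>0 = 0 and v\<^sub>0 = 0]) (auto simp: S_def)
    also have "\<dots> \<le> 1 + 4 * U * V * ((2 * \<bar>l2\<bar> ^ n) * 2)"
      using assms by (intro add_left_mono mult_left_mono mult_mono factor_bounds n) auto
    also have "\<dots> = 1 + 16 * U * V * exp (real n * ln \<bar>l2\<bar>)" by (simp add: abs_l2_power)
    also have "\<dots> \<le> (1 + 16 * U * V) * exp (real n * ln \<bar>l2\<bar>)" using one by (simp add: algebra_simps)
    finally show ?thesis .
  qed
  have "finite S \<and> card S \<le> nat \<lfloor>(1 + 16 * U * V) * exp (real n * ln \<bar>l2\<bar>)\<rfloor>"
    by (rule finite_if_finite_subsets_card_bdd) (use fin in \<open>simp add: le_nat_floor\<close>)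
  then show ?thesis using fin by blast
qed

text \<open>
  The parameter \<open>\<theta>\<close> sets the width \<open>exp (- n * (\<tau> + \<theta>))\<close> of the slices: for \<open>\<theta> = 0\<close> a bounded number of slices
  covers a box, for \<open>\<theta> = ln \<bar>l2\<bar>\<close> the slices are about as wide as the short side. In general about
  \<open>exp (n * (ln \<bar>l2\<bar> + \<theta>))\<close> slices are needed in total.
\<close>

lemma hausdorff_measure_recurrent_set_eq_0:
  assumes \<tau>: "0 < \<tau>" and \<theta>: "0 \<le> \<theta>" "\<theta> \<le> ln \<bar>l2\<bar>"
    and s: "(ln \<bar>l2\<bar> + \<theta>) / (\<tau> + \<theta>) < s"
  shows "hausdorff_measure s (recurrent_set A \<tau>) = 0"
proof -
  define L where "L = ln \<bar>l2\<bar>"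
  have L: "0 < L" using l2 by (simp add: L_def)
  obtain C0 where C0: "0 < C0" "\<And>x. \<bar>u x\<bar> \<le> C0 * norm x" "\<And>x. \<bar>v x\<bar> \<le> C0 * norm x"
    using uv_le_norm by blast
  obtain C1 where C1: "0 < C1" "\<And>x. norm x \<le> C1 * (\<bar>u x\<bar> + \<bar>v x\<bar>)"
    using norm_le_uv by blast
  define C2 where "C2 = C0 / (1 - 1 / \<bar>l2\<bar>)"
  define C3 where "C3 = C0 / (1 - \<bar>l1\<bar>)"
  have C23: "0 < C2" "0 < C3" using C0 l1 l2 by (auto simp: C2_def C3_def)
  define a where "a n = C2 * exp (- real n * (\<tau> + L))" for n :: nat
  define b where "b n = C3 * exp (- real n * \<tau>)" for n :: nat
  define \<delta> where "\<delta> n = exp (- real n * (\<tau> + \<theta>))" for n :: nat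
  have ab: "0 < a n" "0 < b n" "0 < \<delta> n" "a n \<le> C2" "b n \<le> C3" "a n \<le> C2 * \<delta> n" for n
  proof -
    show "0 < a n" "0 < b n" "0 < \<delta> n" using C23 by (auto simp: a_def b_def \<delta>_def)
    show "a n \<le> C2" "b n \<le> C3" using C23 \<tau> L by (auto simp: a_def b_def mult_le_cancel_left1)
    have "real n * \<theta> \<le> real n * L" using \<theta> by (intro mult_left_mono) (auto simp: L_def)
    then show "a n \<le> C2 * \<delta> n" using C23 by (simp add: a_def \<delta>_def algebra_simps)
  qed
  define U where "U = 2 * C0 + C2"
  define V where "V = 2 * C0 + C3"
  have UV: "0 < U" "0 < V" using C0 C23 by (auto simp: U_def V_def)
  \<comment> \<open>at time 0 the displacement vanishes and all points are periodic, so this time is left out\<close>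
  define I where "I n = (if n = 0 then {} else
     {p \<in> periodic_lattice n. \<bar>u p\<bar> \<le> U \<and> \<bar>v p\<bar> \<le> V} \<times> {..<nat \<lceil>2 * b n / \<delta> n\<rceil> + 1})" for n :: nat
  define piece where "piece n i = to_torus ` slice (a n) (b n) (\<delta> n) i" for n i
  define d where "d n = C1 * (2 * C2 + 1) * \<delta> n" for n
  have pd: "dist X Y \<le> d n" if XY: "X \<in> piece n i" "Y \<in> piece n i" for X Y n i
  proof -
    obtain x y where xy: "x \<in> slice (a n) (b n) (\<delta> n) i" "y \<in> slice (a n) (b n) (\<delta> n) i"
      "X = to_torus x" "Y = to_torus y" using XY unfolding piece_def by blast
    have "dist X Y \<le> dist x y" unfolding xy dist_torus_def by (rule torus_dist_le)
    also have "\<dots> \<le> C1 * (2 * a n + \<delta> n)" by (rule slice_dist[OF C1 xy(1,2)])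
    also have "\<dots> \<le> C1 * (2 * (C2 * \<delta> n) + \<delta> n)" using ab(6)[of n] C1 by (intro mult_left_mono) auto
    also have "\<dots> = d n" by (simp add: d_def algebra_simps)
    finally show ?thesis .
  qed
  have d0: "0 \<le> d n" for n using C1 C23 ab(3)[of n] by (simp add: d_def)
  show ?thesis
  proof (rule hausdorff_measure_finite_families_eq_0)
    have "0 \<le> (L + \<theta>) / (\<tau> + \<theta>)" using L \<theta> \<tau> by simp
    then show "0 < s" using s by (simp add: L_def)
    show "finite (I n)" for n
      using card_periodic_lattice_bounded[of n U V] UV by (cases "n = 0") (auto simp: I_def)
    show "bounded (piece n i)" for n i by (rule bounded_of_dist_le[OF pd d0])
    show "diameter (piece n i) \<le> d n" for n i by (rule diameter_le_of_dist_le[OF pd d0])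
    have "(\<lambda>n. C1 * (2 * C2 + 1) * \<delta> n) \<longlonglongrightarrow> C1 * (2 * C2 + 1) * 0"
      unfolding \<delta>_def using \<tau> \<theta> by (intro tendsto_intros exp_neg_tendsto_0) auto
    then show "d \<longlonglongrightarrow> 0" by (simp add: d_def[abs_def])
    have card: "real (card (I n)) \<le> (1 + 16 * U * V) * (2 * C3 + 2) * exp (real n * (L + \<theta>))" for n
    proof (cases "n = 0")
      case True
      then show ?thesis using UV C23 by (simp add: I_def)
    next
      case False
      define M where "M = nat \<lceil>2 * b n / \<delta> n\<rceil> + 1"
      have "exp (- real n * \<tau>) / exp (- real n * (\<tau> + \<theta>)) = exp (real n * \<theta>)"
        by (simp add: exp_diff[symmetric] algebra_simps)
      then have "b n / \<delta> n = C3 * exp (real n * \<theta>)"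
        unfolding b_def \<delta>_def times_divide_eq_right[symmetric] by (rule arg_cong)
      moreover have "real M \<le> 2 * (b n / \<delta> n) + 2"
        using ab[of n] divide_nonneg_pos[of "2 * b n" "\<delta> n"] by (simp add: M_def) linarith
      moreover have "1 \<le> exp (real n * \<theta>)" using \<theta> by simp
      ultimately have M: "real M \<le> (2 * C3 + 2) * exp (real n * \<theta>)" unfolding distrib_right by linarith
      have "real (card (I n)) = real (card {p \<in> periodic_lattice n. \<bar>u p\<bar> \<le> U \<and> \<bar>v p\<bar> \<le> V}) * real M"
        using False by (simp add: I_def M_def[symmetric] card_cartesian_product del: One_nat_def add_Suc_right)
      also have "\<dots> \<le> ((1 + 16 * U * V) * exp (real n * L)) * ((2 * C3 + 2) * exp (real n * \<theta>))"
        using card_periodic_lattice_bounded[of n U V] False UV M C23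
        by (intro mult_mono) (auto simp: L_def)
      also have "\<dots> = (1 + 16 * U * V) * (2 * C3 + 2) * (exp (real n * L) * exp (real n * \<theta>))" by simp
      also have "exp (real n * L) * exp (real n * \<theta>) = exp (real n * (L + \<theta>))"
        by (simp add: exp_add[symmetric] algebra_simps)
      finally show ?thesis .
    qed
    show "summable (\<lambda>n. real (card (I n)) * d n powr s)"
      unfolding d_def \<delta>_def
      by (rule summable_exp_powr[OF \<tau> \<theta>(1) s[folded L_def] _ _ card]) (use UV C23 C1 in simp_all)
    fix X assume X: "X \<in> recurrent_set A \<tau>"
    obtain x where x: "x \<in> unit_cell" "X = to_torus x"
      using bij_betw_to_torus[where 'd = 2] unfolding bij_betw_def by (metis UNIV_I imageE)
    have "norm x \<le> \<bar>x $ 1\<bar> + \<bar>x $ 2\<bar>" using norm_le_l1_cart[of x] by (simp add: sum_2)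
    then have nx: "norm x \<le> 2" using x(1) by (auto simp: unit_cell_def forall_2)
    have "\<exists>\<^sub>\<infinity>n. x \<in> near_return \<tau> n" using X x(2) recurrent_set_iff by simp
    then have "\<exists>\<^sub>\<infinity>n. x \<in> near_return \<tau> n \<and> 1 \<le> n"
      unfolding INFM_nat_le by (metis le_trans max.cobounded1 max.cobounded2)
    then show "\<exists>\<^sub>\<infinity>n. \<exists>i\<in>I n. X \<in> piece n i"
    proof (rule INFM_mono)
      fix n assume n: "x \<in> near_return \<tau> n \<and> 1 \<le> n"
      obtain p where p: "p \<in> periodic_lattice n" "\<bar>u x - u p\<bar> \<le> a n" "\<bar>v x - v p\<bar> \<le> b n"
        using near_return_near_periodic[OF C0, of n x \<tau>] n unfolding a_def b_def C2_def C3_def L_def by blast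
      obtain j where j: "j < nat \<lceil>2 * b n / \<delta> n\<rceil> + 1" "x \<in> slice (a n) (b n) (\<delta> n) (p, j)"
        using slices_cover[OF p(2,3) ab(3)] by blast
      have "C0 * norm x \<le> C0 * 2" using nx C0(1) by (intro mult_left_mono) auto
      then have "\<bar>u x\<bar> \<le> 2 * C0" "\<bar>v x\<bar> \<le> 2 * C0"
        using C0(2)[of x] C0(3)[of x] by linarith+
      then have "\<bar>u p\<bar> \<le> U" "\<bar>v p\<bar> \<le> V"
        using p(2,3) ab(4,5)[of n] unfolding U_def V_def by linarith+
      then have "(p, j) \<in> I n" using p(1) j(1) n by (simp add: I_def)
      moreover have "X \<in> piece n (p, j)" using j(2) x(2) by (simp add: piece_def)
      ultimately show "\<exists>i\<in>I n. X \<in> piece n i" by blast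
    qed
  qed
qed

theorem hausdorff_dim_recurrent_set_le:
  assumes \<tau>: "0 < \<tau>" and s: "s = min (2 * ln \<bar>l2\<bar> / (\<tau> + ln \<bar>l2\<bar>)) (ln \<bar>l2\<bar> / \<tau>)"
  shows "hausdorff_dim (recurrent_set A \<tau>) \<le> ereal s"
proof (rule hausdorff_dim_leI)
  have L: "0 < ln \<bar>l2\<bar>" using l2 by simp
  then show "0 \<le> s" unfolding s using \<tau> by simp
  fix t assume "s < t"
  then consider "(ln \<bar>l2\<bar> + ln \<bar>l2\<bar>) / (\<tau> + ln \<bar>l2\<bar>) < t" | "(ln \<bar>l2\<bar> + 0) / (\<tau> + 0) < t"
    unfolding s by fastforce
  then show "hausdorff_measure t (recurrent_set A \<tau>) = 0"
  proof cases
    case 1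
    then show ?thesis using L by (intro hausdorff_measure_recurrent_set_eq_0[OF \<tau> _ order_refl]) auto
  next
    case 2
    then show ?thesis using L by (intro hausdorff_measure_recurrent_set_eq_0[OF \<tau> order_refl]) auto
  qed
qed

text \<open>
  Each \<open>f i\<close> is injective, so it commutes with the intersection over \<open>N\<close>; the pairs \<open>(i, N)\<close> enumerate
  countably many ubiquitous sets. The open set \<open>G\<close> is the plane for the large intersection
  property, and a small ball for the dimension on the torus.
\<close>

lemma dim_Inter_similarity_images_ge:
  assumes \<tau>: "0 < \<tau>" and s: "s = min (2 * ln \<bar>l2\<bar> / (\<tau> + ln \<bar>l2\<bar>)) (ln \<bar>l2\<bar> / \<tau>)"
    and f: "\<And>i. similarity (f i)" and G: "open G" "G \<noteq> {}"
  shows "ereal s \<le> hausdorff_dim (G \<inter> (\<Inter>i::nat. f i ` (to_torus -` recurrent_set A \<tau>)))"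
proof -
  define W where "W k = (case prod_decode k of (i, N) \<Rightarrow> f i ` (\<Union>n\<in>{N..}. near_return \<tau> n))" for k
  have "ubiquitous s (W k)" for k
    unfolding W_def using ubiquitous_near_return[OF \<tau> s] f
    by (auto split: prod.splits intro: ubiquitous_similarity_image)
  moreover have "s \<le> 2"
    using interpolation_exponent[of "ln \<bar>l2\<bar>" \<tau> s] l2 \<tau> s by (metis ln_gt_zero)
  ultimately have "ereal s \<le> hausdorff_dim (G \<inter> (\<Inter>k. W k))"
    using G by (intro hausdorff_dim_Inter_ubiquitous) simp_all
  also have "\<dots> \<le> hausdorff_dim (G \<inter> (\<Inter>i. f i ` (to_torus -` recurrent_set A \<tau>)))"
  proof (intro hausdorff_dim_mono Int_mono order_refl subsetI INT_I)
    fix y i assume y: "y \<in> (\<Inter>k. W k)"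
    have yN: "y \<in> f i ` (\<Union>n\<in>{N..}. near_return \<tau> n)" for N
    proof -
      have "y \<in> W (prod_encode (i, N))" using y by blast
      then show ?thesis by (simp add: W_def)
    qed
    obtain c where c: "0 < c" "\<And>x y. dist (f i x) (f i y) = c * dist x y"
      using f[of i] unfolding similarity_def by blast
    obtain x where x: "y = f i x" using yN[of 0] by blast
    have "x \<in> (\<Union>n\<in>{N..}. near_return \<tau> n)" for N
    proof -
      obtain x' where x': "y = f i x'" "x' \<in> (\<Union>n\<in>{N..}. near_return \<tau> n)" using yN[of N] by blast
      have "c * dist x x' = 0" using c(2)[of x x'] x x'(1) by simp
      then have "x = x'" using c(1) by simp
      then show ?thesis using x'(2) by simp
    qed
    then show "y \<in> f i ` (to_torus -` recurrent_set A \<tau>)" unfolding recurrent_set_vimage x by blast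
  qed
  finally show ?thesis .
qed

theorem recurrent_set_dim_and_large_intersection:
  assumes \<tau>: "0 < \<tau>" and s: "s = min (2 * ln \<bar>l2\<bar> / (\<tau> + ln \<bar>l2\<bar>)) (ln \<bar>l2\<bar> / \<tau>)"
  shows "hausdorff_dim (recurrent_set A \<tau>) = ereal s \<and>
    recurrent_set A \<tau> \<in> large_intersection_torus s"
proof
  let ?F = "to_torus -` recurrent_set A \<tau> :: (real ^ 2) set"
  let ?B = "ball 0 (1 / 8) :: (real ^ 2) set"
  have "ereal s \<le> hausdorff_dim (?B \<inter> (\<Inter>i::nat. (\<lambda>x. x) ` ?F))"
    by (intro dim_Inter_similarity_images_ge \<tau> s) (auto simp: similarity_def intro: exI[of _ 1])
  also have "(\<Inter>i::nat. (\<lambda>x. x) ` ?F) = ?F" by simp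
  also have "hausdorff_dim (?B \<inter> ?F) \<le> hausdorff_dim (to_torus ` (?B \<inter> ?F))"
    by (rule hausdorff_dim_expanding_image) (auto intro: dist_le_dist_to_torus)
  also have "\<dots> \<le> hausdorff_dim (recurrent_set A \<tau>)" by (rule hausdorff_dim_mono) auto
  finally show "hausdorff_dim (recurrent_set A \<tau>) = ereal s"
    using hausdorff_dim_recurrent_set_le[OF \<tau> s] by (rule antisym[rotated])
  have "gdelta ?F"
    unfolding recurrent_set_vimage
    by (rule gdelta.intros) (auto intro: open_near_return)
  moreover have "ereal s \<le> hausdorff_dim (\<Inter>i. f i ` ?F)" if "\<forall>i. similarity (f i)" for f :: "nat \<Rightarrow> real ^ 2 \<Rightarrow> real ^ 2"
    using dim_Inter_similarity_images_ge[OF \<tau> s, of f UNIV] that by simp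
  ultimately have "?F \<in> large_intersection s" by (simp add: large_intersection_def)
  moreover have "to_torus ` (?F \<inter> unit_cell) = recurrent_set A \<tau>"
  proof (intro equalityI subsetI)
    fix X assume "X \<in> recurrent_set A \<tau>"
    moreover obtain x where "x \<in> unit_cell" "X = to_torus x"
      using bij_betw_to_torus[where 'd = 2] unfolding bij_betw_def by (metis UNIV_I imageE)
    ultimately show "X \<in> to_torus ` (?F \<inter> unit_cell)" by blast
  qed auto
  ultimately show "recurrent_set A \<tau> \<in> large_intersection_torus s"
    unfolding large_intersection_torus_def by (metis (mono_tags, lifting) mem_Collect_eq)
qed

end

lemma eigenvalue_char_poly:
  fixes M :: "complex ^ 2 ^ 2"
  assumes "eigenvalue M l"
  shows "l\<^sup>2 - (M $ 1 $ 1 + M $ 2 $ 2) * l + (M $ 1 $ 1 * M $ 2 $ 2 - M $ 1 $ 2 * M $ 2 $ 1) = 0"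
    (is "?p = 0")
proof -
  obtain w where w: "w \<noteq> 0" "M *v w = l *s w" using assms by (auto simp: eigenvalue_def)
  have 1: "M $ 1 $ 1 * w $ 1 + M $ 1 $ 2 * w $ 2 = l * w $ 1"
    and 2: "M $ 2 $ 1 * w $ 1 + M $ 2 $ 2 * w $ 2 = l * w $ 2"
    using w(2) by (simp_all add: vec_eq_iff forall_2 matrix_vector_mult_def sum_2)
  have "?p * w $ 1 = 0" "?p * w $ 2 = 0"
    using 1 2 by (algebra, algebra)
  moreover have "w $ 1 \<noteq> 0 \<or> w $ 2 \<noteq> 0" using w(1) by (auto simp: vec_eq_iff forall_2)
  ultimately show ?thesis by auto
qed

text \<open>
  The conjugate of \<open>lam1\<close> is a root of the same real quadratic polynomial and has the wrong modulus to be
  \<open>lam2\<close>, so \<open>lam1\<close> is real.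
\<close>

lemma hyperbolic_matrix_of_eigenvalues:
  fixes A :: "int ^ 2 ^ 2"
  assumes e1: "eigenvalue (map_matrix of_int A) lam1" and e2: "eigenvalue (map_matrix of_int A) lam2"
    and norms: "cmod lam2 > 1" "1 > cmod lam1" "cmod lam1 > 0"
  shows "hyperbolic_matrix A (Re lam1) (Re lam2) \<and> \<bar>Re lam2\<bar> = cmod lam2"
proof -
  define t where "t = A $ 1 $ 1 + A $ 2 $ 2"
  define d where "d = A $ 1 $ 1 * A $ 2 $ 2 - A $ 1 $ 2 * A $ 2 $ 1"
  have r1: "lam1\<^sup>2 - of_int t * lam1 + of_int d = 0" and r2: "lam2\<^sup>2 - of_int t * lam2 + of_int d = 0"
    using eigenvalue_char_poly[OF e1] eigenvalue_char_poly[OF e2] by (simp_all add: t_def d_def)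
  have "lam1 \<noteq> lam2" using norms by auto
  moreover have "(lam1 - lam2) * (lam1 + lam2 - of_int t) = 0" using r1 r2 by algebra
  ultimately have tr: "lam1 + lam2 = of_int t" by simp
  have dt: "lam1 * lam2 = of_int d" using r1 tr by algebra
  have "cnj lam1 ^ 2 - of_int t * cnj lam1 + of_int d = cnj (lam1\<^sup>2 - of_int t * lam1 + of_int d)"
    by simp
  then have rc: "cnj lam1 ^ 2 - of_int t * cnj lam1 + of_int d = 0" using r1 by simp
  have "(cnj lam1 - lam1) * (cnj lam1 - lam2) = 0" using rc tr dt by algebra
  moreover have "cnj lam1 \<noteq> lam2" using norms by (metis complex_mod_cnj less_asym)
  ultimately have "cnj lam1 = lam1" by simp
  then have i1: "Im lam1 = 0" by (simp add: complex_eq_iff)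
  then have i2: "Im lam2 = 0" using tr by (simp add: complex_eq_iff)
  have c1: "lam1 = complex_of_real (Re lam1)" and c2: "lam2 = complex_of_real (Re lam2)"
    using i1 i2 by (simp_all add: complex_eq_iff)
  have n: "\<bar>Re lam1\<bar> = cmod lam1" "\<bar>Re lam2\<bar> = cmod lam2"
    using i1 i2 by (simp_all add: cmod_def)
  have "Re lam1 + Re lam2 = of_int t" using tr by (simp add: complex_eq_iff)
  moreover have "Re lam1 * Re lam2 = of_int d" using dt i1 i2 by (simp add: complex_eq_iff)
  ultimately show ?thesis
    using norms n by (simp add: hyperbolic_matrix_def t_def d_def)
qed

theorem theorem1p1:
  fixes A :: "int ^ 2 ^ 2" and lam\<^sub>1 lam\<^sub>2 :: complex and \<tau> s\<^sub>0 :: real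
  assumes "eigenvalue (map_matrix of_int A) lam\<^sub>1"
    and "eigenvalue (map_matrix of_int A) lam\<^sub>2"
    and "cmod lam\<^sub>2 > 1" and "1 > cmod lam\<^sub>1" and "cmod lam\<^sub>1 > 0"
    and "\<tau> > 0"
    and "s\<^sub>0 = min (2 * ln (cmod lam\<^sub>2) / (\<tau> + ln (cmod lam\<^sub>2))) (ln (cmod lam\<^sub>2) / \<tau>)"
  shows "hausdorff_dim (recurrent_set A \<tau>) = ereal s\<^sub>0
       \<and> recurrent_set A \<tau> \<in> large_intersection_torus s\<^sub>0"
proof -
  have h: "hyperbolic_matrix A (Re lam\<^sub>1) (Re lam\<^sub>2)" and n: "\<bar>Re lam\<^sub>2\<bar> = cmod lam\<^sub>2"
    using hyperbolic_matrix_of_eigenvalues[OF assms(1-5)] by auto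
  show ?thesis
    by (rule hyperbolic_matrix.recurrent_set_dim_and_large_intersection[OF h assms(6)])
      (simp only: n assms(7))
qed

end
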